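(* Let $K$ be the kernel described in the context and assume that the distribution $\mathbb{P}_X$ on $\Omega$ has a density with respect to Lebesgue measure satisfying $\frac{d\mathbb{P}_X}{dx}\le\kappa$ for some $\kappa>0$. Then, with eigenvalues listed in non-increasing order, the eigenvalues $a_m(L_K)$ of the integral operator $L_K$ on $L^2(\Omega,\mathbb{P}_X)$ and the eigenvalues $a_m(C\mathscr{O}_nC)$ of $C\mathscr{O}_nC$ on $L^2([-2L,2L]^d)$ satisfy $a_m(L_K)\le\kappa\,a_m(C\mathscr{O}_nC)$ for all $m$.
   Context: Let $d\ge1$, $L>0$, $\Omega\subseteq[-L,L]^d$ a bounded Lipschitz domain, $s$ a positive integer with $s>d/2$, $\lambda_n>0$, $\mu_n\ge0$. $H^s_{\mathrm{per}}([-2L,2L]^d)$ is the set of $f\in L^2([-2L,2L]^d)$ whose $4L$-periodic extension to $[-4L,4L]^d$ lies in $H^s([-4L,4L]^d)$, normed by $\sum_{|\alpha|\le s}\int_{[-2L,2L]^d}|\partial^\alpha f|^2$. $\mathscr{D}(f)=\sum_{|\alpha|\le s}p_\alpha\partial^\alpha f$ with bounded $p_\alpha:\Omega\to\mathbb{R}$. With $B[u,v]=\lambda_n\sum_{|\alpha|\le s}\int_{[-2L,2L]^d}\partial^\alpha u\partial^\alpha v+\mu_n\int_\Omega\mathscr{D}u\,\mathscr{D}v$, $\mathscr{O}_n$ maps $f\in L^2([-2L,2L]^d)$ to the unique $w\in H^s_{\mathrm{per}}$ with $B[w,\phi]=\int\phi f$ for all $\phi\in H^s_{\mathrm{per}}$;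 it has an $L^2$-orthonormal eigenbasis $(v_m)$ with eigenvalues $a_m>0$, and $K(x,y)=\sum_m a_mv_m(x)v_m(y)$ (the reproducing kernel of $H^s_{\mathrm{per}}$ with squared norm $\lambda_n\|f\|^2_{H^s_{\mathrm{per}}}+\mu_n\|\mathscr{D}f\|^2_{L^2(\Omega)}$). The integral operator is $L_Kf(x)=\int_\Omega K(x,y)f(y)\,d\mathbb{P}_X(y)$ on $L^2(\Omega,\mathbb{P}_X)$. $C$ is the operator on $L^2([-2L,2L]^d)$ given by $Cf=f\mathbf{1}_\Omega$. *)

theory Defs
  imports "HOL-Analysis.Analysis"
begin

definition cube :: "real \<Rightarrow> (real^'d) set" where
  "cube r = {x. \<forall>i. \<bar>x$i\<bar> \<le> r}"

definition ocube :: "real \<Rightarrow> (real^'d) set" where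
  "ocube r = {x. \<forall>i. \<bar>x$i\<bar> < r}"

text \<open>Bounded Lipschitz domain: open, connected, bounded, and locally near every
boundary point the region below the graph of a Lipschitz function (in a suitably
rotated coordinate system, given by the unit normal direction nu).\<close>
definition lipschitz_domain :: "(real^'d) set \<Rightarrow> bool" where
  "lipschitz_domain \<Omega> \<longleftrightarrow> open \<Omega> \<and> connected \<Omega> \<and> \<Omega> \<noteq> {} \<and> bounded \<Omega> \<and>
     (\<forall>x\<in>frontier \<Omega>. \<exists>r>0. \<exists>\<nu> (h :: real^'d \<Rightarrow> real) M.
        norm \<nu> = 1 \<and> (\<forall>y z. \<bar>h y - h z\<bar> \<le> M * norm (y - z)) \<and>
        (\<forall>y\<in>ball x r. y \<in> \<Omega> \<longleftrightarrow> y \<bullet> \<nu> < h (y - (y \<bullet> \<nu>) *\<^sub>R \<nu>)))"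

definition pdiff :: "'d \<Rightarrow> (real^'d \<Rightarrow> real) \<Rightarrow> real^'d \<Rightarrow> real" where
  "pdiff i f x = deriv (\<lambda>t. f (x + t *\<^sub>R axis i 1)) 0"

fun pdiffs :: "'d list \<Rightarrow> (real^'d \<Rightarrow> real) \<Rightarrow> real^'d \<Rightarrow> real" where
  "pdiffs [] f = f"
| "pdiffs (i # is) f = pdiff i (pdiffs is f)"

definition smooth_fun :: "(real^'d \<Rightarrow> real) \<Rightarrow> bool" where
  "smooth_fun f \<longleftrightarrow> (\<forall>is. continuous_on UNIV (pdiffs is f) \<and>
     (\<forall>i x. (\<lambda>t. pdiffs is f (x + t *\<^sub>R axis i 1)) differentiable (at 0)))"

definition test_fun :: "(real^'d) set \<Rightarrow> (real^'d \<Rightarrow> real) \<Rightarrow> bool" where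
  "test_fun U \<phi> \<longleftrightarrow> smooth_fun \<phi> \<and> compact (closure {x. \<phi> x \<noteq> 0}) \<and>
     closure {x. \<phi> x \<noteq> 0} \<subseteq> U"

definition mi_order :: "('d::finite \<Rightarrow> nat) \<Rightarrow> nat" where
  "mi_order \<alpha> = (\<Sum>i\<in>UNIV. \<alpha> i)"

definition mi_list :: "('d::finite \<Rightarrow> nat) \<Rightarrow> 'd list" where
  "mi_list \<alpha> = (SOME l. \<forall>i. count_list l i = \<alpha> i)"

definition sq_int :: "'a measure \<Rightarrow> ('a \<Rightarrow> real) \<Rightarrow> bool" where
  "sq_int M f \<longleftrightarrow> f \<in> borel_measurable M \<and> integrable M (\<lambda>x. (f x)\<^sup>2)"

definition loc_int :: "(real^'d) set \<Rightarrow> (real^'d \<Rightarrow> real) \<Rightarrow> bool" where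
  "loc_int U f \<longleftrightarrow> (\<forall>C. compact C \<and> C \<subseteq> U \<longrightarrow> set_integrable lebesgue C f)"

definition weak_deriv :: "(real^'d::finite) set \<Rightarrow> ('d \<Rightarrow> nat) \<Rightarrow> (real^'d \<Rightarrow> real)
    \<Rightarrow> (real^'d \<Rightarrow> real) \<Rightarrow> bool" where
  "weak_deriv U \<alpha> f g \<longleftrightarrow> loc_int U f \<and> loc_int U g \<and>
     (\<forall>\<phi>. test_fun U \<phi> \<longrightarrow>
        (LINT x:U|lebesgue. f x * pdiffs (mi_list \<alpha>) \<phi> x)
          = (-1) ^ mi_order \<alpha> * (LINT x:U|lebesgue. g x * \<phi> x))"

definition wd :: "(real^'d::finite) set \<Rightarrow> ('d \<Rightarrow> nat) \<Rightarrow> (real^'d \<Rightarrow> real) \<Rightarrow> real^'d \<Rightarrow> real" where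
  "wd U \<alpha> f = (SOME g. weak_deriv U \<alpha> f g)"

definition in_Hs :: "(real^'d::finite) set \<Rightarrow> nat \<Rightarrow> (real^'d \<Rightarrow> real) \<Rightarrow> bool" where
  "in_Hs U s f \<longleftrightarrow> sq_int (lebesgue_on U) f \<and>
     (\<forall>\<alpha>. mi_order \<alpha> \<le> s \<longrightarrow> (\<exists>g. weak_deriv U \<alpha> f g \<and> sq_int (lebesgue_on U) g))"

definition perext :: "real \<Rightarrow> (real^'d \<Rightarrow> real) \<Rightarrow> real^'d \<Rightarrow> real" where
  "perext L f = (\<lambda>x. f (\<chi> i. x$i - 4 * L * of_int \<lfloor>(x$i + 2 * L) / (4 * L)\<rfloor>))"

definition Hper :: "real \<Rightarrow> nat \<Rightarrow> (real^'d::finite \<Rightarrow> real) set" where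
  "Hper L s = {f. sq_int (lebesgue_on (cube (2 * L))) f \<and> in_Hs (ocube (4 * L)) s (perext L f)}"

definition Dper :: "real \<Rightarrow> ('d::finite \<Rightarrow> nat) \<Rightarrow> (real^'d \<Rightarrow> real) \<Rightarrow> real^'d \<Rightarrow> real" where
  "Dper L \<alpha> f = wd (ocube (4 * L)) \<alpha> (perext L f)"

definition Dop :: "real \<Rightarrow> nat \<Rightarrow> (('d::finite \<Rightarrow> nat) \<Rightarrow> real^'d \<Rightarrow> real)
    \<Rightarrow> (real^'d \<Rightarrow> real) \<Rightarrow> real^'d \<Rightarrow> real" where
  "Dop L s p f = (\<lambda>x. \<Sum>\<alpha>\<in>{\<alpha>. mi_order \<alpha> \<le> s}. p \<alpha> x * Dper L \<alpha> f x)"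

definition Bform :: "real \<Rightarrow> nat \<Rightarrow> (real^'d::finite) set \<Rightarrow> (('d \<Rightarrow> nat) \<Rightarrow> real^'d \<Rightarrow> real)
    \<Rightarrow> real \<Rightarrow> real \<Rightarrow> (real^'d \<Rightarrow> real) \<Rightarrow> (real^'d \<Rightarrow> real) \<Rightarrow> real" where
  "Bform L s \<Omega> p lamn mun u v =
     lamn * (\<Sum>\<alpha>\<in>{\<alpha>. mi_order \<alpha> \<le> s}.
              LINT x:cube (2 * L)|lebesgue. Dper L \<alpha> u x * Dper L \<alpha> v x)
     + mun * (LINT x:\<Omega>|lebesgue. Dop L s p u x * Dop L s p v x)"

definition On :: "real \<Rightarrow> nat \<Rightarrow> (real^'d::finite) set \<Rightarrow> (('d \<Rightarrow> nat) \<Rightarrow> real^'d \<Rightarrow> real)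
    \<Rightarrow> real \<Rightarrow> real \<Rightarrow> (real^'d \<Rightarrow> real) \<Rightarrow> real^'d \<Rightarrow> real" where
  "On L s \<Omega> p lamn mun f = (SOME w. w \<in> Hper L s \<and>
     (\<forall>\<phi>\<in>Hper L s. Bform L s \<Omega> p lamn mun w \<phi> = (LINT x:cube (2 * L)|lebesgue. \<phi> x * f x)))"

definition COC :: "real \<Rightarrow> nat \<Rightarrow> (real^'d::finite) set \<Rightarrow> (('d \<Rightarrow> nat) \<Rightarrow> real^'d \<Rightarrow> real)
    \<Rightarrow> real \<Rightarrow> real \<Rightarrow> (real^'d \<Rightarrow> real) \<Rightarrow> real^'d \<Rightarrow> real" where
  "COC L s \<Omega> p lamn mun f =
     (\<lambda>x. indicator \<Omega> x * On L s \<Omega> p lamn mun (\<lambda>y. indicator \<Omega> y * f y) x)"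

definition eigenvalues_desc :: "'a measure \<Rightarrow> (('a \<Rightarrow> real) \<Rightarrow> 'a \<Rightarrow> real) \<Rightarrow> (nat \<Rightarrow> real) \<Rightarrow> bool" where
  "eigenvalues_desc M T a \<longleftrightarrow> antimono a \<and> (\<forall>m. 0 \<le> a m) \<and>
     (\<exists>e. (\<forall>m. sq_int M (e m)) \<and>
          (\<forall>m k. (\<integral>x. e m x * e k x \<partial>M) = (if m = k then 1 else 0)) \<and>
          (\<forall>m. AE x in M. T (e m) x = a m * e m x) \<and>
          (\<forall>f. sq_int M f \<longrightarrow> sq_int M (T f) \<and>
               (\<lambda>N. \<integral>x. (T f x - (\<Sum>m<N. a m * (\<integral>y. f y * e m y \<partial>M) * e m x))\<^sup>2 \<partial>M)
                 \<longlonglongrightarrow> 0))"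

definition kernelK :: "(nat \<Rightarrow> real) \<Rightarrow> (nat \<Rightarrow> 'a \<Rightarrow> real) \<Rightarrow> 'a \<Rightarrow> 'a \<Rightarrow> real" where
  "kernelK av v x y = (\<Sum>m. av m * v m x * v m y)"

definition intop :: "'a measure \<Rightarrow> ('a \<Rightarrow> 'a \<Rightarrow> real) \<Rightarrow> ('a \<Rightarrow> real) \<Rightarrow> 'a \<Rightarrow> real" where
  "intop P K f = (\<lambda>x. \<integral>y. K x y * f y \<partial>P)"

end

theory Submission
  imports Defs
begin

text \<open>
  Let \<open>B\<close> be the energy form, so that \<open>B (O\<^sub>n h) \<phi> = \<langle>\<phi>, h\<rangle>\<close>. If \<open>f\<close> lies in the span of the first
  \<open>m + 1\<close> eigenfunctions of \<open>L\<^sub>K\<close> and \<open>h = \<rho> f\<close> is orthogonal to the first \<open>m\<close> eigenfunctions of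
  \<open>C O\<^sub>n C\<close>, then
  \<open>a\<^sub>m \<parallel>f\<parallel>\<^sup>2 \<le> \<langle>L\<^sub>K f, f\<rangle> = \<Sum>k. av\<^sub>k \<langle>v\<^sub>k, h\<rangle>\<^sup>2 \<le> B (O\<^sub>n h) (O\<^sub>n h) = \<langle>O\<^sub>n h, h\<rangle> \<le> b\<^sub>m \<parallel>h\<parallel>\<^sup>2 \<le> \<kappa> b\<^sub>m \<parallel>f\<parallel>\<^sup>2\<close>;
  the middle inequality is Bessel's for the \<open>B\<close>-orthonormal system \<open>O\<^sub>n v\<^sub>k / \<surd>av\<^sub>k\<close>.

  Two analytic facts make this rigorous. The operator \<open>O\<^sub>n\<close> is well defined because the periodic
  Sobolev space is complete, which needs that weak derivatives are unique and inherit periodicity.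
  The kernel series converges because point evaluation on \<open>\<Omega>\<close> is \<open>B\<close>-bounded when \<open>s > d / 2\<close>: a
  mollifier \<open>\<eta>\<close> with \<open>\<eta> - 2 \<eta> (2 \<cdot>) = \<theta> ^ (s)\<close> for a compactly supported \<open>\<theta>\<close> lets one pass from scale
  \<open>\<epsilon>\<close> to \<open>\<epsilon> / 2\<close>, one coordinate at a time, at the cost of \<open>\<epsilon> ^ (s - d / 2)\<close> times the norm of a pure
  \<open>s\<close>-th derivative, and these costs are summable over dyadic scales.
\<close>

section \<open>Square-integrable functions\<close>

text \<open>The two operators act on different spaces, \<open>L^2 (P_X)\<close> and
  \<open>L^2\<close> of the cube, so their quadratic forms cannot be compared on one common vector.
  Multiplication by the density, \<open>f \<mapsto> \<rho> f\<close>, carries vectors across, and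
  \<open>\<rho>^2 \<le> \<kappa> \<rho>\<close> bounds its squared norm by \<kappa>; this is where
  the factor \<kappa> comes from. A dimension count takes the place of the min-max theorem. The
  second obstacle is the gap between pointwise and almost everywhere. The kernel is a pointwise
  series in fixed representatives \<open>v k\<close>, while weak derivatives and \<open>On\<close>
  are selected by \<open>SOME\<close>, so every link between them holds only a.e. Boundedness of
  evaluation must therefore be proved for whole orthonormal systems at once, outside one null set,
  and not for one function at a time. The mollifiers are one-sided, supported in
  \<open>x + [0, e]^d\<close>. For x in \<open>cube L\<close> and \<open>e \<le> L\<close> they stay
  inside \<open>cube (2 * L)\<close>, where the periodic extension is still u itself.\<close>

lemma discriminant_le:
  fixes A B D :: real
  assumes "\<And>t. A + 2 * t * D + t\<^sup>2 * B \<ge> 0"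
  shows "D\<^sup>2 \<le> A * B"
proof (cases "B = 0")
  case True
  have "D = 0"
  proof (rule ccontr)
    assume "D \<noteq> 0"
    \<comment> \<open>This t makes the polynomial equal to -1.\<close>
    then show False
      using assms[of "(- A - 1) / (2 * D)"] True by (simp add: field_simps)
  qed
  then show ?thesis by (simp add: True)
next
  case False
  have "B \<ge> 0"
  proof (rule ccontr)
    assume B: "\<not> B \<ge> 0"
    \<comment> \<open>Chosen so that \<open>t \<ge> 1\<close> and \<open>t * (- B)\<close> exceeds
      \<open>\<bar>A\<bar> + 2 * \<bar>D\<bar>\<close>; after one more factor t the quadratic term
      outweighs the other two.\<close>
    define t where "t = (\<bar>A\<bar> + 2 * \<bar>D\<bar>) / (- B) + 1"
    have t1: "t \<ge> 1" and tB: "t * (- B) = \<bar>A\<bar> + 2 * \<bar>D\<bar> - B"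
      using B by (auto simp: t_def field_simps)
    have "t\<^sup>2 * (- B) = t * (\<bar>A\<bar> + 2 * \<bar>D\<bar> - B)"
      by (metis power2_eq_square mult.assoc tB)
    also have "\<dots> = t * \<bar>A\<bar> + 2 * (t * \<bar>D\<bar>) + t * (- B)" by (simp add: algebra_simps)
    finally have e: "A + 2 * t * D + t\<^sup>2 * B
        = A - t * \<bar>A\<bar> + 2 * (t * D - t * \<bar>D\<bar>) - t * (- B)"
      by (simp add: algebra_simps)
    have aux: "A - x + 2 * (y - z) - w < 0" if "A \<le> x" "y \<le> z" "0 < w" for x y z w
      using that by argo
    have "A \<le> t * \<bar>A\<bar>"
      using t1 mult_right_mono[of 1 t "\<bar>A\<bar>"] by simp
    moreover have "t * D \<le> t * \<bar>D\<bar>" using t1 by (intro mult_left_mono) auto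
    moreover have "t * (- B) > 0" using t1 B by (intro mult_pos_pos) auto
    ultimately have "A - t * \<bar>A\<bar> + 2 * (t * D - t * \<bar>D\<bar>) - t * (- B) < 0"
      using aux by blast
    then show False using assms[of t] unfolding e by simp
  qed
  with False have B: "B > 0" by simp
  have "A + 2 * (- D / B) * D + (- D / B)\<^sup>2 * B = A - D\<^sup>2 / B"
    using B by (simp add: field_simps power2_eq_square)
  with assms[of "- D / B"] have "D\<^sup>2 / B \<le> A" by simp
  then show ?thesis using B by (simp add: field_simps)
qed

lemma sq_int_measurable: "sq_int M f \<Longrightarrow> f \<in> borel_measurable M"
  by (simp add: sq_int_def)

lemma sq_int_mult:
  assumes "sq_int M f" "sq_int M g"
  shows "integrable M (\<lambda>x. f x * g x)"
proof (rule Bochner_Integration.integrable_bound)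
  show "integrable M (\<lambda>x. (f x)\<^sup>2 + (g x)\<^sup>2)" using assms by (simp add: sq_int_def)
  show "(\<lambda>x. f x * g x) \<in> borel_measurable M"
    using assms[THEN sq_int_measurable] by measurable
  have "\<bar>a * b\<bar> \<le> a\<^sup>2 + b\<^sup>2" for a b :: real
  proof -
    have "2 * (\<bar>a\<bar> * \<bar>b\<bar>) \<le> a\<^sup>2 + b\<^sup>2"
      using zero_le_power2[of "\<bar>a\<bar> - \<bar>b\<bar>"] by (simp add: power2_diff)
    moreover have "\<bar>a\<bar> * \<bar>b\<bar> \<ge> 0" by simp
    ultimately show ?thesis unfolding abs_mult by linarith
  qed
  then show "AE x in M. norm (f x * g x) \<le> norm ((f x)\<^sup>2 + (g x)\<^sup>2)"
    by (auto intro!: AE_I2)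
qed

lemma sq_int_cmult: "sq_int M f \<Longrightarrow> sq_int M (\<lambda>x. c * f x)"
  by (auto simp: sq_int_def power_mult_distrib)

lemma sq_int_add:
  assumes "sq_int M f" "sq_int M g" shows "sq_int M (\<lambda>x. f x + g x)"
  using assms sq_int_mult[OF assms]
  by (auto simp: sq_int_def power2_sum mult.assoc)

lemma sq_int_lincomb:
  assumes "sq_int M f" "sq_int M g" shows "sq_int M (\<lambda>x. c * f x + g x)"
  using assms by (intro sq_int_add sq_int_cmult)

lemma sq_int_diff:
  assumes "sq_int M f" "sq_int M g" shows "sq_int M (\<lambda>x. f x - g x)"
  using sq_int_lincomb[OF assms(2,1), of "-1"] by simp

lemma sq_int_zero: "sq_int M (\<lambda>x. 0)"
  by (simp add: sq_int_def)

lemma sq_int_sum: "(\<And>i. i \<in> I \<Longrightarrow> sq_int M (f i)) \<Longrightarrow> sq_int M (\<lambda>x. \<Sum>i\<in>I. f i x)"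
  by (induction I rule: infinite_finite_induct) (auto intro: sq_int_add sq_int_zero)

lemma sq_int_AE_cong:
  assumes "sq_int M f" "g \<in> borel_measurable M" "AE x in M. g x = f x"
  shows "sq_int M g"
proof -
  have "f \<in> borel_measurable M" using assms(1) by (rule sq_int_measurable)
  with assms(2) have "integrable M (\<lambda>x. (g x)\<^sup>2) \<longleftrightarrow> integrable M (\<lambda>x. (f x)\<^sup>2)"
    using assms(3) by (intro integrable_cong_AE) auto
  then show ?thesis using assms by (simp add: sq_int_def)
qed

lemma sq_int_bounded:
  assumes "finite_measure M" "f \<in> borel_measurable M" "\<And>x. x \<in> space M \<Longrightarrow> \<bar>f x\<bar> \<le> C"
  shows "sq_int M f"
  unfolding sq_int_def
proof
  interpret finite_measure M by fact
  show "integrable M (\<lambda>x. (f x)\<^sup>2)"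
    using assms(2,3) by (intro integrable_const_bound[where B = "C\<^sup>2"])
      (auto intro!: AE_I2 abs_le_square_iff[THEN iffD1] order_trans[OF _ abs_ge_self])
qed fact

lemma sq_int_mult_bounded:
  assumes "sq_int M f" "g \<in> borel_measurable M" "\<And>x. x \<in> space M \<Longrightarrow> \<bar>g x\<bar> \<le> C"
  shows "sq_int M (\<lambda>x. g x * f x)"
  unfolding sq_int_def
proof
  show m: "(\<lambda>x. g x * f x) \<in> borel_measurable M"
    using assms(2) sq_int_measurable[OF assms(1)] by measurable
  show "integrable M (\<lambda>x. (g x * f x)\<^sup>2)"
  proof (rule Bochner_Integration.integrable_bound)
    show "integrable M (\<lambda>x. C\<^sup>2 * (f x)\<^sup>2)" using assms(1) by (simp add: sq_int_def)
    show "AE x in M. norm ((g x * f x)\<^sup>2) \<le> norm (C\<^sup>2 * (f x)\<^sup>2)"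
      using assms(3)
      by (auto intro!: AE_I2 mult_right_mono abs_le_square_iff[THEN iffD1]
          order_trans[OF _ abs_ge_self] simp: power_mult_distrib)
  qed (use m in measurable)
qed

lemma sq_int_integrable:
  assumes "finite_measure M" "sq_int M f"
  shows "integrable M f"
  using sq_int_mult[OF assms(2) sq_int_bounded[of M "\<lambda>_. 1" 1]] assms(1) by simp

lemma sq_int_expand:
  assumes "sq_int M f" "sq_int M g"
  shows "(\<integral>x. (f x + t * g x)\<^sup>2 \<partial>M)
    = (\<integral>x. (f x)\<^sup>2 \<partial>M) + 2 * t * (\<integral>x. f x * g x \<partial>M) + t\<^sup>2 * (\<integral>x. (g x)\<^sup>2 \<partial>M)"
proof -
  have "(\<integral>x. (f x + t * g x)\<^sup>2 \<partial>M)
      = (\<integral>x. (f x)\<^sup>2 + ((2 * t) * (f x * g x) + t\<^sup>2 * (g x)\<^sup>2) \<partial>M)"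
    by (simp add: power2_sum power_mult_distrib algebra_simps)
  also have "\<dots> = (\<integral>x. (f x)\<^sup>2 \<partial>M) + ((2 * t) * (\<integral>x. f x * g x \<partial>M) + t\<^sup>2 * (\<integral>x. (g x)\<^sup>2 \<partial>M))"
    using assms sq_int_mult[OF assms] by (simp add: sq_int_def)
  finally show ?thesis by simp
qed

lemma sq_int_Cauchy_Schwarz:
  assumes "sq_int M f" "sq_int M g"
  shows "(\<integral>x. f x * g x \<partial>M)\<^sup>2 \<le> (\<integral>x. (f x)\<^sup>2 \<partial>M) * (\<integral>x. (g x)\<^sup>2 \<partial>M)"
proof (rule discriminant_le)
  fix t
  have "0 \<le> (\<integral>x. (f x + t * g x)\<^sup>2 \<partial>M)" by simp
  then show "0 \<le> (\<integral>x. (f x)\<^sup>2 \<partial>M) + 2 * t * (\<integral>x. f x * g x \<partial>M) + t\<^sup>2 * (\<integral>x. (g x)\<^sup>2 \<partial>M)"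
    by (simp add: sq_int_expand[OF assms])
qed

text \<open>Norm convergence implies convergence of pairings. Weak-derivative identities and
  spectral expansions are passed to the limit this way.\<close>

lemma sq_int_tendsto_mult:
  assumes F: "\<And>n. sq_int M (F n)" and G: "sq_int M G" and H: "sq_int M H"
    and lim: "(\<lambda>n. \<integral>x. (F n x - G x)\<^sup>2 \<partial>M) \<longlonglongrightarrow> 0"
  shows "(\<lambda>n. \<integral>x. F n x * H x \<partial>M) \<longlonglongrightarrow> (\<integral>x. G x * H x \<partial>M)"
proof -
  have "(\<lambda>n. (\<integral>x. (F n x - G x) * H x \<partial>M)\<^sup>2) \<longlonglongrightarrow> 0"
  proof (rule tendsto_sandwich)
    show "\<forall>\<^sub>F n in sequentially. 0 \<le> (\<integral>x. (F n x - G x) * H x \<partial>M)\<^sup>2" by simp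
    show "\<forall>\<^sub>F n in sequentially. (\<integral>x. (F n x - G x) * H x \<partial>M)\<^sup>2
        \<le> (\<integral>x. (F n x - G x)\<^sup>2 \<partial>M) * (\<integral>x. (H x)\<^sup>2 \<partial>M)"
      using F G H by (intro always_eventually allI sq_int_Cauchy_Schwarz sq_int_diff)
    show "(\<lambda>n. (\<integral>x. (F n x - G x)\<^sup>2 \<partial>M) * (\<integral>x. (H x)\<^sup>2 \<partial>M)) \<longlonglongrightarrow> 0"
      using tendsto_mult[OF lim tendsto_const] by simp
  qed auto
  then have "(\<lambda>n. \<integral>x. (F n x - G x) * H x \<partial>M) \<longlonglongrightarrow> 0"
    using tendsto_real_sqrt[of "\<lambda>n. (\<integral>x. (F n x - G x) * H x \<partial>M)\<^sup>2" 0 sequentially]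
    by (simp add: tendsto_rabs_zero_iff)
  moreover have "(\<integral>x. (F n x - G x) * H x \<partial>M) = (\<integral>x. F n x * H x \<partial>M) - (\<integral>x. G x * H x \<partial>M)" for n
    using sq_int_mult[OF F[of n] H] sq_int_mult[OF G H] by (simp add: left_diff_distrib)
  ultimately show ?thesis by (simp add: LIM_zero_iff)
qed

text \<open>Riesz-Fischer on a finite measure space: Cauchy-Schwarz against 1 makes the sequence
  Cauchy in L1, an L1-Cauchy sequence has an a.e. convergent subsequence, and Fatou's lemma bounds
  the L2 distance from each \<open>F n\<close> to the limit of that subsequence.\<close>

lemma sq_int_complete:
  fixes F :: "nat \<Rightarrow> 'a \<Rightarrow> real"
  assumes fin: "finite_measure M" and F: "\<And>n. sq_int M (F n)"
    and cau: "\<And>e. e > 0 \<Longrightarrow> \<exists>N. \<forall>i\<ge>N. \<forall>j\<ge>N. (\<integral>x. (F i x - F j x)\<^sup>2 \<partial>M) < e"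
  obtains G where "sq_int M G" "(\<lambda>n. \<integral>x. (F n x - G x)\<^sup>2 \<partial>M) \<longlonglongrightarrow> 0"
proof -
  interpret finite_measure M by fact
  have Fm [measurable]: "F n \<in> borel_measurable M" for n using F by (rule sq_int_measurable)
  have L1: "(LINT x|M. norm (F i x - F j x))\<^sup>2 \<le> (\<integral>x. (F i x - F j x)\<^sup>2 \<partial>M) * measure M (space M)" for i j
  proof -
    have "sq_int M (\<lambda>x. \<bar>F i x - F j x\<bar>)"
      using sq_int_diff[OF F[of i] F[of j]] by (auto simp: sq_int_def)
    from sq_int_Cauchy_Schwarz[OF this sq_int_bounded[of M "\<lambda>_. 1" 1]] fin
    show ?thesis by simp
  qed
  obtain r where r: "strict_mono r" and rC: "AE x in M. Cauchy (\<lambda>i. F (r i) x)"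
  proof (rule cauchy_L1_AE_cauchy_subseq[of M F])
    show "integrable M (F n)" for n using fin F by (rule sq_int_integrable)
    fix e :: real assume e: "e > 0"
    have mp: "measure M (space M) + 1 > 0" by (simp add: add_nonneg_pos)
    from cau[of "e\<^sup>2 / (measure M (space M) + 1)"] e mp
    obtain N where N: "\<And>i j. i \<ge> N \<Longrightarrow> j \<ge> N \<Longrightarrow>
        (\<integral>x. (F i x - F j x)\<^sup>2 \<partial>M) < e\<^sup>2 / (measure M (space M) + 1)"
      by (auto simp: zero_less_divide_iff)
    have "LINT x|M. norm (F i x - F j x) < e" if "i \<ge> N" "j \<ge> N" for i j
    proof -
      have "(LINT x|M. norm (F i x - F j x))\<^sup>2 \<le> (\<integral>x. (F i x - F j x)\<^sup>2 \<partial>M) * (measure M (space M) + 1)"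
        by (rule order_trans[OF L1]) (simp add: mult_left_mono)
      also have "\<dots> < e\<^sup>2" using N[OF that] mp by (simp add: field_simps)
      finally show ?thesis using e by (rule power_less_imp_less_base[OF _ less_imp_le])
    qed
    then show "\<exists>N. \<forall>i\<ge>N. \<forall>j\<ge>N. LINT x|M. norm (F i x - F j x) < e" by blast
  qed auto
  define G where "G x = lim (\<lambda>i. F (r i) x)" for x
  have Gm [measurable]: "G \<in> borel_measurable M"
    unfolding G_def by measurable
  have lim: "AE x in M. (\<lambda>i. F (r i) x) \<longlonglongrightarrow> G x"
    using rC by eventually_elim (auto simp: G_def convergent_LIMSEQ_iff[symmetric] Cauchy_convergent_iff)
  have bnd: "(\<integral>\<^sup>+x. ennreal ((F n x - G x)\<^sup>2) \<partial>M) \<le> ennreal e"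
    if N: "\<And>i j. i \<ge> N \<Longrightarrow> j \<ge> N \<Longrightarrow> (\<integral>x. (F i x - F j x)\<^sup>2 \<partial>M) < e" and n: "n \<ge> N" for n N e
  proof -
    have "(\<integral>\<^sup>+x. ennreal ((F n x - G x)\<^sup>2) \<partial>M)
        = (\<integral>\<^sup>+x. liminf (\<lambda>i. ennreal ((F n x - F (r i) x)\<^sup>2)) \<partial>M)"
      using lim
    proof (intro nn_integral_cong_AE, eventually_elim)
      case (elim x)
      then have "(\<lambda>i. ennreal ((F n x - F (r i) x)\<^sup>2)) \<longlonglongrightarrow> ennreal ((F n x - G x)\<^sup>2)"
        by (intro tendsto_intros tendsto_ennrealI)
      then show ?case by (rule lim_imp_Liminf[OF trivial_limit_sequentially, symmetric])
    qed
    also have "\<dots> \<le> liminf (\<lambda>i. \<integral>\<^sup>+x. ennreal ((F n x - F (r i) x)\<^sup>2) \<partial>M)"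
      by (rule nn_integral_liminf) measurable
    also have "\<dots> \<le> ennreal e"
    proof -
      have "(\<integral>\<^sup>+x. ennreal ((F n x - F (r i) x)\<^sup>2) \<partial>M) \<le> ennreal e" if "i \<ge> N" for i
      proof -
        have "r i \<ge> N" using that seq_suble[OF r, of i] by linarith
        then show ?thesis
          using sq_int_diff[OF F[of n] F[of "r i"]] N[OF n, of "r i"]
          by (subst nn_integral_eq_integral) (auto simp: sq_int_def intro!: ennreal_leI)
      qed
      then have "\<forall>\<^sub>F i in sequentially. (\<integral>\<^sup>+x. ennreal ((F n x - F (r i) x)\<^sup>2) \<partial>M) \<le> ennreal e"
        by (auto simp: eventually_sequentially)
      then show ?thesis by (rule Liminf_le[OF trivial_limit_sequentially])
    qed
    finally show ?thesis .
  qed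
  have sq: "sq_int M (\<lambda>x. F n x - G x) \<and> (\<integral>x. (F n x - G x)\<^sup>2 \<partial>M) \<le> e"
    if "\<And>i j. i \<ge> N \<Longrightarrow> j \<ge> N \<Longrightarrow> (\<integral>x. (F i x - F j x)\<^sup>2 \<partial>M) < e" "n \<ge> N" "e > 0" for n N e
  proof -
    have b: "(\<integral>\<^sup>+x. ennreal ((F n x - G x)\<^sup>2) \<partial>M) \<le> ennreal e" using bnd that(1,2) by blast
    have i: "integrable M (\<lambda>x. (F n x - G x)\<^sup>2)"
      using b by (intro integrableI_bounded) (auto simp: less_top[symmetric] top_unique)
    with b \<open>e > 0\<close> show ?thesis
      by (subst (asm) nn_integral_eq_integral) (auto simp: sq_int_def)
  qed
  obtain N1 where N1: "\<And>i j. i \<ge> N1 \<Longrightarrow> j \<ge> N1 \<Longrightarrow> (\<integral>x. (F i x - F j x)\<^sup>2 \<partial>M) < 1"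
    using cau[of 1] by auto
  have "sq_int M (\<lambda>x. F N1 x - G x)" using sq[OF N1, of N1] by auto
  from sq_int_diff[OF F[of N1] this] have G: "sq_int M G" by simp
  have "(\<lambda>n. \<integral>x. (F n x - G x)\<^sup>2 \<partial>M) \<longlonglongrightarrow> 0"
  proof (rule LIMSEQ_I)
    fix e :: real assume e: "e > 0"
    then obtain N where "\<And>i j. i \<ge> N \<Longrightarrow> j \<ge> N \<Longrightarrow> (\<integral>x. (F i x - F j x)\<^sup>2 \<partial>M) < e / 2"
      using cau[of "e / 2"] by auto
    from sq[OF this] e have "(\<integral>x. (F n x - G x)\<^sup>2 \<partial>M) \<le> e / 2" if "n \<ge> N" for n using that by auto
    with e show "\<exists>N. \<forall>n\<ge>N. norm ((\<integral>x. (F n x - G x)\<^sup>2 \<partial>M) - 0) < e"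
      by (intro exI[of _ N]) fastforce
  qed
  with G show ?thesis by (rule that)
qed

text \<open>More unknowns than equations, by Gaussian elimination: a row with nonzero last entry is
  the pivot, eliminates the last unknown from the others, and afterwards determines its
  value.\<close>

lemma nontrivial_solution:
  fixes A :: "nat \<Rightarrow> nat \<Rightarrow> real"
  shows "\<exists>c. (\<exists>k\<le>m. c k \<noteq> 0) \<and> (\<forall>i<m. (\<Sum>k\<le>m. A i k * c k) = 0)"
proof (induction m arbitrary: A)
  case 0
  show ?case by (intro exI[of _ "\<lambda>_. 1"]) auto
next
  case (Suc m)
  show ?case
  proof (cases "\<forall>i<Suc m. A i (Suc m) = 0")
    case True
    then show ?thesis
      by (intro exI[of _ "\<lambda>k. if k = Suc m then 1 else 0"]) (auto simp: if_distrib cong: if_cong)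
  next
    case False
    then obtain p where p: "p < Suc m" "A p (Suc m) \<noteq> 0" by auto
    \<comment> \<open>Numbers the equations other than the pivot p by \<open>0..<m\<close>: the last
      equation, number m, moves into the slot vacated by p.\<close>
    define \<tau> where "\<tau> i = (if i = p then m else i)" for i
    define A' where "A' i k = A (\<tau> i) k - A (\<tau> i) (Suc m) / A p (Suc m) * A p k" for i k
    from Suc.IH[of A'] obtain c where c: "\<exists>k\<le>m. c k \<noteq> 0" "\<And>i. i < m \<Longrightarrow> (\<Sum>k\<le>m. A' i k * c k) = 0"
      by blast
    define d where "d k = (if k = Suc m then - (\<Sum>k\<le>m. A p k * c k) / A p (Suc m) else c k)" for k
    have split: "(\<Sum>k\<le>Suc m. A i k * d k)
        = (\<Sum>k\<le>m. A i k * c k) - A i (Suc m) / A p (Suc m) * (\<Sum>k\<le>m. A p k * c k)" for i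
      by (simp add: d_def)
    have "(\<Sum>k\<le>Suc m. A i k * d k) = 0" if i: "i < Suc m" for i
    proof (cases "i = p")
      case True
      then show ?thesis using p(2) unfolding split by simp
    next
      case False
      define j where "j = (if i = m then p else i)"
      have j: "j < m" "\<tau> j = i" using False i p(1) by (auto simp: j_def \<tau>_def)
      have "(\<Sum>k\<le>m. A' j k * c k)
          = (\<Sum>k\<le>m. A i k * c k) - A i (Suc m) / A p (Suc m) * (\<Sum>k\<le>m. A p k * c k)"
        by (simp add: A'_def j left_diff_distrib sum_subtractf sum_distrib_left mult.assoc)
      with c(2)[OF j(1)] show ?thesis by (simp only: split)
    qed
    moreover have "\<exists>k\<le>Suc m. d k \<noteq> 0"
    proof -
      from c(1) obtain k where "k \<le> m" "c k \<noteq> 0" by blast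
      then show ?thesis by (intro exI[of _ k]) (auto simp: d_def)
    qed
    ultimately show ?thesis by blast
  qed
qed

section \<open>Smooth functions of one variable\<close>

text \<open>As a greatest fixed point, smoothness of a function follows from any family that
  contains it and is closed under differentiation, without counting derivatives.\<close>

coinductive smooth1 :: "(real \<Rightarrow> real) \<Rightarrow> bool" where
  smooth1I: "(\<And>x. (f has_real_derivative f' x) (at x)) \<Longrightarrow> smooth1 f' \<Longrightarrow> smooth1 f"

lemma smooth1_has_deriv:
  assumes "smooth1 f" shows "(f has_real_derivative deriv f x) (at x)"
  using assms by (cases rule: smooth1.cases) (metis DERIV_imp_deriv)

lemma smooth1_deriv:
  assumes "smooth1 f" shows "smooth1 (deriv f)"
  using assms
proof (cases rule: smooth1.cases)
  case (smooth1I f')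
  then have "deriv f = f'" by (auto dest: DERIV_imp_deriv)
  with smooth1I show ?thesis by simp
qed

lemma smooth1_nderiv: "smooth1 f \<Longrightarrow> smooth1 ((deriv ^^ n) f)"
  by (induction n) (auto intro: smooth1_deriv)

lemma smooth1_continuous: "smooth1 f \<Longrightarrow> continuous_on S f"
  by (meson DERIV_isCont continuous_at_imp_continuous_on smooth1_has_deriv)

lemma smooth1_const: "smooth1 (\<lambda>x. c)"
  by (coinduction arbitrary: c) (auto intro!: exI[of _ "\<lambda>x. 0"])

lemma smooth1_ident: "smooth1 (\<lambda>x. x)"
  by (rule smooth1I[where f' = "\<lambda>x. 1"]) (auto intro: smooth1_const)

lemma has_real_derivative_affine:
  assumes "(f has_real_derivative D) (at (a * x + b))"
  shows "((\<lambda>x. f (a * x + b)) has_real_derivative a * D) (at x)"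
proof -
  have "((\<lambda>x. a * x + b) has_real_derivative a) (at x)"
    by (auto intro!: derivative_eq_intros)
  from DERIV_chain2[where g = "\<lambda>x. a * x + b", OF assms this] show ?thesis
    by (simp add: mult.commute)
qed

text \<open>Coinduction needs an invariant that is closed under differentiation, so the
  closure properties of \<open>smooth1\<close> are proved simultaneously.\<close>

inductive smooth_alg :: "(real \<Rightarrow> real) \<Rightarrow> bool" where
  "smooth1 f \<Longrightarrow> smooth_alg f"
| "smooth_alg f \<Longrightarrow> smooth_alg g \<Longrightarrow> smooth_alg (\<lambda>x. f x + g x)"
| "smooth_alg f \<Longrightarrow> smooth_alg g \<Longrightarrow> smooth_alg (\<lambda>x. f x * g x)"
| "smooth_alg f \<Longrightarrow> smooth_alg (\<lambda>x. f (a * x + b))"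
| "smooth_alg f \<Longrightarrow> (\<And>x. f x \<noteq> 0) \<Longrightarrow> smooth_alg (\<lambda>x. inverse (f x))"

lemma smooth_alg_deriv:
  "smooth_alg f \<Longrightarrow> \<exists>f'. (\<forall>x. (f has_real_derivative f' x) (at x)) \<and> smooth_alg f'"
proof (induction rule: smooth_alg.induct)
  case (1 f)
  then show ?case by (meson smooth1_has_deriv smooth1_deriv smooth_alg.intros(1))
next
  case (2 f g)
  then obtain f' g' where "\<forall>x. (f has_real_derivative f' x) (at x)" "smooth_alg f'"
    "\<forall>x. (g has_real_derivative g' x) (at x)" "smooth_alg g'" by blast
  then show ?case
    by (intro exI[of _ "\<lambda>x. f' x + g' x"]) (auto intro!: DERIV_add smooth_alg.intros(2))
next
  case (3 f g)
  then obtain f' g' where "\<forall>x. (f has_real_derivative f' x) (at x)" "smooth_alg f'"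
    "\<forall>x. (g has_real_derivative g' x) (at x)" "smooth_alg g'" by blast
  then show ?case using 3
    by (intro exI[of _ "\<lambda>x. f' x * g x + g' x * f x"])
      (auto intro!: DERIV_mult smooth_alg.intros(2,3))
next
  case (4 f a b)
  then obtain f' where f': "\<forall>x. (f has_real_derivative f' x) (at x)" "smooth_alg f'" by blast
  have "((\<lambda>x. f (a * x + b)) has_real_derivative a * f' (a * x + b)) (at x)" for x
    using f'(1) by (intro has_real_derivative_affine) auto
  with f' show ?case
    by (intro exI[of _ "\<lambda>x. a * f' (a * x + b)"])
      (auto intro!: smooth_alg.intros(3,4) smooth_alg.intros(1)[OF smooth1_const])
next
  case (5 f)
  then obtain f' where f': "\<forall>x. (f has_real_derivative f' x) (at x)" "smooth_alg f'" by blast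
  have "((\<lambda>x. inverse (f x)) has_real_derivative (-1) * (inverse (f x) * (f' x * inverse (f x)))) (at x)" for x
    using 5(2)[of x] DERIV_inverse'[OF f'(1)[rule_format, of x]] by (simp add: mult.assoc)
  moreover have "smooth_alg (\<lambda>x. (-1) * (inverse (f x) * (f' x * inverse (f x))))"
    by (intro smooth_alg.intros(3) smooth_alg.intros(5) smooth_alg.intros(1)[OF smooth1_const] f' 5)
  ultimately show ?case
    by (intro exI[of _ "\<lambda>x. (-1) * (inverse (f x) * (f' x * inverse (f x)))"] conjI allI)
qed

lemma smooth_alg_smooth1: "smooth_alg f \<Longrightarrow> smooth1 f"
proof (coinduction arbitrary: f)
  case (smooth1 f)
  then show ?case using smooth_alg_deriv by blast
qed

lemma smooth1_add: "smooth1 f \<Longrightarrow> smooth1 g \<Longrightarrow> smooth1 (\<lambda>x. f x + g x)"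
  and smooth1_mult: "smooth1 f \<Longrightarrow> smooth1 g \<Longrightarrow> smooth1 (\<lambda>x. f x * g x)"
  and smooth1_affine: "smooth1 f \<Longrightarrow> smooth1 (\<lambda>x. f (a * x + b))"
  and smooth1_inverse: "smooth1 f \<Longrightarrow> (\<And>x. f x \<noteq> 0) \<Longrightarrow> smooth1 (\<lambda>x. inverse (f x))"
  by (rule smooth_alg_smooth1, intro smooth_alg.intros; simp add: smooth_alg.intros)+

lemma smooth1_power: "smooth1 f \<Longrightarrow> smooth1 (\<lambda>x. f x ^ n)"
  by (induction n) (auto intro: smooth1_const smooth1_mult)

section \<open>Iterated derivatives\<close>

lemma nderiv_add:
  assumes "smooth1 f" "smooth1 g"
  shows "(deriv ^^ n) (\<lambda>x. f x + g x) = (\<lambda>x. (deriv ^^ n) f x + (deriv ^^ n) g x)"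
proof (induction n)
  case (Suc n)
  have "deriv (\<lambda>x. (deriv ^^ n) f x + (deriv ^^ n) g x) x
      = deriv ((deriv ^^ n) f) x + deriv ((deriv ^^ n) g) x" for x
    by (intro DERIV_imp_deriv DERIV_add smooth1_has_deriv smooth1_nderiv assms)
  then show ?case by (auto simp: Suc)
qed simp

lemma nderiv_affine:
  assumes "smooth1 f"
  shows "(deriv ^^ n) (\<lambda>x. c * f (a * x + b)) = (\<lambda>x. c * a ^ n * (deriv ^^ n) f (a * x + b))"
proof (induction n)
  case (Suc n)
  have "deriv (\<lambda>x. c * a ^ n * (deriv ^^ n) f (a * x + b)) x
      = c * a ^ Suc n * deriv ((deriv ^^ n) f) (a * x + b)" for x
    using DERIV_cmult[OF has_real_derivative_affine[OF
        smooth1_has_deriv[OF smooth1_nderiv[OF assms, of n], of "a * x + b"]], of "c * a ^ n"]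
    by (intro DERIV_imp_deriv) (simp add: mult_ac)
  then show ?case by (auto simp: Suc)
qed simp

lemma nderiv_cong_open:
  fixes f g :: "real \<Rightarrow> real"
  assumes "open S" "\<And>x. x \<in> S \<Longrightarrow> f x = g x" "x \<in> S"
  shows "(deriv ^^ n) f x = (deriv ^^ n) g x"
  using assms(3)
proof (induction n arbitrary: x)
  case (Suc n)
  have "\<forall>\<^sub>F y in nhds x. (deriv ^^ n) f y = (deriv ^^ n) g y"
    using assms(1) Suc by (auto simp: eventually_nhds)
  then show ?case by (simp add: deriv_cong_ev)
qed (use assms(2) in simp)

lemma nderiv_const: "(deriv ^^ n) (\<lambda>x::real. 0::real) = (\<lambda>x. 0)"
  by (induction n) auto

lemma nderiv_power:
  "n \<le> k \<Longrightarrow> (deriv ^^ n) (\<lambda>x::real. x ^ k / fact k) = (\<lambda>x. x ^ (k - n) / fact (k - n))"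
proof (induction n)
  case (Suc n)
  define m where "m = k - Suc n"
  have m: "k - n = Suc m" using Suc.prems by (simp add: m_def)
  have "deriv (\<lambda>x::real. x ^ Suc m / fact (Suc m)) = (\<lambda>x. x ^ m / fact m)"
  proof
    fix x :: real
    have "((\<lambda>x::real. x ^ Suc m / fact (Suc m)) has_real_derivative x ^ m / fact m) (at x)"
      using DERIV_cdivide[OF DERIV_pow[of "Suc m" x UNIV], of "fact (Suc m)"]
      by (simp add: mult_divide_mult_cancel_left del: power_Suc of_nat_Suc)
    then show "deriv (\<lambda>x::real. x ^ Suc m / fact (Suc m)) x = x ^ m / fact m"
      by (rule DERIV_imp_deriv)
  qed
  with Suc show ?case by (simp add: m m_def[symmetric])
qed simp

section \<open>Flat functions and a smooth step\<close>

definition flat_exp :: "real poly \<Rightarrow> real \<Rightarrow> real" where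
  "flat_exp p x = (if x > 0 then poly p (inverse x) * exp (- inverse x) else 0)"

lemma poly_times_exp_tendsto_0: "((\<lambda>y. poly p y * exp (- y)) \<longlongrightarrow> (0::real)) at_top"
proof -
  have "((\<lambda>y. \<Sum>i\<le>degree p. coeff p i * (y ^ i / exp y)) \<longlongrightarrow> (\<Sum>i\<le>degree p. coeff p i * 0)) at_top"
    by (intro tendsto_sum tendsto_mult tendsto_const tendsto_power_div_exp_0)
  then show ?thesis
    by (simp add: poly_altdef sum_distrib_right exp_minus divide_inverse mult.assoc)
qed

text \<open>With \<open>y = inverse x\<close>, differentiating \<open>p(y) exp(-y)\<close> in x
  produces the factor \<open>- y^2\<close> from y, hence the polynomial \<open>y^2 (p - p')\<close>.
  The family is thus closed under differentiation, which is the invariant needed for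
  coinduction.\<close>

lemma flat_exp_deriv:
  "(flat_exp p has_real_derivative flat_exp ([:0, 0, 1:] * (p - pderiv p)) x) (at x)"
proof -
  consider "x > 0" | "x < 0" | "x = 0" by linarith
  then show ?thesis
  proof cases
    case 1
    have "((\<lambda>x. poly p (inverse x) * exp (- inverse x)) has_real_derivative
        flat_exp ([:0, 0, 1:] * (p - pderiv p)) x) (at x)"
      using 1 by (auto intro!: derivative_eq_intros simp: flat_exp_def algebra_simps power2_eq_square)
    then show ?thesis
      using 1 by (intro has_field_derivative_transform_within_open[where S = "{0<..}" and g = "flat_exp p"
            and f = "\<lambda>x. poly p (inverse x) * exp (- inverse x)"])
        (auto simp: flat_exp_def)
  next
    case 2
    have "((\<lambda>x. 0) has_real_derivative 0) (at x)" by simp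
    then show ?thesis using 2
      by (intro has_field_derivative_transform_within_open[where S = "{..<0}" and f = "\<lambda>x. 0" and g = "flat_exp p"])
        (auto simp: flat_exp_def)
  next
    case 3
    \<comment> \<open>With \<open>t = inverse y\<close> the right difference quotient at 0 is
      \<open>t * poly p t * exp (- t)\<close>; the extra factor t is the shift in
      \<open>pCons 0 p\<close>.\<close>
    have "((\<lambda>y. flat_exp p y / y) \<longlongrightarrow> 0) (at_right 0)"
    proof -
      have "((\<lambda>y. poly (pCons 0 p) (inverse y) * exp (- inverse y)) \<longlongrightarrow> (0::real)) (at_right 0)"
        by (rule filterlim_compose[OF poly_times_exp_tendsto_0 filterlim_inverse_at_top_right])
      then show ?thesis
        by (rule Lim_transform_eventually)
          (auto simp: eventually_at_right_less flat_exp_def divide_inverse intro!: eventually_at_rightI[of 0 1])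
    qed
    moreover have "((\<lambda>y. flat_exp p y / y) \<longlongrightarrow> 0) (at_left 0)"
      by (rule Lim_transform_eventually[OF tendsto_const])
        (auto simp: flat_exp_def intro!: eventually_at_leftI[of "-1"])
    ultimately have "((\<lambda>y. flat_exp p y / y) \<longlongrightarrow> 0) (at 0)"
      by (simp add: filterlim_split_at)
    then show ?thesis using 3 by (simp add: has_field_derivative_iff flat_exp_def)
  qed
qed

lemma smooth1_flat_exp: "smooth1 (flat_exp p)"
  by (coinduction arbitrary: p) (use flat_exp_deriv in blast)

text \<open>The classical quotient \<open>E x / (E x + E (1 - x))\<close>. Its denominator is
  positive because x and 1 - x are never both nonpositive; \<open>1 - x\<close> is written in the
  affine form that the closure rules accept.\<close>

definition smooth_step :: "real \<Rightarrow> real" where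
  "smooth_step x = flat_exp 1 x * inverse (flat_exp 1 x + flat_exp 1 ((-1) * x + 1))"

lemma smooth1_smooth_step: "smooth1 smooth_step"
proof -
  have "flat_exp 1 x + flat_exp 1 ((-1) * x + 1) \<noteq> 0" for x
    by (auto simp: flat_exp_def add_pos_pos pos_add_strict intro!: less_imp_neq[symmetric])
  then show ?thesis
    unfolding smooth_step_def[abs_def]
    by (intro smooth1_mult smooth1_inverse smooth1_add smooth1_affine smooth1_flat_exp)
qed

lemma smooth_step_0: "x \<le> 0 \<Longrightarrow> smooth_step x = 0"
  by (simp add: smooth_step_def flat_exp_def)

lemma smooth_step_1: "x \<ge> 1 \<Longrightarrow> smooth_step x = 1"
  by (simp add: smooth_step_def flat_exp_def)

text \<open>With \<open>g x = \<zeta> x * x ^ (s - 1) / (s - 1)!\<close> for a smooth step \<open>\<zeta>\<close>, homogeneity of the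
  power makes \<open>g x - 2 ^ (1 - s) * g (2 * x)\<close> compactly supported; its \<open>s\<close>-th derivative compares
  the mollifier \<open>\<eta> = g ^ (s)\<close> with its dilation.\<close>

lemma refinable_mollifier:
  assumes s: "s > 0"
  obtains \<eta> \<theta> :: "real \<Rightarrow> real" where "smooth1 \<eta>" "smooth1 \<theta>"
    "\<And>x. x \<notin> {0..1} \<Longrightarrow> \<eta> x = 0" "\<And>x. x \<notin> {0..1} \<Longrightarrow> \<theta> x = 0"
    "(deriv ^^ s) \<theta> = (\<lambda>x. \<eta> x - 2 * \<eta> (2 * x))"
    "integrable lborel \<eta>" "(\<integral>x. \<eta> x \<partial>lborel) = 1"
proof -
  \<comment> \<open>Degree s - 1 is the one for which the derivative of order s - 1 of
    \<open>x ^ k / fact k\<close> is 1 and the next one vanishes: this yields total mass 1 and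
    compact support for \<eta> at the same time.\<close>
  define k where "k = s - 1"
  have sk: "s = Suc k" using s by (simp add: k_def)
  define g where "g x = smooth_step x * (x ^ k * inverse (fact k))" for x :: real
  have g: "smooth1 g"
    unfolding g_def[abs_def]
    by (intro smooth1_mult smooth1_smooth_step smooth1_power smooth1_ident smooth1_const)
  have g_neg: "(deriv ^^ n) g x = 0" if "x < 0" for n x
    using nderiv_cong_open[of "{..<0}" g "\<lambda>x. 0" x n] that
    by (auto simp: nderiv_const g_def smooth_step_0)
  have g_pos: "(deriv ^^ n) g x = (deriv ^^ n) (\<lambda>x. x ^ k / fact k) x" if "x > 1" for n x
    using that by (intro nderiv_cong_open[of "{1<..}"])
      (auto simp: g_def smooth_step_1 divide_inverse)
  have g_top: "(deriv ^^ k) g x = 1" if "x > 1" for x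
    using that by (simp add: g_pos nderiv_power)
  define \<eta> where "\<eta> = (deriv ^^ s) g"
  \<comment> \<open>To the right of 1 the two terms cancel, since
    \<open>2 * (1/2) ^ s * 2 ^ k = 1\<close>; the added 0 gives the argument the affine shape of the
    rules above.\<close>
  define \<theta> where "\<theta> x = g x + (- 2 * (1 / 2) ^ s) * g (2 * x + 0)" for x
  have \<eta>: "smooth1 \<eta>" unfolding \<eta>_def by (rule smooth1_nderiv[OF g])
  have \<eta>_0: "\<eta> x = 0" if "x \<notin> {0..1}" for x
  proof (cases "x < 0")
    case False
    then have "x > 1" using that by auto
    have "(deriv ^^ Suc k) (\<lambda>x::real. x ^ k / fact k) x = 0" for x
      by (simp add: nderiv_power)
    then show ?thesis using \<open>x > 1\<close> g_pos[of x s] by (simp add: \<eta>_def sk)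
  qed (simp add: \<eta>_def g_neg)
  have int: "has_bochner_integral lborel \<eta> 1"
  proof -
    \<comment> \<open>The interval overlaps the support on both sides, so that its end points lie
      where the k-th derivative of g is already 0 and already 1.\<close>
    have "has_bochner_integral lborel (\<lambda>x. \<eta> x * indicator {-1..2} x)
        ((deriv ^^ k) g 2 - (deriv ^^ k) g (-1))"
    proof (rule has_bochner_integral_FTC_Icc_real)
      show "((deriv ^^ k) g has_real_derivative \<eta> x) (at x)" for x
        using smooth1_has_deriv[OF smooth1_nderiv[OF g, of k]] by (simp add: \<eta>_def sk)
      show "isCont \<eta> x" for x
        using smooth1_has_deriv[OF \<eta>] DERIV_isCont by blast
    qed auto
    moreover have "(\<lambda>x. \<eta> x * indicator {-1..2} x) = \<eta>"
      using \<eta>_0 by (force simp: fun_eq_iff indicator_def)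
    ultimately show ?thesis by (simp add: g_top g_neg)
  qed
  show ?thesis
  proof
    show "smooth1 \<eta>" by fact
    show "smooth1 \<theta>" unfolding \<theta>_def[abs_def]
      by (intro smooth1_add smooth1_mult smooth1_const g smooth1_affine)
    show "\<eta> x = 0" if "x \<notin> {0..1}" for x using that by (rule \<eta>_0)
    show "\<theta> x = 0" if "x \<notin> {0..1}" for x
      using that by (cases "x < 0")
        (auto simp: \<theta>_def g_def smooth_step_0 smooth_step_1 power_mult_distrib sk power_divide)
    show "(deriv ^^ s) \<theta> = (\<lambda>x. \<eta> x - 2 * \<eta> (2 * x))"
      unfolding \<theta>_def[abs_def]
      by (subst nderiv_add[OF g smooth1_mult[OF smooth1_const smooth1_affine[OF g]]],
          subst nderiv_affine[OF g]) (simp add: \<eta>_def power_divide)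
    show "integrable lborel \<eta>" "(\<integral>x. \<eta> x \<partial>lborel) = 1"
      using int by (simp_all add: has_bochner_integral_iff)
  qed
qed

section \<open>Tensor products and test functions\<close>

definition tensor :: "('d \<Rightarrow> real \<Rightarrow> real) \<Rightarrow> real^'d::finite \<Rightarrow> real" where
  "tensor f y = (\<Prod>i\<in>UNIV. f i (y $ i))"

lemma tensor_line_deriv:
  assumes "\<And>i. smooth1 (f i)"
  shows "((\<lambda>t. tensor f (y + t *\<^sub>R axis j 1)) has_real_derivative
    tensor (f(j := deriv (f j))) y) (at 0)"
proof -
  have split: "tensor g z = g j (z $ j) * (\<Prod>i\<in>UNIV - {j}. g i (z $ i))" for g z
    unfolding tensor_def by (rule prod.remove) auto
  have eq: "tensor f (y + t *\<^sub>R axis j 1) = f j (1 * t + y $ j) * (\<Prod>i\<in>UNIV - {j}. f i (y $ i))" for t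
    unfolding split by (auto simp: axis_def add.commute intro!: prod.cong)
  have "((\<lambda>t. f j (1 * t + y $ j)) has_real_derivative 1 * deriv (f j) (y $ j)) (at 0)"
    using smooth1_has_deriv[OF assms, of j "y $ j"] by (intro has_real_derivative_affine) simp
  from DERIV_cmult_right[OF this]
  have "((\<lambda>t. tensor f (y + t *\<^sub>R axis j 1)) has_real_derivative
     1 * deriv (f j) (y $ j) * (\<Prod>i\<in>UNIV - {j}. f i (y $ i))) (at 0)"
    unfolding eq by blast
  then show ?thesis unfolding split by simp
qed

lemma pdiffs_tensor:
  assumes "\<And>i. smooth1 (f i)"
  shows "pdiffs l (tensor f) = tensor (\<lambda>i. (deriv ^^ count_list l i) (f i))"
proof (induction l)
  case (Cons j l)
  let ?g = "\<lambda>i. (deriv ^^ count_list l i) (f i)"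
  have "pdiff j (tensor ?g) y = tensor (?g(j := deriv (?g j))) y" for y
    unfolding pdiff_def using assms
    by (intro DERIV_imp_deriv tensor_line_deriv smooth1_nderiv)
  moreover have "?g(j := deriv (?g j)) = (\<lambda>i. (deriv ^^ count_list (j # l) i) (f i))"
    by (auto simp: fun_eq_iff)
  ultimately show ?case by (auto simp: Cons)
qed simp

lemma continuous_on_tensor:
  assumes "\<And>i. smooth1 (f i)"
  shows "continuous_on S (tensor f)"
proof -
  have "continuous_on S (\<lambda>y. f i (y $ i))" for i
    by (rule continuous_on_compose2[OF smooth1_continuous[OF assms, of UNIV]]) (auto intro: continuous_intros)
  then show ?thesis
    unfolding tensor_def[abs_def] by (intro continuous_on_prod)
qed

lemma smooth_fun_tensor:
  assumes "\<And>i. smooth1 (f i)"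
  shows "smooth_fun (tensor f)"
  unfolding smooth_fun_def pdiffs_tensor[OF assms]
proof (intro allI conjI)
  fix l j x
  show "continuous_on UNIV (tensor (\<lambda>i. (deriv ^^ count_list l i) (f i)))"
    by (intro continuous_on_tensor smooth1_nderiv assms)
  show "(\<lambda>t. tensor (\<lambda>i. (deriv ^^ count_list l i) (f i)) (x + t *\<^sub>R axis j 1)) differentiable (at 0)"
    unfolding real_differentiable_def
    by (rule exI, rule tensor_line_deriv, intro smooth1_nderiv assms)
qed

lemma tensor_zero_outside:
  assumes "\<And>i t. t \<notin> {lo $ i..hi $ i} \<Longrightarrow> f i t = 0" "y \<notin> cbox lo hi"
  shows "tensor f y = 0"
proof -
  obtain i where "y $ i \<notin> {lo $ i..hi $ i}" using assms(2) by (auto simp: mem_box_cart)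
  then have "f i (y $ i) = 0" by (rule assms(1))
  then show ?thesis unfolding tensor_def by (intro prod_zero) auto
qed

lemma test_fun_tensor:
  assumes "\<And>i. smooth1 (f i)" "\<And>i t. t \<notin> {lo $ i..hi $ i} \<Longrightarrow> f i t = 0" "cbox lo hi \<subseteq> U"
  shows "test_fun U (tensor f)"
proof -
  have "{x. tensor f x \<noteq> 0} \<subseteq> cbox lo hi"
    using tensor_zero_outside[of lo hi f] assms(2) by blast
  then have "closure {x. tensor f x \<noteq> 0} \<subseteq> cbox lo hi"
    by (rule closure_minimal) (rule closed_cbox)
  moreover from this have "compact (closure {x. tensor f x \<noteq> 0})"
    by (meson bounded_cbox bounded_subset closed_closure compact_eq_bounded_closed)
  ultimately show ?thesis using assms(1,3) by (auto simp: test_fun_def smooth_fun_tensor)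
qed

lemma tensor_abs_le:
  assumes "\<And>i t. \<bar>f i t\<bar> \<le> C i"
  shows "\<bar>tensor f y\<bar> \<le> (\<Prod>i\<in>UNIV. C i)"
  unfolding tensor_def abs_prod using assms by (intro prod_mono) auto

lemma integral_tensor:
  fixes f :: "'d::finite \<Rightarrow> real \<Rightarrow> real"
  assumes "\<And>i. integrable lborel (f i)"
  shows "integrable lborel (tensor f)" "(\<integral>x. tensor f x \<partial>lborel) = (\<Prod>i\<in>UNIV. \<integral>x. f i x \<partial>lborel)"
proof -
  interpret product_sigma_finite "\<lambda>_::real^'d. lborel :: real measure" ..
  \<comment> \<open>Lebesgue measure is a product over basis vectors, while the factors are indexed
    by coordinates. \<open>G\<close> re-indexes them; \<open>THE\<close> is well defined because
    \<open>axis i 1\<close> determines i.\<close>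
  define G where "G b = f (THE i. b = axis i 1)" for b :: "real^'d"
  have G: "G (axis i 1) = f i" for i by (simp add: G_def axis_eq_axis)
  have Bas: "(Basis :: (real^'d) set) = (\<lambda>i. axis i 1) ` UNIV"
    by (auto simp: Basis_vec_def)
  have inj: "inj (\<lambda>i::'d. axis i (1::real))" by (auto simp: inj_on_def axis_eq_axis)
  have t: "tensor f x = (\<Prod>b\<in>Basis. G b (x \<bullet> b))" for x
    unfolding tensor_def Bas by (subst prod.reindex[OF inj]) (simp add: G inner_axis)
  have Gi: "integrable lborel (G b)" if "b \<in> Basis" for b
    using that assms by (auto simp: Bas G)
  have m: "(\<lambda>h. \<Sum>b\<in>Basis. h b *\<^sub>R b) \<in> (\<Pi>\<^sub>M b\<in>Basis. lborel :: real measure) \<rightarrow>\<^sub>M (borel :: (real^'d) measure)"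
    by measurable
  have [measurable]: "f i \<in> borel_measurable borel" for i using assms[of i] by auto
  have mt: "tensor f \<in> borel_measurable borel"
    unfolding tensor_def[abs_def] by measurable
  have e: "tensor f (\<Sum>b\<in>Basis. h b *\<^sub>R b) = (\<Prod>b\<in>Basis. G b (h b))" for h :: "real^'d \<Rightarrow> real"
    unfolding t by (intro prod.cong refl) simp
  show "integrable lborel (tensor f)"
    by (subst lborel_eq, subst integrable_distr_eq[OF m mt]) (simp add: e product_integrable_prod Gi)
  show "(\<integral>x. tensor f x \<partial>lborel) = (\<Prod>i\<in>UNIV. \<integral>x. f i x \<partial>lborel)"
    by (subst lborel_eq, subst integral_distr[OF m mt])
      (simp add: e product_integral_prod[OF finite_Basis Gi], simp add: Bas prod.reindex[OF inj] G)
qed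

text \<open>The complement of the closed support is open, so along a coordinate line through such a
  point the lower derivative vanishes in a whole neighbourhood, and so does its derivative.\<close>

lemma pdiffs_eq_0:
  assumes "x \<notin> closure {x. \<phi> x \<noteq> 0}"
  shows "pdiffs l \<phi> x = 0"
  using assms
proof (induction l arbitrary: x)
  case Nil
  then have "x \<notin> {x. \<phi> x \<noteq> 0}" by (rule contra_subsetD[OF closure_subset])
  then show ?case by simp
next
  case (Cons j l)
  let ?S = "- closure {x. \<phi> x \<noteq> 0}"
  let ?W = "(\<lambda>t. x + t *\<^sub>R axis j (1::real)) -` ?S"
  have "open ?W" by (intro open_vimage open_Compl closed_closure continuous_intros)
  moreover have "0 \<in> ?W" using Cons.prems by simp
  moreover have "\<forall>t\<in>?W. pdiffs l \<phi> (x + t *\<^sub>R axis j 1) = 0" using Cons.IH by simp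
  ultimately have "\<forall>\<^sub>F t in nhds 0. pdiffs l \<phi> (x + t *\<^sub>R axis j 1) = 0"
    unfolding eventually_nhds by (intro exI[of _ ?W] conjI)
  then have "deriv (\<lambda>t. pdiffs l \<phi> (x + t *\<^sub>R axis j 1)) 0 = deriv (\<lambda>t. 0) 0"
    by (intro deriv_cong_ev) auto
  then show ?case by (simp add: pdiff_def)
qed

section \<open>Bounds, integrability and translation of test functions\<close>

lemma test_fun_pdiffs_continuous: "test_fun U \<phi> \<Longrightarrow> continuous_on UNIV (pdiffs l \<phi>)"
  by (simp add: test_fun_def smooth_fun_def)

lemma test_fun_pdiffs_measurable: "test_fun U \<phi> \<Longrightarrow> pdiffs l \<phi> \<in> borel_measurable (lebesgue_on S)"
  by (rule measurable_restrict_space1, rule measurable_completion)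
    (simp add: borel_measurable_continuous_onI test_fun_pdiffs_continuous)

lemma test_fun_pdiffs_bounded:
  assumes "test_fun U \<phi>"
  obtains C where "\<And>x. \<bar>pdiffs l \<phi> x\<bar> \<le> C"
proof -
  let ?K = "closure {x. \<phi> x \<noteq> 0}"
  have "compact (pdiffs l \<phi> ` ?K)"
    using assms continuous_on_subset[OF test_fun_pdiffs_continuous[OF assms]]
    by (intro compact_continuous_image) (auto simp: test_fun_def)
  then obtain C where "\<And>x. x \<in> ?K \<Longrightarrow> \<bar>pdiffs l \<phi> x\<bar> \<le> C"
    using bounded_iff[of "pdiffs l \<phi> ` ?K"] compact_imp_bounded by auto
  then have "\<bar>pdiffs l \<phi> x\<bar> \<le> max C 0" for x
    using pdiffs_eq_0[of x \<phi> l] by (cases "x \<in> ?K") (auto simp: le_max_iff_disj)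
  then show ?thesis by (rule that)
qed

text \<open>Compact support turns local integrability into integrability over all of U, so that the
  integrals in the definition of weak derivatives are additive and never take the default
  value.\<close>

lemma loc_int_mult_test_fun:
  assumes "loc_int U f" "test_fun U \<phi>" "U \<in> sets lebesgue"
  shows "integrable (lebesgue_on U) (\<lambda>x. f x * pdiffs l \<phi> x)"
proof -
  let ?K = "closure {x. \<phi> x \<noteq> 0}"
  have K: "compact ?K" "?K \<subseteq> U" using assms(2) by (auto simp: test_fun_def)
  have i: "set_integrable lebesgue ?K f" using assms(1) K by (auto simp: loc_int_def)
  obtain C where C: "\<And>x. \<bar>pdiffs l \<phi> x\<bar> \<le> C" using test_fun_pdiffs_bounded[OF assms(2)] by blast
  have m: "pdiffs l \<phi> \<in> borel_measurable lebesgue"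
    using test_fun_pdiffs_measurable[OF assms(2), of l UNIV] by (simp add: lebesgue_on_UNIV_eq)
  have "integrable lebesgue (\<lambda>x. (indicator ?K x *\<^sub>R f x) * pdiffs l \<phi> x)"
  proof (rule Bochner_Integration.integrable_bound)
    show "integrable lebesgue (\<lambda>x. C * (indicator ?K x *\<^sub>R f x))"
      using i by (simp add: set_integrable_def)
    show "(\<lambda>x. (indicator ?K x *\<^sub>R f x) * pdiffs l \<phi> x) \<in> borel_measurable lebesgue"
      using i m by (auto simp: set_integrable_def)
    show "AE x in lebesgue. norm ((indicator ?K x *\<^sub>R f x) * pdiffs l \<phi> x)
        \<le> norm (C * (indicator ?K x *\<^sub>R f x))"
    proof (rule AE_I2)
      fix x
      have "norm ((indicator ?K x *\<^sub>R f x) * pdiffs l \<phi> x) \<le> \<bar>indicator ?K x *\<^sub>R f x\<bar> * \<bar>C\<bar>"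
        unfolding real_norm_def abs_mult
        by (intro mult_mono order_trans[OF C abs_ge_self]) auto
      then show "norm ((indicator ?K x *\<^sub>R f x) * pdiffs l \<phi> x) \<le> norm (C * (indicator ?K x *\<^sub>R f x))"
        by (simp add: abs_mult mult.commute)
    qed
  qed
  moreover have "(\<lambda>x. (indicator ?K x *\<^sub>R f x) * pdiffs l \<phi> x) = (\<lambda>x. indicator U x *\<^sub>R (f x * pdiffs l \<phi> x))"
    using K(2) by (auto simp: fun_eq_iff pdiffs_eq_0 split: split_indicator)
  ultimately show ?thesis using assms(3) by (simp add: integrable_restrict_space)
qed

lemma pdiffs_translate: "pdiffs l (\<lambda>x. \<phi> (x - c)) = (\<lambda>x. pdiffs l \<phi> (x - c))"
proof (induction l)
  case (Cons j l)
  have e: "x + t *\<^sub>R axis j 1 - c = x - c + t *\<^sub>R axis j 1" for x t by simp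
  show ?case by (simp only: pdiffs.simps Cons pdiff_def[abs_def] e)
qed simp

lemma test_fun_translate:
  assumes "test_fun V \<phi>" "\<And>x. x \<in> V \<Longrightarrow> x + c \<in> U"
  shows "test_fun U (\<lambda>x. \<phi> (x - c))"
proof -
  have s: "{x. \<phi> (x - c) \<noteq> 0} = (+) c ` {x. \<phi> x \<noteq> 0}"
  proof (intro set_eqI iffI)
    fix x assume "x \<in> {x. \<phi> (x - c) \<noteq> 0}"
    then show "x \<in> (+) c ` {x. \<phi> x \<noteq> 0}" by (intro image_eqI[of _ _ "x - c"]) auto
  qed auto
  have "smooth_fun (\<lambda>x. \<phi> (x - c))"
    unfolding smooth_fun_def pdiffs_translate
  proof (intro allI conjI)
    fix l i x
    show "continuous_on UNIV (\<lambda>x. pdiffs l \<phi> (x - c))"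
      by (intro continuous_on_compose2[OF test_fun_pdiffs_continuous[OF assms(1)]] continuous_intros) auto
    have "(\<lambda>t. pdiffs l \<phi> ((x - c) + t *\<^sub>R axis i 1)) differentiable (at 0)"
      using assms(1) by (auto simp: test_fun_def smooth_fun_def)
    then show "(\<lambda>t. pdiffs l \<phi> (x + t *\<^sub>R axis i 1 - c)) differentiable (at 0)"
      by (simp add: algebra_simps)
  qed
  then show ?thesis
    using assms compact_translation[of "closure {x. \<phi> x \<noteq> 0}" c]
    unfolding test_fun_def s closure_translation by (auto simp: add.commute[of c])
qed

section \<open>Mollification and uniqueness of weak derivatives\<close>

text \<open>Lebesgue differentiation is applied to \<open>\<bar>f - q\<bar>\<close> for every
  rational q; the exceptional sets are countably many, and a rational q within \<open>e / 4\<close>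
  of \<open>f x\<close> then serves at x. The cubes have x as a corner, as the supports of the
  mollifiers do.\<close>

lemma lebesgue_points_cbox:
  fixes f :: "'a::euclidean_space \<Rightarrow> real"
  assumes "integrable lebesgue f"
  obtains N where "negligible N"
    "\<And>x e. x \<notin> N \<Longrightarrow> e > 0 \<Longrightarrow> \<exists>d>0. \<forall>h. 0 < h \<and> h < d \<longrightarrow>
       integral (cbox x (x + h *\<^sub>R One)) (\<lambda>y. \<bar>f y - f x\<bar>) \<le> e * h ^ DIM('a)"
proof -
  have abs_int: "(\<lambda>y. \<bar>f y - q\<bar>) absolutely_integrable_on cbox a b" for q :: real and a b
  proof -
    have "f absolutely_integrable_on UNIV" using assms by (simp add: set_integrable_def)
    then have "f absolutely_integrable_on cbox a b" by (rule set_integrable_subset) auto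
    then have "(\<lambda>y. f y - q) absolutely_integrable_on cbox a b" by (intro set_integral_diff(1)) auto
    then show ?thesis by (rule set_integrable_abs)
  qed
  note int = set_lebesgue_integral_eq_integral(1)[OF abs_int]
  have "\<exists>N. negligible N \<and> (\<forall>x e. x \<notin> N \<longrightarrow> 0 < e \<longrightarrow> (\<exists>d>0. \<forall>h. 0 < h \<and> h < d \<longrightarrow>
      norm (integral (cbox x (x + h *\<^sub>R One)) (\<lambda>y. \<bar>f y - q\<bar>) /\<^sub>R h ^ DIM('a) - \<bar>f x - q\<bar>) < e))" for q
    using integrable_ccontinuous_explicit[of "\<lambda>y. \<bar>f y - q\<bar>"] int by metis
  then obtain N where N: "\<And>q. negligible (N q)" "\<And>q x e. x \<notin> N q \<Longrightarrow> 0 < e \<Longrightarrow> \<exists>d>0. \<forall>h. 0 < h \<and> h < d \<longrightarrow>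
      norm (integral (cbox x (x + h *\<^sub>R One)) (\<lambda>y. \<bar>f y - q\<bar>) /\<^sub>R h ^ DIM('a) - \<bar>f x - q\<bar>) < e"
    by metis
  show ?thesis
  proof (rule that[of "\<Union>(N ` \<rat>)"])
    show "negligible (\<Union>(N ` \<rat>))"
      using N(1) by (intro negligible_countable_Union) (auto simp: countable_rat)
  next
    fix x :: 'a and e :: real assume x: "x \<notin> \<Union>(N ` \<rat>)" and e: "e > 0"
    obtain q where q: "q \<in> \<rat>" "\<bar>f x - q\<bar> < e / 4"
      using Rats_dense_in_real[of "f x" "f x + e / 4"] e by force
    from x q(1) have "x \<notin> N q" by auto
    from N(2)[OF this, of "e / 4"] e obtain d where d: "d > 0" "\<And>h. 0 < h \<Longrightarrow> h < d \<Longrightarrow>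
      norm (integral (cbox x (x + h *\<^sub>R One)) (\<lambda>y. \<bar>f y - q\<bar>) /\<^sub>R h ^ DIM('a) - \<bar>f x - q\<bar>) < e / 4" by auto
    have "integral (cbox x (x + h *\<^sub>R One)) (\<lambda>y. \<bar>f y - f x\<bar>) \<le> e * h ^ DIM('a)" if h: "0 < h" "h < d" for h
    proof -
      let ?C = "cbox x (x + h *\<^sub>R One)"
      have hp: "h ^ DIM('a) > 0" using h by simp
      have cont: "measure lborel ?C = h ^ DIM('a)"
        using h by (subst content_cbox) (auto simp: inner_add_left)
      have "integral ?C (\<lambda>y. \<bar>f y - f x\<bar>) \<le> integral ?C (\<lambda>y. \<bar>f y - q\<bar> + \<bar>f x - q\<bar>)"
        by (intro integral_le int integrable_add integrable_const) (auto)
      also have "\<dots> = integral ?C (\<lambda>y. \<bar>f y - q\<bar>) + h ^ DIM('a) * \<bar>f x - q\<bar>"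
        by (subst integral_add) (auto intro: int simp: cont)
      also have "integral ?C (\<lambda>y. \<bar>f y - q\<bar>) \<le> (e / 2) * h ^ DIM('a)"
      proof -
        have "integral ?C (\<lambda>y. \<bar>f y - q\<bar>) / h ^ DIM('a) < e / 2"
        proof -
          have "\<bar>integral ?C (\<lambda>y. \<bar>f y - q\<bar>) / h ^ DIM('a) - \<bar>f x - q\<bar>\<bar> < e / 4"
            using d(2)[OF h] by (simp only: real_norm_def real_scaleR_def divide_inverse mult.commute)
          moreover have "A < e / 2" if "\<bar>A - B\<bar> < e / 4" "B < e / 4" for A B :: real
            using that by linarith
          ultimately show ?thesis using q(2) by blast
        qed
        then show ?thesis using hp by (simp add: field_simps)
      qed
      also have "h ^ DIM('a) * \<bar>f x - q\<bar> \<le> h ^ DIM('a) * (e / 4)"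
        using q(2) hp by (intro mult_left_mono) auto
      also have "(e / 2) * h ^ DIM('a) + h ^ DIM('a) * (e / 4) \<le> e * h ^ DIM('a)"
        using mult_pos_pos[OF e hp] by (simp add: mult.commute)
      finally show ?thesis by simp
    qed
    with d(1) show "\<exists>d>0. \<forall>h. 0 < h \<and> h < d \<longrightarrow>
       integral (cbox x (x + h *\<^sub>R One)) (\<lambda>y. \<bar>f y - f x\<bar>) \<le> e * h ^ DIM('a)" by blast
  qed
qed

lemma sum_Basis_cart [simp]: "(\<Sum>b\<in>(Basis :: (real^'d::finite) set). b $ i) = 1"
proof -
  have "(One :: real^'d) $ i = (One :: real^'d) \<bullet> axis i 1" by (rule cart_eq_inner_axis)
  also have "\<dots> = 1" by (simp add: axis_in_Basis_iff)
  finally show ?thesis by simp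
qed

section \<open>Rescaled mollifiers\<close>

locale mollifier =
  fixes \<eta> :: "real \<Rightarrow> real"
  assumes smooth: "smooth1 \<eta>" and supp: "\<And>t. t \<notin> {0..1} \<Longrightarrow> \<eta> t = 0"
    and integrable_eta: "integrable lborel \<eta>" and integral_eta: "(\<integral>t. \<eta> t \<partial>lborel) = 1"
begin

text \<open>This is \<open>(1 / e) * \<eta> ((t - c) / e)\<close>, with the argument expanded to the
  affine form required by the smoothness and derivative rules.\<close>

definition dil :: "real \<Rightarrow> real \<Rightarrow> real \<Rightarrow> real" where
  "dil e c = (\<lambda>t. inverse e * \<eta> (inverse e * t + - (c * inverse e)))"

definition moll :: "real \<Rightarrow> real^'d \<Rightarrow> real^'d::finite \<Rightarrow> real" where
  "moll e x = tensor (\<lambda>i. dil e (x $ i))"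

lemma smooth1_dil: "smooth1 (dil e c)"
  unfolding dil_def by (intro smooth1_mult smooth1_const smooth1_affine smooth)

lemma dil_zero:
  assumes "e > 0" "t \<notin> {c..c + e}" shows "dil e c t = 0"
proof -
  have "inverse e * t + - (c * inverse e) = (t - c) / e" by (simp add: divide_inverse algebra_simps)
  moreover have "(t - c) / e \<notin> {0..1}" using assms by (auto simp: field_simps)
  ultimately show ?thesis by (simp add: dil_def supp)
qed

lemma eta_bounded: obtains M where "M > 0" "\<And>t. \<bar>\<eta> t\<bar> \<le> M"
proof -
  have "compact (\<eta> ` {0..1})"
    by (intro compact_continuous_image smooth1_continuous smooth) auto
  then obtain C where "\<And>t. t \<in> {0..1} \<Longrightarrow> \<bar>\<eta> t\<bar> \<le> C"
    using bounded_iff[of "\<eta> ` {0..1}"] compact_imp_bounded by (metis imageI real_norm_def)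
  then have "\<bar>\<eta> t\<bar> \<le> \<bar>C\<bar> + 1" for t
    using supp[of t] by (cases "t \<in> {0..1}") force+
  then show ?thesis by (intro that[of "\<bar>C\<bar> + 1"]) auto
qed

lemma dil_integral:
  assumes "e > 0"
  shows "integrable lborel (dil e c)" "(\<integral>t. dil e c t \<partial>lborel) = 1"
proof -
  have eq: "dil e c = (\<lambda>t. inverse e * \<eta> (- (c * inverse e) + inverse e * t))"
    by (simp add: dil_def add.commute)
  show "integrable lborel (dil e c)"
    unfolding eq using assms integrable_eta
    by (intro integrable_mult_right lborel_integrable_real_affine) auto
  show "(\<integral>t. dil e c t \<partial>lborel) = 1"
    unfolding eq using assms integral_eta
      lborel_integral_real_affine[of "inverse e" \<eta> "- (c * inverse e)"] by simp
qed

lemma moll_zero: "e > 0 \<Longrightarrow> y \<notin> cbox x (x + e *\<^sub>R One) \<Longrightarrow> moll e x y = 0"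
  unfolding moll_def by (rule tensor_zero_outside[of x "x + e *\<^sub>R One"]) (auto intro: dil_zero)

lemma test_fun_moll: "e > 0 \<Longrightarrow> cbox x (x + e *\<^sub>R One) \<subseteq> U \<Longrightarrow> test_fun U (moll e x)"
  unfolding moll_def
  by (rule test_fun_tensor[of _ x "x + e *\<^sub>R One"]) (auto intro: dil_zero smooth1_dil)

lemma moll_abs_le:
  fixes x :: "real^'d::finite"
  assumes "e > 0" "\<And>t. \<bar>\<eta> t\<bar> \<le> M"
  shows "\<bar>moll e x y\<bar> \<le> (inverse e * M) ^ CARD('d)"
proof -
  have "\<bar>moll e x y\<bar> \<le> (\<Prod>i\<in>(UNIV::'d set). inverse e * M)"
    unfolding moll_def
    by (rule tensor_abs_le) (use assms in \<open>auto simp: dil_def abs_mult intro!: mult_left_mono\<close>)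
  then show ?thesis by simp
qed

lemma moll_measurable: "moll e x \<in> borel_measurable lebesgue"
  unfolding moll_def
  by (rule measurable_completion)
    (simp add: borel_measurable_continuous_onI continuous_on_tensor smooth1_dil)

lemma moll_integral:
  assumes "e > 0"
  shows "integrable lebesgue (moll e x)" "(\<integral>y. moll e x y \<partial>lebesgue) = 1"
proof -
  have m: "moll e x \<in> borel_measurable lborel"
    unfolding moll_def
    by (simp add: borel_measurable_continuous_onI continuous_on_tensor smooth1_dil)
  show "integrable lebesgue (moll e x)"
    using integral_tensor(1)[of "\<lambda>i. dil e (x $ i)"] dil_integral[OF assms] m
    by (simp add: integrable_completion moll_def)
  show "(\<integral>y. moll e x y \<partial>lebesgue) = 1"
    using integral_tensor(2)[of "\<lambda>i. dil e (x $ i)"] dil_integral[OF assms] m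
    by (simp add: integral_completion moll_def)
qed

text \<open>Since the mollifier has integral 1, the error is the integral of
  \<open>(f y - f x) * moll e x y\<close>. The kernel is at most \<open>(M / e) ^ d\<close> in
  absolute value on a cube of volume \<open>e ^ d\<close>, so the Lebesgue point property suffices
  whatever the sign of \<eta>.\<close>

lemma moll_tendsto:
  fixes f :: "real^'d::finite \<Rightarrow> real"
  assumes f: "integrable lebesgue f"
  obtains N where "negligible N"
    "\<And>x. x \<notin> N \<Longrightarrow> ((\<lambda>e. \<integral>y. f y * moll e x y \<partial>lebesgue) \<longlongrightarrow> f x) (at_right 0)"
proof -
  obtain N where N: "negligible N" "\<And>x e. x \<notin> N \<Longrightarrow> e > 0 \<Longrightarrow> \<exists>d>0. \<forall>h. 0 < h \<and> h < d \<longrightarrow>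
       integral (cbox x (x + h *\<^sub>R One)) (\<lambda>y. \<bar>f y - f x\<bar>) \<le> e * h ^ DIM(real^'d)"
    using lebesgue_points_cbox[OF f] by blast
  obtain M where M: "M > 0" "\<And>t. \<bar>\<eta> t\<bar> \<le> M" using eta_bounded by blast
  have "((\<lambda>e. \<integral>y. f y * moll e x y \<partial>lebesgue) \<longlongrightarrow> f x) (at_right 0)" if x: "x \<notin> N" for x
  proof (rule tendstoI)
    fix r :: real assume r: "r > 0"
    \<comment> \<open>Tuned so that the product with \<open>(M / h) ^ d * h ^ d\<close> is exactly
      \<open>r / 2\<close>.\<close>
    define e where "e = r / (2 * M ^ CARD('d))"
    have e: "e > 0" using r M by (simp add: e_def)
    from N(2)[OF x e] obtain d where d: "d > 0" "\<And>h. 0 < h \<Longrightarrow> h < d \<Longrightarrow>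
       integral (cbox x (x + h *\<^sub>R One)) (\<lambda>y. \<bar>f y - f x\<bar>) \<le> e * h ^ CARD('d)" by auto
    have "dist (\<integral>y. f y * moll h x y \<partial>lebesgue) (f x) < r" if h: "0 < h" "h < d" for h
    proof -
      let ?C = "cbox x (x + h *\<^sub>R One)"
      let ?B = "(inverse h * M) ^ CARD('d)"
      have mm: "moll h x \<in> borel_measurable lebesgue" by (rule moll_measurable)
      have b: "\<bar>moll h x y\<bar> \<le> ?B" for y using moll_abs_le[OF h(1) M(2)] .
      have B: "?B \<ge> 0" using h M by simp
      have i1: "integrable lebesgue (\<lambda>y. f y * moll h x y)"
      proof (rule Bochner_Integration.integrable_bound)
        show "integrable lebesgue (\<lambda>y. f y * ?B)" using f by simp
        show "(\<lambda>y. f y * moll h x y) \<in> borel_measurable lebesgue" using f mm by auto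
        show "AE y in lebesgue. norm (f y * moll h x y) \<le> norm (f y * ?B)"
          using B b by (intro AE_I2) (simp only: real_norm_def abs_mult, intro mult_left_mono, auto)
      qed
      have i2: "integrable lebesgue (\<lambda>y. (f y - f x) * moll h x y)"
        using i1 moll_integral(1)[OF h(1), of x] by (simp add: left_diff_distrib)
      have "(\<integral>y. f y * moll h x y \<partial>lebesgue) - f x = (\<integral>y. (f y - f x) * moll h x y \<partial>lebesgue)"
        using i1 moll_integral[OF h(1), of x] by (simp add: left_diff_distrib)
      also have "\<bar>\<dots>\<bar> \<le> (\<integral>y. \<bar>(f y - f x) * moll h x y\<bar> \<partial>lebesgue)"
        by (rule integral_abs_bound)
      also have "\<dots> \<le> (\<integral>y. ?B * (indicator ?C y *\<^sub>R \<bar>f y - f x\<bar>) \<partial>lebesgue)"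
      proof (rule integral_mono)
        show "integrable lebesgue (\<lambda>y. \<bar>(f y - f x) * moll h x y\<bar>)" using i2 by simp
        have "f absolutely_integrable_on UNIV" using f by (simp add: set_integrable_def)
        then have "f absolutely_integrable_on ?C" by (rule set_integrable_subset) auto
        then have "(\<lambda>y. f y - f x) absolutely_integrable_on ?C" by (intro set_integral_diff(1)) auto
        then have ab: "(\<lambda>y. \<bar>f y - f x\<bar>) absolutely_integrable_on ?C" by (rule set_integrable_abs)
        then show "integrable lebesgue (\<lambda>y. ?B * (indicator ?C y *\<^sub>R \<bar>f y - f x\<bar>))"
          by (simp add: set_integrable_def)
        fix y
        show "\<bar>(f y - f x) * moll h x y\<bar> \<le> ?B * (indicator ?C y *\<^sub>R \<bar>f y - f x\<bar>)"
          using mult_right_mono[OF b[of y], of "\<bar>f y - f x\<bar>"] moll_zero[OF h(1), of y x]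
          by (cases "y \<in> ?C") (auto simp: abs_mult mult.commute)
      qed
      also have "\<dots> = ?B * integral ?C (\<lambda>y. \<bar>f y - f x\<bar>)"
      proof -
        have "f absolutely_integrable_on UNIV" using f by (simp add: set_integrable_def)
        then have "f absolutely_integrable_on ?C" by (rule set_integrable_subset) auto
        then have "(\<lambda>y. f y - f x) absolutely_integrable_on ?C" by (intro set_integral_diff(1)) auto
        then have "(\<lambda>y. \<bar>f y - f x\<bar>) absolutely_integrable_on ?C" by (rule set_integrable_abs)
        from set_lebesgue_integral_eq_integral(2)[OF this] show ?thesis
          by (simp add: set_lebesgue_integral_def)
      qed
      also have "\<dots> \<le> ?B * (e * h ^ CARD('d))" using d(2)[OF h] B by (rule mult_left_mono)
      also have "\<dots> = r / 2"
        using M h by (simp add: e_def power_mult_distrib power_inverse field_simps)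
      also have "\<dots> < r" using r by simp
      finally show ?thesis by (simp add: dist_real_def)
    qed
    then show "\<forall>\<^sub>F h in at_right 0. dist (\<integral>y. f y * moll h x y \<partial>lebesgue) (f x) < r"
      using d(1) by (intro eventually_at_rightI[of 0 d]) auto
  qed
  with N(1) show ?thesis by (rule that)
qed

end

lemma mollifier_exists: "\<exists>\<eta>. mollifier \<eta>"
proof -
  obtain \<eta> \<theta> :: "real \<Rightarrow> real" where "smooth1 \<eta>" "\<And>x. x \<notin> {0..1} \<Longrightarrow> \<eta> x = 0"
    "integrable lborel \<eta>" "(\<integral>x. \<eta> x \<partial>lborel) = 1"
    using refinable_mollifier[of 1] by (metis zero_less_one)
  then show ?thesis by (intro exI[of _ \<eta>] mollifier.intro)
qed

section \<open>The fundamental lemma of the calculus of variations\<close>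

lemma set_integral_lebesgue_on:
  fixes f :: "'a::euclidean_space \<Rightarrow> real"
  shows "U \<in> sets lebesgue \<Longrightarrow> set_lebesgue_integral lebesgue U f = integral\<^sup>L (lebesgue_on U) f"
  by (simp add: set_lebesgue_integral_def integral_restrict_space)

text \<open>Rescaled mollifiers around a point are test functions on U once the scale is small, so
  all mollified values of g vanish there, and they converge to g almost everywhere.\<close>

lemma loc_int_ae_zero:
  fixes g :: "real^'d::finite \<Rightarrow> real"
  assumes U: "open U" and g: "loc_int U g"
    and z: "\<And>\<phi>. test_fun U \<phi> \<Longrightarrow> (LINT x:U|lebesgue. g x * \<phi> x) = 0"
  shows "AE x in lebesgue_on U. g x = 0"
proof -
  obtain \<eta> where "mollifier \<eta>" using mollifier_exists by blast
  then interpret mollifier \<eta> .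
  obtain \<D> where D: "countable \<D>" "\<D> \<subseteq> Pow U" "\<And>X. X \<in> \<D> \<Longrightarrow> \<exists>a b. X = cbox a b" "\<Union>\<D> = U"
    using open_countable_Union_open_cbox[OF U] by metis
  have "\<exists>N. negligible N \<and> (\<forall>x\<in>X - N. g x = 0)" if X: "X \<in> \<D>" for X
  proof -
    obtain a b where ab: "X = cbox a b" using D(3)[OF X] by blast
    have XU: "X \<subseteq> U" using D(2) X by auto
    \<comment> \<open>Cutting g off at one compact box makes it globally integrable, as
      mollification requires; countably many such boxes exhaust U.\<close>
    define f where "f x = indicator X x *\<^sub>R g x" for x
    have "integrable lebesgue f"
      using g XU ab unfolding loc_int_def set_integrable_def f_def[abs_def] by auto
    then obtain N where N: "negligible N"
      "\<And>x. x \<notin> N \<Longrightarrow> ((\<lambda>e. \<integral>y. f y * moll e x y \<partial>lebesgue) \<longlongrightarrow> f x) (at_right 0)"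
      using moll_tendsto by blast
    have "g x = 0" if x: "x \<in> box a b" "x \<notin> N" for x
    proof -
      obtain d where d: "d > 0" "ball x d \<subseteq> box a b"
        using x(1) open_box open_contains_ball by metis
      \<comment> \<open>The norm is bounded by the sum of the coordinates, each at most e; dividing
        d by the dimension keeps the cube inside the ball.\<close>
      have "(\<integral>y. f y * moll e x y \<partial>lebesgue) = 0" if e: "0 < e" "e < d / real CARD('d)" for e
      proof -
        have sub: "cbox x (x + e *\<^sub>R One) \<subseteq> X"
        proof
          fix y assume y: "y \<in> cbox x (x + e *\<^sub>R One)"
          have "norm (y - x) \<le> (\<Sum>i\<in>UNIV. \<bar>(y - x) $ i\<bar>)" by (rule norm_le_l1_cart)
          also have "\<dots> \<le> (\<Sum>i\<in>(UNIV::'d set). e)"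
          proof (intro sum_mono)
            fix i
            have "x $ i \<le> y $ i \<and> y $ i \<le> x $ i + e" using y by (simp add: mem_box_cart)
            then show "\<bar>(y - x) $ i\<bar> \<le> e" by (simp add: abs_le_iff)
          qed
          also have "\<dots> < d" using e by (simp add: field_simps)
          finally have "y \<in> ball x d" by (simp add: dist_norm norm_minus_commute)
          then show "y \<in> X" using d(2) ab box_subset_cbox by blast
        qed
        have "(\<integral>y. f y * moll e x y \<partial>lebesgue) = (LINT y:U|lebesgue. g y * moll e x y)"
          unfolding set_lebesgue_integral_def
        proof (intro Bochner_Integration.integral_cong refl)
          fix y
          show "f y * moll e x y = indicator U y *\<^sub>R (g y * moll e x y)"
            using sub XU moll_zero[OF e(1), of y x] by (cases "y \<in> X") (auto simp: f_def)
        qed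
        also have "\<dots> = 0" using sub XU e(1) by (intro z test_fun_moll) auto
        finally show ?thesis .
      qed
      then have "\<forall>\<^sub>F e in at_right 0. (\<integral>y. f y * moll e x y \<partial>lebesgue) = 0"
        using d(1) by (intro eventually_at_rightI[of 0 "d / real CARD('d)"]) auto
      from tendsto_cong[OF this] N(2)[OF x(2)] have "((\<lambda>e. 0) \<longlongrightarrow> f x) (at_right (0::real))" by simp
      then have "f x = 0" by (simp add: tendsto_const_iff)
      then show ?thesis using x(1) box_subset_cbox[of a b] by (auto simp: f_def ab)
    qed
    moreover have "negligible (N \<union> (cbox a b - box a b))"
      using N(1) negligible_frontier_interval by auto
    ultimately show ?thesis unfolding ab by (intro exI[of _ "N \<union> (cbox a b - box a b)"]) auto
  qed
  then obtain N where N: "\<And>X. X \<in> \<D> \<Longrightarrow> negligible (N X)" "\<And>X x. X \<in> \<D> \<Longrightarrow> x \<in> X - N X \<Longrightarrow> g x = 0"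
    by metis
  have "negligible (\<Union>(N ` \<D>))"
    using D(1) N(1) by (intro negligible_countable_Union) auto
  then have "AE x in lebesgue. x \<notin> \<Union>(N ` \<D>)"
    by (intro AE_not_in) (simp add: negligible_iff_null_sets)
  then have "AE x in lebesgue. x \<in> U \<longrightarrow> g x = 0"
    by eventually_elim (use N(2) D(4) in blast)
  then show ?thesis using U by (subst AE_restrict_space_iff) auto
qed

lemma loc_int_lincomb:
  assumes "loc_int U f" "loc_int U g" shows "loc_int U (\<lambda>x. c * f x + g x)"
  using assms unfolding loc_int_def by (auto intro!: set_integral_add(1) set_integrable_mult_right)

lemma weak_deriv_lincomb:
  assumes U: "open U" and "weak_deriv U \<alpha> f g" "weak_deriv U \<alpha> f' g'"
  shows "weak_deriv U \<alpha> (\<lambda>x. c * f x + f' x) (\<lambda>x. c * g x + g' x)"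
  unfolding weak_deriv_def
proof (intro conjI allI impI)
  have Us: "U \<in> sets lebesgue" using U by auto
  have l: "loc_int U f" "loc_int U g" "loc_int U f'" "loc_int U g'"
    using assms by (auto simp: weak_deriv_def)
  show "loc_int U (\<lambda>x. c * f x + f' x)" "loc_int U (\<lambda>x. c * g x + g' x)"
    using l by (auto intro: loc_int_lincomb)
  fix \<phi> assume t: "test_fun U \<phi>"
  have lin: "(LINT x:U|lebesgue. (c * h x + h' x) * pdiffs l \<phi> x)
      = c * (LINT x:U|lebesgue. h x * pdiffs l \<phi> x) + (LINT x:U|lebesgue. h' x * pdiffs l \<phi> x)"
    if "loc_int U h" "loc_int U h'" for h h' l
    using loc_int_mult_test_fun[OF that(1) t Us, of l] loc_int_mult_test_fun[OF that(2) t Us, of l]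
    by (simp add: set_integral_lebesgue_on[OF Us] distrib_right mult.assoc)
  have "(LINT x:U|lebesgue. f x * pdiffs (mi_list \<alpha>) \<phi> x)
          = (-1) ^ mi_order \<alpha> * (LINT x:U|lebesgue. g x * \<phi> x)"
       "(LINT x:U|lebesgue. f' x * pdiffs (mi_list \<alpha>) \<phi> x)
          = (-1) ^ mi_order \<alpha> * (LINT x:U|lebesgue. g' x * \<phi> x)"
    using assms t by (auto simp: weak_deriv_def)
  then show "(LINT x:U|lebesgue. (c * f x + f' x) * pdiffs (mi_list \<alpha>) \<phi> x)
          = (-1) ^ mi_order \<alpha> * (LINT x:U|lebesgue. (c * g x + g' x) * \<phi> x)"
    using lin[OF l(1,3)] lin[OF l(2,4), of "[]"] by (simp add: algebra_simps)
qed

text \<open>The fundamental lemma applied to the difference. The functions themselves need agree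
  only a.e., which suits derivatives of functions known up to null sets.\<close>

lemma weak_deriv_unique:
  assumes U: "open U" and fg: "weak_deriv U \<alpha> f g" "weak_deriv U \<alpha> f' g'"
    and ae: "AE x in lebesgue_on U. f x = f' x"
  shows "AE x in lebesgue_on U. g x = g' x"
proof -
  have Us: "U \<in> sets lebesgue" using U by auto
  have w: "weak_deriv U \<alpha> (\<lambda>x. (-1) * f' x + f x) (\<lambda>x. (-1) * g' x + g x)"
    by (rule weak_deriv_lincomb[OF U fg(2,1)])
  have "AE x in lebesgue_on U. (-1) * g' x + g x = 0"
  proof (rule loc_int_ae_zero[OF U])
    show "loc_int U (\<lambda>x. (-1) * g' x + g x)" using w by (simp add: weak_deriv_def)
    fix \<phi> assume "test_fun U \<phi>"
    with w have "(LINT x:U|lebesgue. ((-1) * f' x + f x) * pdiffs (mi_list \<alpha>) \<phi> x)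
          = (-1) ^ mi_order \<alpha> * (LINT x:U|lebesgue. ((-1) * g' x + g x) * \<phi> x)"
      by (simp add: weak_deriv_def)
    moreover have "(LINT x:U|lebesgue. ((-1) * f' x + f x) * pdiffs (mi_list \<alpha>) \<phi> x) = 0"
      unfolding set_integral_lebesgue_on[OF Us]
    proof (rule integral_eq_zero_AE)
      show "AE x in lebesgue_on U. ((-1) * f' x + f x) * pdiffs (mi_list \<alpha>) \<phi> x = 0"
        using ae by eventually_elim simp
    qed
    ultimately show "(LINT x:U|lebesgue. ((-1) * g' x + g x) * \<phi> x) = 0" by simp
  qed
  then show ?thesis by eventually_elim simp
qed

section \<open>Periodic extension\<close>

lemma weak_derivD:
  "weak_deriv U \<alpha> f g \<Longrightarrow> test_fun U \<phi> \<Longrightarrow>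
    (LINT x:U|lebesgue. f x * pdiffs (mi_list \<alpha>) \<phi> x)
      = (-1) ^ mi_order \<alpha> * (LINT x:U|lebesgue. g x * \<phi> x)"
  by (simp add: weak_deriv_def)

section \<open>Translation and restriction of Lebesgue integrals\<close>

lemma lebesgue_translation:
  fixes c :: "'a::euclidean_space"
  shows "(\<lambda>x. x + c) \<in> lebesgue \<rightarrow>\<^sub>M lebesgue" "distr lebesgue lebesgue (\<lambda>x. x + c) = lebesgue"
proof -
  have e: "(\<lambda>x. c + (\<Sum>j\<in>Basis. (1 * (x \<bullet> j)) *\<^sub>R j)) = (\<lambda>x. x + c)"
    by (auto simp: euclidean_representation add.commute)
  show "(\<lambda>x. x + c) \<in> lebesgue \<rightarrow>\<^sub>M lebesgue"
    using lebesgue_affine_measurable[of "\<lambda>_. 1" c] unfolding e by simp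
  show "distr lebesgue lebesgue (\<lambda>x. x + c) = lebesgue"
    using lebesgue_affine_euclidean[of "\<lambda>_. 1" c] unfolding e by (simp add: density_1)
qed

lemma integrable_lebesgue_translate:
  fixes f :: "'a::euclidean_space \<Rightarrow> real"
  assumes "integrable lebesgue f"
  shows "integrable lebesgue (\<lambda>x. f (x + c))"
  using integrable_distr[OF lebesgue_translation(1), of c f] assms
  by (simp add: lebesgue_translation(2))

lemma integral_lebesgue_translate:
  fixes f :: "'a::euclidean_space \<Rightarrow> real"
  shows "(\<integral>x. f (x + c) \<partial>lebesgue) = (\<integral>x. f x \<partial>lebesgue)"
proof -
  have *: "(\<integral>x. f (x + c) \<partial>lebesgue) = (\<integral>x. f x \<partial>lebesgue)" if "integrable lebesgue f" for c and f :: "'a \<Rightarrow> real"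
    using integral_distr[OF lebesgue_translation(1), of f c] that
    by (simp add: lebesgue_translation(2) integrable_iff_bounded)
  show ?thesis
  proof (cases "integrable lebesgue f")
    case False
    have "\<not> integrable lebesgue (\<lambda>x. f (x + c))"
      using integrable_lebesgue_translate[of "\<lambda>x. f (x + c)" "- c"] False by auto
    with False show ?thesis by (simp add: not_integrable_integral_eq)
  qed (rule *)
qed

lemma sq_int_lebesgue_translate:
  fixes f :: "'a::euclidean_space \<Rightarrow> real"
  assumes "sq_int lebesgue f" shows "sq_int lebesgue (\<lambda>x. f (x + c))"
  using assms integrable_lebesgue_translate[of "\<lambda>x. (f x)\<^sup>2" c]
    measurable_compose[OF lebesgue_translation(1), of f borel c]
  by (simp add: sq_int_def)

lemma sq_int_lebesgue_on_iff:
  assumes "S \<in> sets lebesgue"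
  shows "sq_int (lebesgue_on S) f \<longleftrightarrow> sq_int lebesgue (\<lambda>x. indicator S x * f x)"
proof -
  have "(\<lambda>x. (indicator S x * f x)\<^sup>2) = (\<lambda>x. indicator S x *\<^sub>R (f x)\<^sup>2)"
    by (auto simp: fun_eq_iff split: split_indicator)
  then show ?thesis
    using assms by (simp add: sq_int_def borel_measurable_restrict_space_iff integrable_restrict_space)
qed

lemma integral_square_lebesgue_on:
  fixes f :: "'a::euclidean_space \<Rightarrow> real"
  assumes "S \<in> sets lebesgue"
  shows "(\<integral>x. (f x)\<^sup>2 \<partial>lebesgue_on S) = (\<integral>x. (indicator S x * f x)\<^sup>2 \<partial>lebesgue)"
proof -
  have "(\<lambda>x. (indicator S x * f x)\<^sup>2) = (\<lambda>x. indicator S x *\<^sub>R (f x)\<^sup>2)"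
    by (auto simp: fun_eq_iff split: split_indicator)
  then show ?thesis using assms by (simp add: integral_restrict_space)
qed

lemma sq_int_lebesgue_on_subset:
  assumes "sq_int (lebesgue_on S) f" "T \<subseteq> S" "S \<in> sets lebesgue" "T \<in> sets lebesgue"
  shows "sq_int (lebesgue_on T) f"
    "(\<integral>x. (f x)\<^sup>2 \<partial>lebesgue_on T) \<le> (\<integral>x. (f x)\<^sup>2 \<partial>lebesgue_on S)"
proof -
  have e: "(\<lambda>x. indicator T x * f x) = (\<lambda>x. indicator T x * (indicator S x * f x))"
    using assms(2) by (auto simp: fun_eq_iff split: split_indicator)
  have S: "sq_int lebesgue (\<lambda>x. indicator S x * f x)"
    using assms by (simp add: sq_int_lebesgue_on_iff)
  then have T: "sq_int lebesgue (\<lambda>x. indicator T x * f x)"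
    unfolding e using assms(4)
    by (intro sq_int_mult_bounded[where C = 1 and g = "indicator T"]) (auto split: split_indicator)
  then show "sq_int (lebesgue_on T) f" using assms by (simp add: sq_int_lebesgue_on_iff)
  show "(\<integral>x. (f x)\<^sup>2 \<partial>lebesgue_on T) \<le> (\<integral>x. (f x)\<^sup>2 \<partial>lebesgue_on S)"
    unfolding integral_square_lebesgue_on[OF assms(3)] integral_square_lebesgue_on[OF assms(4)]
    using S T assms(2) by (intro integral_mono) (auto simp: sq_int_def split: split_indicator)
qed

lemma AE_lebesgue_on_subset:
  assumes "AE x in lebesgue_on S. P x" "T \<subseteq> S" "S \<in> sets lebesgue" "T \<in> sets lebesgue"
  shows "AE x in lebesgue_on T. P x"
proof -
  have "AE x in lebesgue. x \<in> S \<longrightarrow> P x" using assms by (subst (asm) AE_restrict_space_iff) auto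
  then have "AE x in lebesgue. x \<in> T \<longrightarrow> P x" by eventually_elim (use assms(2) in auto)
  then show ?thesis using assms by (subst AE_restrict_space_iff) auto
qed

lemma sq_int_loc_int:
  assumes "sq_int (lebesgue_on U) f" "U \<in> lmeasurable"
  shows "loc_int U f"
  unfolding loc_int_def
proof (intro allI impI)
  fix C assume C: "compact C \<and> C \<subseteq> U"
  have "integrable (lebesgue_on U) f"
    using assms by (intro sq_int_integrable finite_measure_lebesgue_on)
  then have "set_integrable lebesgue U f"
    using assms(2) by (simp add: integrable_restrict_space set_integrable_def fmeasurableD)
  then show "set_integrable lebesgue C f"
    by (rule set_integrable_subset) (use C lmeasurable_compact[of C] in \<open>simp_all add: fmeasurableD\<close>)
qed

text \<open>Measurability of g is a conclusion here, by completeness of Lebesgue measure. It serves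
  weak derivatives picked by \<open>SOME\<close>, which are only known to agree a.e. with a
  square-integrable function.\<close>

lemma sq_int_lebesgue_on_AE_cong:
  fixes f :: "'a::euclidean_space \<Rightarrow> real"
  assumes f: "sq_int (lebesgue_on U) f" and U: "U \<in> lmeasurable" and ae: "AE x in lebesgue_on U. g x = f x"
  shows "sq_int (lebesgue_on U) g"
proof (rule sq_int_AE_cong[OF f _ ae])
  have Us: "U \<in> sets lebesgue" using U by (rule fmeasurableD)
  have "integrable (lebesgue_on U) f"
    using f U by (intro sq_int_integrable finite_measure_lebesgue_on)
  then have fi: "f absolutely_integrable_on U"
    using Us by (simp add: integrable_restrict_space set_integrable_def)
  have "AE x in lebesgue. x \<in> U \<longrightarrow> g x = f x" using ae Us by (subst (asm) AE_restrict_space_iff) auto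
  then obtain N where N: "N \<in> null_sets lebesgue" "\<And>x. x \<in> space lebesgue - N \<Longrightarrow> x \<in> U \<longrightarrow> g x = f x"
    by (rule AE_E3) blast
  have "g absolutely_integrable_on U"
    by (rule absolutely_integrable_spike[OF fi, of N]) (use N in \<open>auto simp: negligible_iff_null_sets\<close>)
  then show "g \<in> borel_measurable (lebesgue_on U)"
    using Us by (rule absolutely_integrable_imp_borel_measurable)
qed

lemma cube_eq_cbox: "cube r = cbox (\<chi> i. - r) (\<chi> i. r)"
  by (auto simp: cube_def mem_box_cart abs_le_iff minus_le_iff)

lemma ocube_eq_box: "ocube r = box (\<chi> i. - r) (\<chi> i. r)"
  by (auto simp: ocube_def mem_box_cart abs_less_iff minus_less_iff)

lemma cube_lmeasurable [simp]: "cube r \<in> lmeasurable" "ocube r \<in> lmeasurable" "cube r \<in> sets lebesgue"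
    "ocube r \<in> sets lebesgue" "open (ocube r)"
  by (auto simp: cube_eq_cbox ocube_eq_box)

lemma cube_ocube_AE: "AE x in lebesgue_on (cube r). x \<in> ocube r"
proof -
  have "cube r - ocube r \<in> null_sets lebesgue"
    unfolding cube_eq_cbox ocube_eq_box
    using negligible_frontier_interval negligible_iff_null_sets by blast
  then have "AE x in lebesgue. x \<notin> cube r - ocube r" by (rule AE_not_in)
  then show ?thesis by (subst AE_restrict_space_iff) auto
qed

lemma cube_subset_ocube: "r < t \<Longrightarrow> cube r \<subseteq> ocube t"
  unfolding cube_def ocube_def using le_less_trans by blast

section \<open>Lattice cells and the periodic extension\<close>

locale period =
  fixes L :: real assumes L_pos: "L > 0"
begin

definition off :: "('d \<Rightarrow> int) \<Rightarrow> real^'d" where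
  "off \<sigma> = (\<chi> i. 4 * L * of_int (\<sigma> i))"

definition cellno :: "real^'d \<Rightarrow> 'd \<Rightarrow> int" where
  "cellno x i = \<lfloor>(x $ i + 2 * L) / (4 * L)\<rfloor>"

text \<open>Half-open, so that its lattice translates tile space: every point has exactly one
  translate in it. The floor in \<open>perext\<close> picks this translate.\<close>

definition cell :: "(real^'d) set" where
  "cell = {x. \<forall>i. - 2 * L \<le> x $ i \<and> x $ i < 2 * L}"

text \<open>The cells that can meet \<open>ocube (4 * L)\<close>: there
  \<open>(x + 2 L) / (4 L)\<close> lies between -1/2 and 3/2.\<close>

abbreviation shifts :: "('d::finite \<Rightarrow> int) set" where
  "shifts \<equiv> {\<sigma>. \<forall>i. \<sigma> i \<in> {-1, 0, 1}}"

lemma finite_shifts: "finite (shifts :: ('d::finite \<Rightarrow> int) set)"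
proof -
  have "(shifts :: ('d \<Rightarrow> int) set) = (\<Pi>\<^sub>E i\<in>UNIV. {-1, 0, 1})" by (auto simp: PiE_UNIV_domain)
  then show ?thesis by (simp add: finite_PiE)
qed

lemma perext_eq: "perext L f x = f (x - off (cellno x))"
  unfolding perext_def off_def cellno_def
  by (rule arg_cong[where f = f]) (simp add: vec_eq_iff)

lemma cell_iff: "x - off \<sigma> \<in> cell \<longleftrightarrow> \<sigma> = cellno x"
proof -
  have "- 2 * L \<le> x $ i - 4 * L * of_int (\<sigma> i) \<and> x $ i - 4 * L * of_int (\<sigma> i) < 2 * L \<longleftrightarrow> \<sigma> i = cellno x i" for i
  proof -
    have "cellno x i = \<sigma> i \<longleftrightarrow> of_int (\<sigma> i) \<le> (x $ i + 2 * L) / (4 * L) \<and> (x $ i + 2 * L) / (4 * L) < of_int (\<sigma> i) + 1"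
      unfolding cellno_def by (rule floor_eq_iff)
    also have "of_int (\<sigma> i) \<le> (x $ i + 2 * L) / (4 * L) \<longleftrightarrow> - 2 * L \<le> x $ i - 4 * L * of_int (\<sigma> i)"
      using L_pos by (auto simp: pos_le_divide_eq mult.commute)
    also have "(x $ i + 2 * L) / (4 * L) < of_int (\<sigma> i) + 1 \<longleftrightarrow> x $ i - 4 * L * of_int (\<sigma> i) < 2 * L"
      using L_pos by (auto simp: pos_divide_less_eq algebra_simps)
    finally show ?thesis by auto
  qed
  then show ?thesis by (auto simp: cell_def off_def fun_eq_iff)
qed

lemma cellno_shifts:
  assumes "x \<in> ocube (4 * L)" shows "cellno x \<in> shifts"
proof -
  have "cellno x i \<in> {-1, 0, 1}" for i
  proof -
    have x: "- (4 * L) < x $ i" "x $ i < 4 * L" 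
      using assms[unfolded ocube_def, simplified, rule_format, of i] by linarith+
    have "- 1 \<le> cellno x i"
      unfolding cellno_def using L_pos x by (simp add: le_floor_iff pos_le_divide_eq)
    moreover have "cellno x i < 2"
      unfolding cellno_def using L_pos x by (simp add: floor_less_iff pos_divide_less_eq)
    ultimately show ?thesis by auto
  qed
  then show ?thesis by auto
qed

lemma cell_subset:
  shows "(cell :: (real^'a) set) \<subseteq> cube (2 * L)" and "(cell :: (real^'a) set) \<subseteq> ocube (4 * L)"
    and "(ocube (2 * L) :: (real^'a) set) \<subseteq> cell"
proof -
  show "(cell :: (real^'a) set) \<subseteq> cube (2 * L)"
    unfolding cell_def cube_def abs_le_iff by (auto simp: minus_le_iff less_imp_le)
  show "(cell :: (real^'a) set) \<subseteq> ocube (4 * L)"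
  proof
    fix x :: "real^'a" assume x: "x \<in> cell"
    have "\<bar>x $ i\<bar> < 4 * L" for i
    proof -
      have "- 2 * L \<le> x $ i \<and> x $ i < 2 * L" using x by (simp add: cell_def)
      then show ?thesis using L_pos by linarith
    qed
    then show "x \<in> ocube (4 * L)" by (simp add: ocube_def)
  qed
  show "(ocube (2 * L) :: (real^'a) set) \<subseteq> cell"
    unfolding cell_def ocube_def abs_less_iff by (auto simp: minus_less_iff less_imp_le)
qed

lemma cell_sets: "(cell :: (real^'d::finite) set) \<in> sets lebesgue"
proof -
  have "cell = ocube (2 * L) \<union> (cell \<inter> (cube (2 * L) - ocube (2 * L)))" using cell_subset by auto
  moreover have "(cell :: (real^'d) set) \<inter> (cube (2 * L) - ocube (2 * L)) \<in> sets lebesgue"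
    unfolding cube_eq_cbox ocube_eq_box
    by (meson negligible_frontier_interval negligible_imp_sets negligible_subset inf_le2)
  ultimately show ?thesis by (metis cube_lmeasurable(4) sets.Un)
qed

lemma perext_ocube:
  fixes x :: "real^'a"
  assumes "x \<in> ocube (2 * L)" shows "perext L f x = f x"
proof -
  have off_0: "off (\<lambda>i. 0) = (0 :: real^'a)" by (simp add: off_def vec_eq_iff)
  then have "x - off (\<lambda>i. 0) \<in> cell" using assms cell_subset(3)[where 'a = 'a] by auto
  then have "cellno x = (\<lambda>i. 0)" by (simp only: cell_iff)
  then show ?thesis by (simp add: perext_eq off_0)
qed

lemma perext_AE: "AE x in lebesgue_on (cube (2 * L)). perext L f x = f x"
  using cube_ocube_AE[of "2 * L"] by eventually_elim (rule perext_ocube)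

lemma perext_off: "perext L f (x + off \<sigma>) = perext L f x"
proof -
  have "x - off (cellno x) \<in> cell" by (simp only: cell_iff)
  then have "(x + off \<sigma>) - off (\<lambda>i. cellno x i + \<sigma> i) \<in> cell"
    by (simp add: off_def cell_def algebra_simps)
  then have c: "(\<lambda>i. cellno x i + \<sigma> i) = cellno (x + off \<sigma>)" by (simp only: cell_iff)
  have "x + off \<sigma> - off (cellno (x + off \<sigma>)) = x - off (cellno x)"
    unfolding c[symmetric] by (simp add: off_def vec_eq_iff algebra_simps)
  then show ?thesis by (simp only: perext_eq)
qed

text \<open>Exactly one summand is nonzero. A finite sum of translates makes measurability and norm
  bounds of the extension a matter of translation invariance.\<close>

lemma perext_sum:
  assumes "x \<in> ocube (4 * L)"
  shows "perext L f x = (\<Sum>\<sigma>\<in>shifts. indicator cell (x + - off \<sigma>) * f (x + - off \<sigma>))"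
proof -
  have "(\<Sum>\<sigma>\<in>shifts. indicator cell (x + - off \<sigma>) * f (x + - off \<sigma>))
      = (\<Sum>\<sigma>\<in>{cellno x}. indicator cell (x + - off \<sigma>) * f (x + - off \<sigma>))"
    using cellno_shifts[OF assms] finite_shifts
    by (intro sum.mono_neutral_right) (auto simp: cell_iff indicator_def)
  also have "\<dots> = perext L f x" by (simp add: cell_iff perext_eq)
  finally show ?thesis by simp
qed

lemma sq_int_perext:
  fixes f :: "real^'d::finite \<Rightarrow> real"
  assumes f: "sq_int (lebesgue_on (cube (2 * L))) f"
  shows "sq_int (lebesgue_on (ocube (4 * L))) (perext L f)"
    "(\<integral>x. (perext L f x)\<^sup>2 \<partial>lebesgue_on (ocube (4 * L)))
      \<le> real (card (shifts :: ('d \<Rightarrow> int) set)) * (\<integral>x. (f x)\<^sup>2 \<partial>lebesgue_on (cube (2 * L)))"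
proof -
  let ?U = "ocube (4 * L) :: (real^'d) set"
  define G where "G x = indicator cell x * f x" for x
  define S where "S x = (\<Sum>\<sigma>\<in>shifts. G (x + - off \<sigma>))" for x
  have fc: "sq_int (lebesgue_on cell) f"
    by (rule sq_int_lebesgue_on_subset(1)[OF f cell_subset(1) cube_lmeasurable(3) cell_sets])
  then have G: "sq_int lebesgue G" unfolding G_def[abs_def] by (simp add: sq_int_lebesgue_on_iff cell_sets)
  have S: "sq_int lebesgue S"
    unfolding S_def[abs_def] by (intro sq_int_sum sq_int_lebesgue_translate G)
  have pS: "indicator ?U x * perext L f x = indicator ?U x * S x" for x
    using perext_sum[of x f] by (auto simp: S_def G_def split: split_indicator)
  have "sq_int lebesgue (\<lambda>x. indicator ?U x * S x)"
    by (rule sq_int_mult_bounded[OF S, where C = 1])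
      (auto intro!: borel_measurable_indicator split: split_indicator)
  then show "sq_int (lebesgue_on ?U) (perext L f)" by (simp add: sq_int_lebesgue_on_iff pS)
  then have "sq_int lebesgue (\<lambda>x. indicator ?U x * perext L f x)"
    by (simp add: sq_int_lebesgue_on_iff)
  then have pi: "integrable lebesgue (\<lambda>x. (indicator ?U x * perext L f x)\<^sup>2)"
    by (simp add: sq_int_def)
  have G2: "integrable lebesgue (\<lambda>x. (G x)\<^sup>2)" using G by (simp add: sq_int_def)
  have "(\<integral>x. (perext L f x)\<^sup>2 \<partial>lebesgue_on ?U) = (\<integral>x. (indicator ?U x * perext L f x)\<^sup>2 \<partial>lebesgue)"
    by (simp add: integral_square_lebesgue_on)
  also have "\<dots> \<le> (\<integral>x. (\<Sum>\<sigma>\<in>shifts. (G (x + - off \<sigma>))\<^sup>2) \<partial>lebesgue)"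
  proof (rule integral_mono[OF pi])
    show "integrable lebesgue (\<lambda>x. \<Sum>\<sigma>\<in>shifts. (G (x + - off \<sigma>))\<^sup>2)"
      by (intro Bochner_Integration.integrable_sum integrable_lebesgue_translate[OF G2])
    fix x
    show "(indicator ?U x * perext L f x)\<^sup>2 \<le> (\<Sum>\<sigma>\<in>shifts. (G (x + - off \<sigma>))\<^sup>2)"
    proof (cases "x \<in> ?U")
      case True
      \<comment> \<open>Extension is composition with a map of the argument, hence commutes with
        squaring; no cross terms between translates arise.\<close>
      have "(perext L f x)\<^sup>2 = perext L (\<lambda>x. (f x)\<^sup>2) x" by (simp add: perext_eq)
      also have "\<dots> = (\<Sum>\<sigma>\<in>shifts. (G (x + - off \<sigma>))\<^sup>2)"
        unfolding perext_sum[OF True] by (intro sum.cong) (auto simp: G_def split: split_indicator)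
      finally show ?thesis using True by simp
    qed (simp add: sum_nonneg)
  qed
  also have "\<dots> = (\<Sum>\<sigma>\<in>(shifts :: ('d \<Rightarrow> int) set). (\<integral>x. (G x)\<^sup>2 \<partial>lebesgue))"
    by (subst Bochner_Integration.integral_sum)
      (rule integrable_lebesgue_translate[OF G2], simp only: integral_lebesgue_translate[of "\<lambda>x. (G x)\<^sup>2"])
  also have "\<dots> = real (card (shifts :: ('d \<Rightarrow> int) set)) * (\<integral>x. (f x)\<^sup>2 \<partial>lebesgue_on cell)"
    by (simp add: integral_square_lebesgue_on[OF cell_sets] G_def)
  also have "\<dots> \<le> real (card (shifts :: ('d \<Rightarrow> int) set)) * (\<integral>x. (f x)\<^sup>2 \<partial>lebesgue_on (cube (2 * L)))"
    by (intro mult_left_mono sq_int_lebesgue_on_subset(2)[OF f cell_subset(1) cube_lmeasurable(3) cell_sets]) simp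
  finally show "(\<integral>x. (perext L f x)\<^sup>2 \<partial>lebesgue_on (ocube (4 * L)))
      \<le> real (card (shifts :: ('d \<Rightarrow> int) set)) * (\<integral>x. (f x)\<^sup>2 \<partial>lebesgue_on (cube (2 * L)))" .
qed

text \<open>On the overlap of the cube with its translate, a test function can be shifted and still
  be a test function on the cube. Moving the shift from g to the test function, then to the
  invariant \<open>perext L u\<close>, and back shows that g and its translate have the same
  pairings.\<close>

lemma weak_deriv_perext_shift:
  fixes u :: "real^'d::finite \<Rightarrow> real"
  assumes g: "weak_deriv (ocube (4 * L)) \<alpha> (perext L u) g"
  shows "AE x in lebesgue_on (ocube (4 * L)). x + off \<sigma> \<in> ocube (4 * L) \<longrightarrow> g (x + off \<sigma>) = g x"
proof -
  let ?U = "ocube (4 * L) :: (real^'d) set"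
  define c where "c = off \<sigma>"
  define V where "V = ?U \<inter> (\<lambda>x. x + c) -` ?U"
  have V: "open V" unfolding V_def
    by (intro open_Int open_vimage continuous_intros) auto
  have Vs: "V \<in> sets lebesgue" using V by auto
  have gl: "loc_int ?U g" using g by (simp add: weak_deriv_def)
  have l1: "loc_int V (\<lambda>x. g (x + c))"
    unfolding loc_int_def
  proof (intro allI impI)
    fix C assume C: "compact C \<and> C \<subseteq> V"
    have "compact ((+) c ` C)" "(+) c ` C \<subseteq> ?U"
      using C compact_translation[of C c] by (auto simp: V_def add.commute[of c])
    then have "set_integrable lebesgue ((+) c ` C) g" using gl by (auto simp: loc_int_def)
    then have "integrable lebesgue (\<lambda>x. indicator ((+) c ` C) (x + c) *\<^sub>R g (x + c))"
      unfolding set_integrable_def by (rule integrable_lebesgue_translate)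
    moreover have "indicator ((+) c ` C) (x + c) = (indicator C x :: real)" for x
      by (auto simp: indicator_def image_iff add.commute)
    ultimately show "set_integrable lebesgue C (\<lambda>x. g (x + c))" by (simp add: set_integrable_def)
  qed
  have l2: "loc_int V g" using gl unfolding loc_int_def V_def by blast
  have "AE x in lebesgue_on V. (-1) * g x + g (x + c) = 0"
  proof (rule loc_int_ae_zero[OF V])
    show "loc_int V (\<lambda>x. (-1) * g x + g (x + c))" by (rule loc_int_lincomb[OF l2 l1])
    fix \<phi> assume t: "test_fun V \<phi>"
    let ?p = "pdiffs (mi_list \<alpha>) \<phi>"
    have tU: "test_fun ?U \<phi>" using t by (auto simp: test_fun_def V_def)
    have tc: "test_fun ?U (\<lambda>x. \<phi> (x - c))" using t by (rule test_fun_translate) (auto simp: V_def)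
    have supp: "?p x = 0" "\<phi> x = 0" if "x \<notin> V" for x
    proof -
      have "x \<notin> closure {x. \<phi> x \<noteq> 0}" using t that by (auto simp: test_fun_def)
      from pdiffs_eq_0[OF this] pdiffs_eq_0[OF this, of "[]"] show "?p x = 0" "\<phi> x = 0" by auto
    qed
    have onV: "(LINT x:V|lebesgue. h x * k x) = (\<integral>x. h x * k x \<partial>lebesgue)"
      if "\<And>x. x \<notin> V \<Longrightarrow> k x = 0" for h k :: "real^'d \<Rightarrow> real"
      unfolding set_lebesgue_integral_def using that
      by (intro Bochner_Integration.integral_cong) (auto split: split_indicator)
    have onU: "(LINT x:?U|lebesgue. h x * k x) = (\<integral>x. h x * k x \<partial>lebesgue)"
      if "\<And>x. x \<notin> V \<Longrightarrow> k x = 0" for h k :: "real^'d \<Rightarrow> real"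
      unfolding set_lebesgue_integral_def using that
      by (intro Bochner_Integration.integral_cong) (auto simp: V_def split: split_indicator)
    have onUc: "(LINT x:?U|lebesgue. h x * k (x - c)) = (\<integral>x. h (x + c) * k x \<partial>lebesgue)"
      if k: "\<And>x. x \<notin> V \<Longrightarrow> k x = 0" for h k :: "real^'d \<Rightarrow> real"
    proof -
      have "(LINT x:?U|lebesgue. h x * k (x - c)) = (\<integral>x. h x * k (x - c) \<partial>lebesgue)"
        unfolding set_lebesgue_integral_def
      proof (intro Bochner_Integration.integral_cong refl)
        fix x show "indicator ?U x *\<^sub>R (h x * k (x - c)) = h x * k (x - c)"
          using k[of "x - c"] by (auto simp: V_def split: split_indicator)
      qed
      also have "\<dots> = (\<integral>x. h (x + c) * k (x + c - c) \<partial>lebesgue)"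
        using integral_lebesgue_translate[of "\<lambda>x. h x * k (x - c)" c] by simp
      finally show ?thesis by simp
    qed
    let ?s = "(-1) ^ mi_order \<alpha> :: real"
    have "?s * (\<integral>x. g (x + c) * \<phi> x \<partial>lebesgue) = ?s * (LINT x:?U|lebesgue. g x * \<phi> (x - c))"
      by (simp add: onUc supp)
    also have "\<dots> = (LINT x:?U|lebesgue. perext L u x * ?p (x - c))"
      using weak_derivD[OF g tc] by (simp add: pdiffs_translate)
    also have "\<dots> = (\<integral>x. perext L u (x + c) * ?p x \<partial>lebesgue)" by (simp add: onUc supp)
    also have "\<dots> = (LINT x:?U|lebesgue. perext L u x * ?p x)"
      unfolding c_def perext_off by (simp add: onU supp)
    also have "\<dots> = ?s * (LINT x:?U|lebesgue. g x * \<phi> x)" by (rule weak_derivD[OF g tU])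
    also have "\<dots> = ?s * (\<integral>x. g x * \<phi> x \<partial>lebesgue)" by (simp add: onU supp)
    finally have eq: "(\<integral>x. g (x + c) * \<phi> x \<partial>lebesgue) = (\<integral>x. g x * \<phi> x \<partial>lebesgue)" by simp
    have "(LINT x:V|lebesgue. ((-1) * g x + g (x + c)) * \<phi> x)
        = (-1) * (LINT x:V|lebesgue. g x * \<phi> x) + (LINT x:V|lebesgue. g (x + c) * \<phi> x)"
      using loc_int_mult_test_fun[OF l1 t Vs, of "[]"] loc_int_mult_test_fun[OF l2 t Vs, of "[]"]
      by (simp add: set_integral_lebesgue_on[OF Vs] distrib_right left_diff_distrib)
    also have "\<dots> = 0" by (simp add: onV supp eq)
    finally show "(LINT x:V|lebesgue. ((-1) * g x + g (x + c)) * \<phi> x) = 0" .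
  qed
  then have "AE x in lebesgue. x \<in> V \<longrightarrow> g (x + c) = g x"
    using Vs by (subst (asm) AE_restrict_space_iff) auto
  then have "AE x in lebesgue. x \<in> ?U \<longrightarrow> x + c \<in> ?U \<longrightarrow> g (x + c) = g x"
    by eventually_elim (auto simp: V_def)
  then show ?thesis by (subst AE_restrict_space_iff) (auto simp: c_def)
qed

text \<open>Finitely many shifts suffice to bring any point of the large cube into the base cell, so
  the exceptional null sets can be united. The derivative on the large cube is then recovered from
  its values on the cell.\<close>

lemma weak_deriv_perext_periodic:
  fixes u :: "real^'d::finite \<Rightarrow> real"
  assumes g: "weak_deriv (ocube (4 * L)) \<alpha> (perext L u) g"
  shows "AE x in lebesgue_on (ocube (4 * L)). perext L g x = g x"
proof -
  let ?U = "ocube (4 * L) :: (real^'d) set"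
  have "AE x in lebesgue_on ?U. \<forall>\<sigma>\<in>shifts. x + off (\<lambda>i. - \<sigma> i) \<in> ?U \<longrightarrow> g (x + off (\<lambda>i. - \<sigma> i)) = g x"
    using finite_shifts weak_deriv_perext_shift[OF g]
    by (intro AE_finite_allI) auto
  then show ?thesis
  proof (rule lebesgue_on_mono)
    fix x assume h: "\<forall>\<sigma>\<in>shifts. x + off (\<lambda>i. - \<sigma> i) \<in> ?U \<longrightarrow> g (x + off (\<lambda>i. - \<sigma> i)) = g x" and x: "x \<in> ?U"
    have e: "x + off (\<lambda>i. - cellno x i) = x - off (cellno x)" by (simp add: off_def vec_eq_iff)
    have "x - off (cellno x) \<in> cell" by (simp only: cell_iff)
    then have "x - off (cellno x) \<in> ?U" using cell_subset(2) by auto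
    with h[rule_format, OF cellno_shifts[OF x]] show "perext L g x = g x"
      by (simp add: e perext_eq)
  qed
qed

end

section \<open>Riesz representation and completeness of the periodic Sobolev space\<close>

text \<open>A minimising sequence for the quadratic functional \<open>B u u - 2 * l u\<close> is
  Cauchy by the parallelogram identity, and its limit solves the equation. The form is only
  semidefinite and vectors are functions determined a.e., so existence is all that is claimed;
  differences are written \<open>(-1) * v + u\<close> to match the closure assumption.\<close>

lemma riesz_representation:
  fixes V :: "('a \<Rightarrow> real) set" and B :: "('a \<Rightarrow> real) \<Rightarrow> ('a \<Rightarrow> real) \<Rightarrow> real"
  assumes zero: "(\<lambda>x. 0) \<in> V"
    and V: "\<And>c u v. u \<in> V \<Longrightarrow> v \<in> V \<Longrightarrow> (\<lambda>x. c * u x + v x) \<in> V"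
    and sym: "\<And>u v. B u v = B v u"
    and lin: "\<And>c u v w. u \<in> V \<Longrightarrow> v \<in> V \<Longrightarrow> w \<in> V \<Longrightarrow> B (\<lambda>x. c * u x + v x) w = c * B u w + B v w"
    and pos: "\<And>u. u \<in> V \<Longrightarrow> B u u \<ge> 0"
    and complete: "\<And>u :: nat \<Rightarrow> 'a \<Rightarrow> real. (\<And>n. u n \<in> V) \<Longrightarrow>
        (\<And>e. e > 0 \<Longrightarrow> \<exists>N. \<forall>i\<ge>N. \<forall>j\<ge>N. B (\<lambda>x. (-1) * u j x + u i x) (\<lambda>x. (-1) * u j x + u i x) < e) \<Longrightarrow>
        \<exists>w\<in>V. (\<lambda>n. B (\<lambda>x. (-1) * w x + u n x) (\<lambda>x. (-1) * w x + u n x)) \<longlonglongrightarrow> 0"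
    and l_lin: "\<And>c u v. u \<in> V \<Longrightarrow> v \<in> V \<Longrightarrow> l (\<lambda>x. c * u x + v x) = c * l u + (l v :: real)"
    and l_bound: "\<And>u. u \<in> V \<Longrightarrow> (l u)\<^sup>2 \<le> K * B u u"
  shows "\<exists>w\<in>V. \<forall>\<phi>\<in>V. B w \<phi> = l \<phi>"
proof -
  have lin2: "B w (\<lambda>x. c * u x + v x) = c * B w u + B w v" if "u \<in> V" "v \<in> V" "w \<in> V" for c u v w
    using lin[OF that, of c] by (simp add: sym)
  have quad: "B (\<lambda>x. c * u x + v x) (\<lambda>x. c * u x + v x) = c\<^sup>2 * B u u + 2 * c * B u v + B v v"
    if "u \<in> V" "v \<in> V" for c u v
  proof -
    note uv = V[OF that, of c]
    show ?thesis
      using lin[OF that uv, of c] lin2[OF that that(1), of c] lin2[OF that that(2), of c] sym[of v u]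
      by (simp add: algebra_simps power2_eq_square)
  qed
  \<comment> \<open>Bounded below by \<open>- \<bar>K\<bar>\<close>: the bound on l together with
    the inequality of arithmetic and geometric means gives
    \<open>2 * l u \<le> \<bar>K\<bar> + B u u\<close>.\<close>
  define J where "J u = B u u - 2 * l u" for u
  have J_ge: "J u \<ge> - \<bar>K\<bar>" if "u \<in> V" for u
  proof -
    have "(l u)\<^sup>2 \<le> \<bar>K\<bar> * B u u"
      by (rule order_trans[OF l_bound[OF that]]) (intro mult_right_mono pos that, simp)
    also have "\<dots> \<le> ((\<bar>K\<bar> + B u u) / 2)\<^sup>2"
      using zero_le_power2[of "\<bar>K\<bar> - B u u"] by (simp add: power2_eq_square field_simps)
    finally have "l u \<le> (\<bar>K\<bar> + B u u) / 2"
      by (rule power2_le_imp_le) (use pos[OF that] in auto)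
    then show ?thesis by (simp add: J_def)
  qed
  define m where "m = (INF u\<in>V. J u)"
  have bdd: "bdd_below (J ` V)" using J_ge by (auto intro!: bdd_belowI)
  have m_le: "m \<le> J u" if "u \<in> V" for u unfolding m_def by (rule cINF_lower[OF bdd that])
  have "\<exists>u\<in>V. J u < m + 1 / real (Suc n)" for n
  proof -
    have "(INF u\<in>V. J u) < m + 1 / real (Suc n)" by (simp add: m_def)
    then show ?thesis using cINF_less_iff[OF _ bdd] zero by blast
  qed
  then obtain u where u: "\<And>n. u n \<in> V" "\<And>n. J (u n) < m + 1 / real (Suc n)" by metis
  have par: "B (\<lambda>x. (-1) * u j x + u i x) (\<lambda>x. (-1) * u j x + u i x) < 2 / real (Suc i) + 2 / real (Suc j)" for i j
  proof -
    \<comment> \<open>V is closed only under \<open>c * u + v\<close>, so the midpoint of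
      \<open>u i\<close> and \<open>u j\<close> is assembled in two steps, with 0 as a
      summand.\<close>
    define h where "h = (\<lambda>x. (1/2) * u j x + 0)"
    have h: "h \<in> V" unfolding h_def by (rule V[OF u(1) zero])
    define w where "w = (\<lambda>x. (1/2) * u i x + h x)"
    have w: "w \<in> V" unfolding w_def by (rule V[OF u(1) h])
    have Bz: "B v (\<lambda>x. 0) = 0" if "v \<in> V" for v
      using lin2[OF that that that, of "-1"] by simp
    have lz: "l (\<lambda>x. 0) = 0" using l_lin[OF zero zero, of "-1"] by simp
    have "B h h = (1/2)\<^sup>2 * B (u j) (u j)"
      unfolding h_def using quad[OF u(1)[of j] zero, of "1/2"] Bz[OF u(1)[of j]] Bz[OF zero] by simp
    moreover have "B (u i) h = 1/2 * B (u i) (u j)"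
      unfolding h_def using lin2[OF u(1)[of j] zero u(1)[of i], of "1/2"] Bz[OF u(1)[of i]] by simp
    ultimately have Bw: "4 * B w w = B (u i) (u i) + 2 * B (u i) (u j) + B (u j) (u j)"
      unfolding w_def using quad[OF u(1)[of i] h, of "1/2"] by (simp add: power2_eq_square)
    have "l h = 1/2 * l (u j)" unfolding h_def using l_lin[OF u(1)[of j] zero, of "1/2"] lz by simp
    then have lw: "l w = 1/2 * l (u i) + 1/2 * l (u j)" unfolding w_def using l_lin[OF u(1)[of i] h, of "1/2"] by simp
    have "B (\<lambda>x. (-1) * u j x + u i x) (\<lambda>x. (-1) * u j x + u i x) = 2 * J (u i) + 2 * J (u j) - 4 * J w"
      using quad[OF u(1)[of j] u(1)[of i], of "-1"] Bw lw sym[of "u i" "u j"] by (simp add: J_def)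
    then show ?thesis using u(2)[of i] u(2)[of j] m_le[OF w] by linarith
  qed
  have "\<exists>w\<in>V. (\<lambda>n. B (\<lambda>x. (-1) * w x + u n x) (\<lambda>x. (-1) * w x + u n x)) \<longlonglongrightarrow> 0"
  proof (rule complete[OF u(1)])
    fix e :: real assume e: "e > 0"
    obtain N where N: "4 / e < real N" using reals_Archimedean2 by blast
    have "0 < 4 / e" using e by simp
    with N have "0 < real N" by linarith
    with N e have N: "N > 0" "4 / real N < e" by (auto simp: field_simps)
    have "2 / real (Suc i) + 2 / real (Suc j) < e" if "i \<ge> N" "j \<ge> N" for i j
    proof -
      have "2 / real (Suc k) \<le> 2 / real N" if "k \<ge> N" for k
        using that N(1) by (intro divide_left_mono) auto
      from this[OF that(1)] this[OF that(2)] N(2) show ?thesis by simp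
    qed
    with par show "\<exists>N. \<forall>i\<ge>N. \<forall>j\<ge>N. B (\<lambda>x. (-1) * u j x + u i x) (\<lambda>x. (-1) * u j x + u i x) < e"
      by (meson less_trans)
  qed
  then obtain w where w: "w \<in> V" and lim: "(\<lambda>n. B (\<lambda>x. (-1) * w x + u n x) (\<lambda>x. (-1) * w x + u n x)) \<longlonglongrightarrow> 0"
    by blast
  have "B w \<phi> = l \<phi>" if \<phi>: "\<phi> \<in> V" for \<phi>
  proof -
    have CS: "(B v \<phi>)\<^sup>2 \<le> B v v * B \<phi> \<phi>" if v: "v \<in> V" for v
    proof (rule discriminant_le)
      fix t
      show "0 \<le> B v v + 2 * t * B v \<phi> + t\<^sup>2 * B \<phi> \<phi>"
        using pos[OF V[OF \<phi> v, of t]] quad[OF \<phi> v, of t] sym[of v \<phi>] by simp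
    qed
    \<comment> \<open>Since \<open>u n\<close> minimises J up to \<open>1 / Suc n\<close>, the
      change of J along \<phi> is a quadratic in t bounded below by \<open>- 1 / Suc n\<close>; its
      discriminant bounds the residual of the Euler equation.\<close>
    have 1: "(B (u n) \<phi> - l \<phi>)\<^sup>2 \<le> 1 / real (Suc n) * B \<phi> \<phi>" for n
    proof (rule discriminant_le)
      fix t
      have "m \<le> J (\<lambda>x. t * \<phi> x + u n x)" by (rule m_le[OF V[OF \<phi> u(1)]])
      also have "\<dots> = J (u n) + 2 * t * (B (u n) \<phi> - l \<phi>) + t\<^sup>2 * B \<phi> \<phi>"
        using quad[OF \<phi> u(1)[of n], of t] l_lin[OF \<phi> u(1)[of n], of t] sym[of "u n" \<phi>]
        by (simp add: J_def algebra_simps)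
      finally show "0 \<le> 1 / real (Suc n) + 2 * t * (B (u n) \<phi> - l \<phi>) + t\<^sup>2 * B \<phi> \<phi>"
        using u(2)[of n] by linarith
    qed
    have 2: "(\<lambda>n. (B (u n) \<phi> - l \<phi>)\<^sup>2) \<longlonglongrightarrow> 0"
    proof (rule tendsto_sandwich[where f = "\<lambda>_. 0"])
      show "\<forall>\<^sub>F n in sequentially. (B (u n) \<phi> - l \<phi>)\<^sup>2 \<le> 1 / real (Suc n) * B \<phi> \<phi>"
        using 1 by (intro always_eventually allI)
      show "(\<lambda>n. 1 / real (Suc n) * B \<phi> \<phi>) \<longlonglongrightarrow> 0"
        using tendsto_mult[OF LIMSEQ_inverse_real_of_nat tendsto_const[of "B \<phi> \<phi>"]]
        by (simp add: divide_inverse)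
    qed auto
    have 3: "(\<lambda>n. (B (u n) \<phi> - B w \<phi>)\<^sup>2) \<longlonglongrightarrow> 0"
    proof (rule tendsto_sandwich[where f = "\<lambda>_. 0"])
      show "\<forall>\<^sub>F n in sequentially. (B (u n) \<phi> - B w \<phi>)\<^sup>2
          \<le> B (\<lambda>x. (-1) * w x + u n x) (\<lambda>x. (-1) * w x + u n x) * B \<phi> \<phi>"
      proof (intro always_eventually allI)
        fix n
        have "B (\<lambda>x. (-1) * w x + u n x) \<phi> = B (u n) \<phi> - B w \<phi>"
          using lin[OF w u(1)[of n] \<phi>, of "-1"] by simp
        then show "(B (u n) \<phi> - B w \<phi>)\<^sup>2
          \<le> B (\<lambda>x. (-1) * w x + u n x) (\<lambda>x. (-1) * w x + u n x) * B \<phi> \<phi>"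
          using CS[OF V[OF w u(1)[of n], of "-1"]] by simp
      qed
      show "(\<lambda>n. B (\<lambda>x. (-1) * w x + u n x) (\<lambda>x. (-1) * w x + u n x) * B \<phi> \<phi>) \<longlonglongrightarrow> 0"
        using tendsto_mult[OF lim tendsto_const[of "B \<phi> \<phi>"]] by simp
    qed auto
    have sq: "(\<lambda>n. f n - c) \<longlonglongrightarrow> 0" if "(\<lambda>n. (f n - c)\<^sup>2) \<longlonglongrightarrow> 0" for f and c :: real
      using tendsto_real_sqrt[OF that] by (simp add: tendsto_rabs_zero_iff)
    from sq[OF 2] sq[OF 3] have "(\<lambda>n. B (u n) \<phi>) \<longlonglongrightarrow> l \<phi>" "(\<lambda>n. B (u n) \<phi>) \<longlonglongrightarrow> B w \<phi>"
      by (simp_all add: LIM_zero_iff)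
    then show ?thesis using LIMSEQ_unique by blast
  qed
  with w show ?thesis by blast
qed

section \<open>Multi-indices\<close>

lemma count_list_mi_list: "count_list (mi_list \<alpha>) i = \<alpha> i"
proof -
  have "\<exists>l. \<forall>i\<in>A. count_list l i = \<alpha> i \<and> set l \<subseteq> A" if "finite A" for A :: "'a set"
    using that
  proof induction
    case (insert a A)
    then obtain l where l: "\<forall>i\<in>A. count_list l i = \<alpha> i" "A = {} \<or> set l \<subseteq> A" by blast
    \<comment> \<open>For \<open>A = {}\<close> the induction hypothesis says nothing about l, so
      the empty list is used instead.\<close>
    define l' where "l' = replicate (\<alpha> a) a @ (if A = {} then [] else l)"
    have "count_list (replicate n a) i = (if i = a then n else 0)" for n i by (induction n) auto
    moreover have "count_list (if A = {} then [] else l) a = 0"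
      using l insert.hyps by (auto simp: count_list_0_iff)
    ultimately have "\<forall>i\<in>insert a A. count_list l' i = \<alpha> i \<and> set l' \<subseteq> insert a A"
      using l insert.hyps by (auto simp: l'_def count_list_append split: if_splits)
    then show ?case by blast
  qed simp
  from this[of UNIV] have "\<exists>l. \<forall>i. count_list l i = \<alpha> i" by auto
  then show ?thesis unfolding mi_list_def by (rule someI2_ex) auto
qed

text \<open>For a pure power the unordered multi-index leaves no freedom of order, so the choice
  made by \<open>SOME\<close> is known explicitly. Only such derivatives are computed on concrete
  functions.\<close>

lemma mi_list_single: "mi_list (\<lambda>i. if i = j then n else 0) = replicate n j"
proof -
  let ?l = "mi_list (\<lambda>i. if i = j then n else 0)"
  have c: "count_list ?l i = (if i = j then n else 0)" for i by (rule count_list_mi_list)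
  have "set ?l \<subseteq> {j}"
  proof
    fix i assume "i \<in> set ?l"
    then have "count_list ?l i \<noteq> 0" by (simp add: count_list_0_iff)
    then show "i \<in> {j}" by (simp add: c split: if_splits)
  qed
  then have "?l = replicate (length ?l) j" by (intro replicate_eqI) auto
  moreover have "count_list (replicate k j) j = k" for k by (induction k) auto
  ultimately show ?thesis using c[of j] by metis
qed

lemma mi_list_zero: "mi_list (\<lambda>_::'d::finite. 0) = []"
  using mi_list_single[of undefined 0] by simp

lemma mi_order_single: "mi_order (\<lambda>i::'d::finite. if i = j then n else 0) = n"
  by (simp add: mi_order_def)

lemma finite_mi_order: "finite {\<alpha> :: 'd::finite \<Rightarrow> nat. mi_order \<alpha> \<le> s}"
proof (rule finite_subset)
  have "\<alpha> i \<le> mi_order \<alpha>" for \<alpha> and i :: 'd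
    unfolding mi_order_def by (rule member_le_sum) auto
  then show "{\<alpha> :: 'd \<Rightarrow> nat. mi_order \<alpha> \<le> s} \<subseteq> (\<Pi>\<^sub>E i\<in>UNIV. {..s})"
    by (auto simp: PiE_UNIV_domain intro: order_trans)
  show "finite (\<Pi>\<^sub>E i\<in>(UNIV::'d set). {..s})" by (simp add: finite_PiE)
qed

lemma weak_deriv_zero_order:
  assumes "loc_int U f" shows "weak_deriv U (\<lambda>_. 0) f f"
  using assms by (simp add: weak_deriv_def mi_list_zero mi_order_def)

section \<open>The periodic Sobolev space\<close>

context period
begin

text \<open>\<open>Dper\<close> is an arbitrary choice among weak derivatives; membership in
  \<open>Hper\<close> promises one that is square integrable, and uniqueness a.e. passes this on to
  the chosen one.\<close>

lemma Hper_Dper: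
  assumes "u \<in> Hper L s" "mi_order \<alpha> \<le> s"
  shows "weak_deriv (ocube (4 * L)) \<alpha> (perext L u) (Dper L \<alpha> u)"
    "sq_int (lebesgue_on (ocube (4 * L))) (Dper L \<alpha> u)"
    "sq_int (lebesgue_on (cube (2 * L))) (Dper L \<alpha> u)"
proof -
  from assms obtain g where g: "weak_deriv (ocube (4 * L)) \<alpha> (perext L u) g"
    "sq_int (lebesgue_on (ocube (4 * L))) g" by (auto simp: Hper_def in_Hs_def)
  from g(1) show w: "weak_deriv (ocube (4 * L)) \<alpha> (perext L u) (Dper L \<alpha> u)"
    unfolding Dper_def wd_def by (rule someI[where P = "weak_deriv (ocube (4 * L)) \<alpha> (perext L u)"])
  show U: "sq_int (lebesgue_on (ocube (4 * L))) (Dper L \<alpha> u)"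
    by (rule sq_int_lebesgue_on_AE_cong[OF g(2) cube_lmeasurable(2) weak_deriv_unique[OF cube_lmeasurable(5) w g(1)]]) auto
  show "sq_int (lebesgue_on (cube (2 * L))) (Dper L \<alpha> u)"
    by (rule sq_int_lebesgue_on_subset(1)[OF U cube_subset_ocube]) (use L_pos in auto)
qed

lemma Hper_sq_int: "u \<in> Hper L s \<Longrightarrow> sq_int (lebesgue_on (cube (2 * L))) u"
  by (simp add: Hper_def)

lemma AE_ocube_imp_cube:
  "AE x in lebesgue_on (ocube (4 * L)). P x \<Longrightarrow> AE x in lebesgue_on (cube (2 * L)). P x"
  by (erule AE_lebesgue_on_subset[OF _ cube_subset_ocube]) (use L_pos in auto)

lemma Dper_AE_eq:
  assumes "u \<in> Hper L s" "mi_order \<alpha> \<le> s" "weak_deriv (ocube (4 * L)) \<alpha> (perext L u) g"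
  shows "AE x in lebesgue_on (cube (2 * L)). Dper L \<alpha> u x = g x"
  by (rule AE_ocube_imp_cube)
    (rule weak_deriv_unique[OF cube_lmeasurable(5) Hper_Dper(1)[OF assms(1,2)] assms(3)], simp)

lemma Hper_lincomb:
  assumes "u \<in> Hper L s" "v \<in> Hper L s"
  shows "(\<lambda>x. c * u x + v x) \<in> Hper L s"
    "mi_order \<alpha> \<le> s \<Longrightarrow> AE x in lebesgue_on (cube (2 * L)).
        Dper L \<alpha> (\<lambda>x. c * u x + v x) x = c * Dper L \<alpha> u x + Dper L \<alpha> v x"
proof -
  have p: "perext L (\<lambda>x. c * u x + v x) = (\<lambda>x. c * perext L u x + perext L v x)"
    by (simp add: perext_def)
  have w: "weak_deriv (ocube (4 * L)) \<alpha> (perext L (\<lambda>x. c * u x + v x)) (\<lambda>x. c * Dper L \<alpha> u x + Dper L \<alpha> v x)"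
    if "mi_order \<alpha> \<le> s" for \<alpha>
    unfolding p by (intro weak_deriv_lincomb Hper_Dper(1)[OF assms(1) that] Hper_Dper(1)[OF assms(2) that]) simp
  show H: "(\<lambda>x. c * u x + v x) \<in> Hper L s"
    using assms w sq_int_lincomb[OF Hper_Dper(2)[OF assms(1)] Hper_Dper(2)[OF assms(2)]]
    by (fastforce simp: Hper_def in_Hs_def p intro: sq_int_lincomb)
  show "AE x in lebesgue_on (cube (2 * L)).
        Dper L \<alpha> (\<lambda>x. c * u x + v x) x = c * Dper L \<alpha> u x + Dper L \<alpha> v x" if "mi_order \<alpha> \<le> s"
    by (rule Dper_AE_eq[OF H that w[OF that]])
qed

lemma Dper_zero_order:
  assumes "u \<in> Hper L s"
  shows "AE x in lebesgue_on (cube (2 * L)). Dper L (\<lambda>_. 0) u x = u x"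
proof -
  have "sq_int (lebesgue_on (ocube (4 * L))) (perext L u)" using assms by (simp add: Hper_def in_Hs_def)
  then have "loc_int (ocube (4 * L)) (perext L u)" by (rule sq_int_loc_int) simp
  from Dper_AE_eq[OF assms _ weak_deriv_zero_order[OF this]]
  have "AE x in lebesgue_on (cube (2 * L)). Dper L (\<lambda>_. 0) u x = perext L u x" by (simp add: mi_order_def)
  with perext_AE[of u] show ?thesis by eventually_elim simp
qed

text \<open>Offering the derivatives as periodic extensions reduces all integrability on the large
  cube to the base cube.\<close>

lemma HperI:
  assumes u: "sq_int (lebesgue_on (cube (2 * L))) u"
    and "\<And>\<alpha>. mi_order \<alpha> \<le> s \<Longrightarrow> weak_deriv (ocube (4 * L)) \<alpha> (perext L u) (perext L (G \<alpha>))"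
    and "\<And>\<alpha>. mi_order \<alpha> \<le> s \<Longrightarrow> sq_int (lebesgue_on (cube (2 * L))) (G \<alpha>)"
  shows "u \<in> Hper L s"
  using assms sq_int_perext(1) unfolding Hper_def in_Hs_def by blast

lemma weak_deriv_zero:
  fixes U :: "(real^'d::finite) set"
  shows "weak_deriv U \<alpha> (\<lambda>x. 0) (\<lambda>x. 0)"
  by (simp add: weak_deriv_def loc_int_def set_integrable_def)

lemma Hper_zero: "(\<lambda>x. 0) \<in> Hper L s"
  using weak_deriv_zero by (intro HperI[where G = "\<lambda>_ _. 0"]) (auto simp: sq_int_zero perext_def)

text \<open>The norm sees only the base cube, whereas weak derivatives are tested on the larger open
  cube. Limits are taken on the base cube and extended periodically; the extensions are the right
  limits because the weak derivatives of periodic functions are themselves periodic a.e.\<close>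

lemma Hper_complete:
  fixes u :: "nat \<Rightarrow> real^'d::finite \<Rightarrow> real"
  assumes u: "\<And>n. u n \<in> Hper L s"
    and cau: "\<And>\<alpha> e. mi_order \<alpha> \<le> s \<Longrightarrow> e > 0 \<Longrightarrow> \<exists>N. \<forall>i\<ge>N. \<forall>j\<ge>N.
      (\<integral>x. (Dper L \<alpha> (u i) x - Dper L \<alpha> (u j) x)\<^sup>2 \<partial>lebesgue_on (cube (2 * L))) < e"
  shows "\<exists>w\<in>Hper L s. \<forall>\<alpha>. mi_order \<alpha> \<le> s \<longrightarrow>
    (\<lambda>n. \<integral>x. (Dper L \<alpha> (u n) x - Dper L \<alpha> w x)\<^sup>2 \<partial>lebesgue_on (cube (2 * L))) \<longlonglongrightarrow> 0"
proof -
  let ?Q = "lebesgue_on (cube (2 * L)) :: (real^'d) measure"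
  let ?U = "ocube (4 * L) :: (real^'d) set"
  have finQ: "finite_measure ?Q" by (intro finite_measure_lebesgue_on) simp
  have finU: "finite_measure (lebesgue_on ?U)" by (intro finite_measure_lebesgue_on) simp
  have D: "sq_int ?Q (Dper L \<alpha> (u n))" if "mi_order \<alpha> \<le> s" for \<alpha> n using Hper_Dper(3)[OF u that] .
  have "\<exists>G. sq_int ?Q G \<and> (\<lambda>n. \<integral>x. (Dper L \<alpha> (u n) x - G x)\<^sup>2 \<partial>?Q) \<longlonglongrightarrow> 0" if "mi_order \<alpha> \<le> s" for \<alpha>
    by (rule sq_int_complete[OF finQ D[OF that] cau[OF that]]) blast+
  then have "\<forall>\<alpha>. \<exists>G. mi_order \<alpha> \<le> s \<longrightarrow>
      sq_int ?Q G \<and> (\<lambda>n. \<integral>x. (Dper L \<alpha> (u n) x - G x)\<^sup>2 \<partial>?Q) \<longlonglongrightarrow> 0" by blast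
  from choice[OF this] obtain G where G: "\<And>\<alpha>. mi_order \<alpha> \<le> s \<Longrightarrow> sq_int ?Q (G \<alpha>)"
    "\<And>\<alpha>. mi_order \<alpha> \<le> s \<Longrightarrow> (\<lambda>n. \<integral>x. (Dper L \<alpha> (u n) x - G \<alpha> x)\<^sup>2 \<partial>?Q) \<longlonglongrightarrow> 0" by blast
  \<comment> \<open>Periodic extension is linear and bounded between the two L2 spaces, the constant
    being the number of cells.\<close>
  have ext: "(\<lambda>n. \<integral>x. (perext L (F n) x - perext L H x)\<^sup>2 \<partial>lebesgue_on ?U) \<longlonglongrightarrow> 0"
    if "\<And>n. sq_int ?Q (F n)" "sq_int ?Q H" "(\<lambda>n. \<integral>x. (F n x - H x)\<^sup>2 \<partial>?Q) \<longlonglongrightarrow> 0" for F H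
  proof (rule tendsto_sandwich[where f = "\<lambda>_. 0"])
    show "\<forall>\<^sub>F n in sequentially. (\<integral>x. (perext L (F n) x - perext L H x)\<^sup>2 \<partial>lebesgue_on ?U)
        \<le> real (card (shifts :: ('d \<Rightarrow> int) set)) * (\<integral>x. (F n x - H x)\<^sup>2 \<partial>?Q)"
      using sq_int_perext(2)[OF sq_int_diff[OF that(1,2)]]
      by (intro always_eventually allI) (simp add: perext_def)
    show "(\<lambda>n. real (card (shifts :: ('d \<Rightarrow> int) set)) * (\<integral>x. (F n x - H x)\<^sup>2 \<partial>?Q)) \<longlonglongrightarrow> 0"
      using tendsto_mult[OF tendsto_const that(3)] by simp
  qed auto
  \<comment> \<open>The limit of the derivatives of order zero, which agree a.e. with the
    \<open>u n\<close>.\<close>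
  define w where "w = G (\<lambda>_. 0)"
  have o0: "mi_order (\<lambda>_::'d. 0) \<le> s" by (simp add: mi_order_def)
  have w: "sq_int ?Q w" unfolding w_def by (rule G(1)[OF o0])
  have uw: "(\<lambda>n. \<integral>x. (u n x - w x)\<^sup>2 \<partial>?Q) \<longlonglongrightarrow> 0"
  proof -
    have "(\<integral>x. (u n x - w x)\<^sup>2 \<partial>?Q) = (\<integral>x. (Dper L (\<lambda>_. 0) (u n) x - w x)\<^sup>2 \<partial>?Q)" for n
      using sq_int_diff[OF Hper_sq_int[OF u] w, THEN sq_int_measurable]
        sq_int_diff[OF D[OF o0] w, THEN sq_int_measurable] Dper_zero_order[OF u, of n]
      by (intro integral_cong_AE) auto
    then show ?thesis using G(2)[OF o0] by (simp add: w_def)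
  qed
  have wd: "weak_deriv ?U \<alpha> (perext L w) (perext L (G \<alpha>))" if a: "mi_order \<alpha> \<le> s" for \<alpha>
    unfolding weak_deriv_def
  proof (intro conjI allI impI)
    show "loc_int ?U (perext L w)" "loc_int ?U (perext L (G \<alpha>))"
      using sq_int_perext(1)[OF w] sq_int_perext(1)[OF G(1)[OF a]] by (auto intro: sq_int_loc_int)
    fix \<phi> assume t: "test_fun ?U \<phi>"
    have ts: "sq_int (lebesgue_on ?U) (pdiffs l \<phi>)" for l
    proof -
      obtain C where "\<And>x. \<bar>pdiffs l \<phi> x\<bar> \<le> C" using test_fun_pdiffs_bounded[OF t] by blast
      then show ?thesis by (intro sq_int_bounded[OF finU test_fun_pdiffs_measurable[OF t], where C = C])
    qed
    let ?p = "pdiffs (mi_list \<alpha>) \<phi>" and ?s = "(-1) ^ mi_order \<alpha> :: real"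
    have "(\<lambda>n. \<integral>x. perext L (u n) x * ?p x \<partial>lebesgue_on ?U) \<longlonglongrightarrow> (\<integral>x. perext L w x * ?p x \<partial>lebesgue_on ?U)"
      by (intro sq_int_tendsto_mult sq_int_perext(1) Hper_sq_int[OF u] w ts ext uw)
    moreover have "(\<lambda>n. \<integral>x. perext L (Dper L \<alpha> (u n)) x * \<phi> x \<partial>lebesgue_on ?U)
        \<longlonglongrightarrow> (\<integral>x. perext L (G \<alpha>) x * \<phi> x \<partial>lebesgue_on ?U)"
      using ts[of "[]"] by (intro sq_int_tendsto_mult sq_int_perext(1) D[OF a] G(1)[OF a] ext G(2)[OF a]) simp_all
    then have "(\<lambda>n. ?s * (\<integral>x. perext L (Dper L \<alpha> (u n)) x * \<phi> x \<partial>lebesgue_on ?U))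
        \<longlonglongrightarrow> ?s * (\<integral>x. perext L (G \<alpha>) x * \<phi> x \<partial>lebesgue_on ?U)"
      by (intro tendsto_mult tendsto_const)
    moreover have "?s * (\<integral>x. perext L (Dper L \<alpha> (u n)) x * \<phi> x \<partial>lebesgue_on ?U)
        = (\<integral>x. perext L (u n) x * ?p x \<partial>lebesgue_on ?U)" for n
    proof -
      have "(\<integral>x. perext L (u n) x * ?p x \<partial>lebesgue_on ?U) = ?s * (\<integral>x. Dper L \<alpha> (u n) x * \<phi> x \<partial>lebesgue_on ?U)"
        using weak_derivD[OF Hper_Dper(1)[OF u a] t, of n] by (simp add: set_integral_lebesgue_on)
      also have "(\<integral>x. Dper L \<alpha> (u n) x * \<phi> x \<partial>lebesgue_on ?U)
          = (\<integral>x. perext L (Dper L \<alpha> (u n)) x * \<phi> x \<partial>lebesgue_on ?U)"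
      proof (rule integral_cong_AE)
        show "(\<lambda>x. Dper L \<alpha> (u n) x * \<phi> x) \<in> borel_measurable (lebesgue_on ?U)"
          using sq_int_measurable[OF ts[of "[]"]] sq_int_measurable[OF Hper_Dper(2)[OF u a]] by simp
        show "(\<lambda>x. perext L (Dper L \<alpha> (u n)) x * \<phi> x) \<in> borel_measurable (lebesgue_on ?U)"
          using sq_int_measurable[OF ts[of "[]"]] sq_int_measurable[OF sq_int_perext(1)[OF D[OF a]]] by simp
        show "AE x in lebesgue_on ?U. Dper L \<alpha> (u n) x * \<phi> x = perext L (Dper L \<alpha> (u n)) x * \<phi> x"
          using weak_deriv_perext_periodic[OF Hper_Dper(1)[OF u a], of n] by eventually_elim simp
      qed
      finally show ?thesis by simp
    qed
    ultimately have "(\<integral>x. perext L w x * ?p x \<partial>lebesgue_on ?U) = ?s * (\<integral>x. perext L (G \<alpha>) x * \<phi> x \<partial>lebesgue_on ?U)"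
      using LIMSEQ_unique by simp
    then show "(LINT x:?U|lebesgue. perext L w x * ?p x) = ?s * (LINT x:?U|lebesgue. perext L (G \<alpha>) x * \<phi> x)"
      by (simp add: set_integral_lebesgue_on)
  qed
  have wH: "w \<in> Hper L s" by (rule HperI[OF w wd G(1)])
  have "(\<lambda>n. \<integral>x. (Dper L \<alpha> (u n) x - Dper L \<alpha> w x)\<^sup>2 \<partial>?Q) \<longlonglongrightarrow> 0" if a: "mi_order \<alpha> \<le> s" for \<alpha>
  proof -
    have ae: "AE x in ?Q. Dper L \<alpha> w x = G \<alpha> x"
      using Dper_AE_eq[OF wH a wd[OF a]] perext_AE[of "G \<alpha>"] by eventually_elim simp
    have "(\<integral>x. (Dper L \<alpha> (u n) x - Dper L \<alpha> w x)\<^sup>2 \<partial>?Q) = (\<integral>x. (Dper L \<alpha> (u n) x - G \<alpha> x)\<^sup>2 \<partial>?Q)" for n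
      using sq_int_diff[OF D[OF a] Hper_Dper(3)[OF wH a], THEN sq_int_measurable]
        sq_int_diff[OF D[OF a] G(1)[OF a], THEN sq_int_measurable] ae
      by (intro integral_cong_AE) auto
    then show ?thesis using G(2)[OF a] by simp
  qed
  with wH show ?thesis by blast
qed

end

section \<open>The energy form\<close>

lemma sq_int_integral_lincomb:
  assumes "sq_int M f" "sq_int M g" "sq_int M h" "sq_int M k" "AE x in M. k x = c * f x + g x"
  shows "(\<integral>x. k x * h x \<partial>M) = c * (\<integral>x. f x * h x \<partial>M) + (\<integral>x. g x * h x \<partial>M)"
proof -
  have "(\<integral>x. k x * h x \<partial>M) = (\<integral>x. c * (f x * h x) + g x * h x \<partial>M)"
  proof (rule integral_cong_AE)
    show "(\<lambda>x. k x * h x) \<in> borel_measurable M" "(\<lambda>x. c * (f x * h x) + g x * h x) \<in> borel_measurable M"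
      using assms(1-4)[THEN sq_int_measurable] by simp_all
    show "AE x in M. k x * h x = c * (f x * h x) + g x * h x"
      using assms(5) by eventually_elim (simp add: algebra_simps)
  qed
  also have "\<dots> = c * (\<integral>x. f x * h x \<partial>M) + (\<integral>x. g x * h x \<partial>M)"
    using sq_int_mult[OF assms(1,3)] sq_int_mult[OF assms(2,3)] by simp
  finally show ?thesis .
qed

locale sobolev_form = period +
  fixes s :: nat and \<Omega> :: "(real^'d::finite) set" and p :: "('d \<Rightarrow> nat) \<Rightarrow> real^'d \<Rightarrow> real"
    and lamn mun :: real
  assumes Om: "\<Omega> \<in> sets lebesgue" "\<Omega> \<subseteq> cube L"
    and s: "s > 0" "real s > real CARD('d) / 2"
    and lam: "lamn > 0" and mu: "mun \<ge> 0"
    and p_meas: "\<And>\<alpha>. p \<alpha> \<in> borel_measurable (lebesgue_on \<Omega>)"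
    and p_bdd: "\<And>\<alpha>. \<exists>B. \<forall>x\<in>\<Omega>. \<bar>p \<alpha> x\<bar> \<le> B"
begin

abbreviation H :: "(real^'d \<Rightarrow> real) set" where "H \<equiv> Hper L s"
abbreviation Q :: "(real^'d) measure" where "Q \<equiv> lebesgue_on (cube (2 * L))"
abbreviation A :: "('d \<Rightarrow> nat) set" where "A \<equiv> {\<alpha>. mi_order \<alpha> \<le> s}"
abbreviation B :: "(real^'d \<Rightarrow> real) \<Rightarrow> (real^'d \<Rightarrow> real) \<Rightarrow> real" where "B \<equiv> Bform L s \<Omega> p lamn mun"

lemma Om_subset: "\<Omega> \<subseteq> cube (2 * L)"
proof -
  have "cube L \<subseteq> (cube (2 * L) :: (real^'d) set)"
  proof
    fix x :: "real^'d" assume "x \<in> cube L"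
    then have "\<bar>x $ i\<bar> \<le> L" for i by (simp add: cube_def)
    then have "\<bar>x $ i\<bar> \<le> 2 * L" for i by (rule order_trans) (use L_pos in simp)
    then show "x \<in> cube (2 * L)" by (simp add: cube_def)
  qed
  with Om(2) show ?thesis by (rule subset_trans)
qed

lemma finite_measure_Q: "finite_measure Q"
  by (intro finite_measure_lebesgue_on) simp

lemma B_eq: "B u v = lamn * (\<Sum>\<alpha>\<in>A. \<integral>x. Dper L \<alpha> u x * Dper L \<alpha> v x \<partial>Q)
    + mun * (\<integral>x. Dop L s p u x * Dop L s p v x \<partial>lebesgue_on \<Omega>)"
  by (simp add: Bform_def set_integral_lebesgue_on Om(1))

lemma B_sym: "B u v = B v u"
  by (simp add: B_eq mult.commute)

lemma D_Om: "u \<in> H \<Longrightarrow> \<alpha> \<in> A \<Longrightarrow> sq_int (lebesgue_on \<Omega>) (Dper L \<alpha> u)"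
  using Om(1) by (intro sq_int_lebesgue_on_subset(1)[OF Hper_Dper(3)[of u s \<alpha>] Om_subset]) auto

lemma Dop_sq_int:
  assumes "u \<in> H" shows "sq_int (lebesgue_on \<Omega>) (Dop L s p u)"
  unfolding Dop_def
proof (intro sq_int_sum)
  fix \<alpha> assume a: "\<alpha> \<in> A"
  obtain C where "\<forall>x\<in>\<Omega>. \<bar>p \<alpha> x\<bar> \<le> C" using p_bdd by blast
  then show "sq_int (lebesgue_on \<Omega>) (\<lambda>x. p \<alpha> x * Dper L \<alpha> u x)"
    by (intro sq_int_mult_bounded[OF D_Om[OF assms a] p_meas]) auto
qed

lemma Dop_lincomb:
  assumes "u \<in> H" "v \<in> H"
  shows "AE x in lebesgue_on \<Omega>. Dop L s p (\<lambda>x. c * u x + v x) x = c * Dop L s p u x + Dop L s p v x"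
proof -
  have "AE x in lebesgue_on \<Omega>. \<forall>\<alpha>\<in>A. Dper L \<alpha> (\<lambda>x. c * u x + v x) x = c * Dper L \<alpha> u x + Dper L \<alpha> v x"
  proof (rule AE_finite_allI[OF finite_mi_order])
    fix \<alpha> assume "\<alpha> \<in> A"
    then show "AE x in lebesgue_on \<Omega>. Dper L \<alpha> (\<lambda>x. c * u x + v x) x = c * Dper L \<alpha> u x + Dper L \<alpha> v x"
      using Om(1) by (intro AE_lebesgue_on_subset[OF Hper_lincomb(2)[OF assms] Om_subset]) auto
  qed
  then show ?thesis
    by eventually_elim (simp add: Dop_def sum_distrib_left sum.distrib[symmetric] algebra_simps)
qed

lemma B_lincomb:
  assumes "u \<in> H" "v \<in> H" "w \<in> H"
  shows "B (\<lambda>x. c * u x + v x) w = c * B u w + B v w"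
proof -
  let ?z = "\<lambda>x. c * u x + v x"
  have z: "?z \<in> H" by (rule Hper_lincomb(1)[OF assms(1,2)])
  have 1: "(\<integral>x. Dper L \<alpha> ?z x * Dper L \<alpha> w x \<partial>Q)
      = c * (\<integral>x. Dper L \<alpha> u x * Dper L \<alpha> w x \<partial>Q) + (\<integral>x. Dper L \<alpha> v x * Dper L \<alpha> w x \<partial>Q)"
    if "\<alpha> \<in> A" for \<alpha>
    using that assms z by (intro sq_int_integral_lincomb Hper_Dper(3) Hper_lincomb(2)) auto
  have 2: "(\<integral>x. Dop L s p ?z x * Dop L s p w x \<partial>lebesgue_on \<Omega>)
      = c * (\<integral>x. Dop L s p u x * Dop L s p w x \<partial>lebesgue_on \<Omega>) + (\<integral>x. Dop L s p v x * Dop L s p w x \<partial>lebesgue_on \<Omega>)"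
    using assms z by (intro sq_int_integral_lincomb Dop_sq_int Dop_lincomb)
  have 3: "(\<Sum>\<alpha>\<in>A. \<integral>x. Dper L \<alpha> ?z x * Dper L \<alpha> w x \<partial>Q)
      = c * (\<Sum>\<alpha>\<in>A. \<integral>x. Dper L \<alpha> u x * Dper L \<alpha> w x \<partial>Q) + (\<Sum>\<alpha>\<in>A. \<integral>x. Dper L \<alpha> v x * Dper L \<alpha> w x \<partial>Q)"
    unfolding sum_distrib_left sum.distrib[symmetric] by (intro sum.cong refl 1)
  show ?thesis unfolding B_eq 2 3 by (simp add: algebra_simps)
qed

lemma B_lower:
  assumes "\<alpha> \<in> A"
  shows "lamn * (\<integral>x. (Dper L \<alpha> u x)\<^sup>2 \<partial>Q) \<le> B u u"
proof -
  have "(\<integral>x. (Dper L \<alpha> u x)\<^sup>2 \<partial>Q) \<le> (\<Sum>\<alpha>\<in>A. \<integral>x. (Dper L \<alpha> u x)\<^sup>2 \<partial>Q)"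
    using assms finite_mi_order by (intro member_le_sum) auto
  then have "lamn * (\<integral>x. (Dper L \<alpha> u x)\<^sup>2 \<partial>Q) \<le> lamn * (\<Sum>\<alpha>\<in>A. \<integral>x. (Dper L \<alpha> u x)\<^sup>2 \<partial>Q)"
    using lam by (intro mult_left_mono) auto
  moreover have "0 \<le> mun * (\<integral>x. (Dop L s p u x)\<^sup>2 \<partial>lebesgue_on \<Omega>)" using mu by simp
  ultimately show ?thesis by (simp add: B_eq power2_eq_square)
qed

lemma B_nonneg: "0 \<le> B u u"
proof -
  have "(\<lambda>_. 0) \<in> A" by (simp add: mi_order_def)
  from B_lower[OF this, of u] have "lamn * (\<integral>x. (Dper L (\<lambda>_. 0) u x)\<^sup>2 \<partial>Q) \<le> B u u" .
  moreover have "0 \<le> lamn * (\<integral>x. (Dper L (\<lambda>_. 0) u x)\<^sup>2 \<partial>Q)" using lam by simp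
  ultimately show ?thesis by linarith
qed

lemma B_lower_L2:
  assumes "u \<in> H"
  shows "lamn * (\<integral>x. (u x)\<^sup>2 \<partial>Q) \<le> B u u"
proof -
  have a: "(\<lambda>_. 0) \<in> A" by (simp add: mi_order_def)
  then have a': "mi_order (\<lambda>_::'d. 0) \<le> s" by simp
  have "(\<integral>x. (u x)\<^sup>2 \<partial>Q) = (\<integral>x. (Dper L (\<lambda>_. 0) u x)\<^sup>2 \<partial>Q)"
    using sq_int_measurable[OF Hper_sq_int[OF assms]] sq_int_measurable[OF Hper_Dper(3)[OF assms a']]
      Dper_zero_order[OF assms] by (intro integral_cong_AE) auto
  with B_lower[OF a, of u] show ?thesis by simp
qed

text \<open>Bounded coefficients and Cauchy-Schwarz over the finitely many multi-indices control the
  differential term. Together with \<open>B_lower\<close> this makes energy and Sobolev norm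
  equivalent, so completeness carries over to the energy.\<close>

lemma B_upper:
  obtains K where "\<And>u. u \<in> H \<Longrightarrow> B u u \<le> K * (\<Sum>\<alpha>\<in>A. \<integral>x. (Dper L \<alpha> u x)\<^sup>2 \<partial>Q)"
proof -
  have "\<forall>\<alpha>. \<exists>C. \<forall>x\<in>\<Omega>. \<bar>p \<alpha> x\<bar> \<le> C" using p_bdd by blast
  from choice[OF this] obtain C where C: "\<And>\<alpha> x. x \<in> \<Omega> \<Longrightarrow> \<bar>p \<alpha> x\<bar> \<le> C \<alpha>" by blast
  define P where "P = (\<Sum>\<alpha>\<in>A. (C \<alpha>)\<^sup>2)"
  have P: "(p \<alpha> x)\<^sup>2 \<le> P" if "x \<in> \<Omega>" "\<alpha> \<in> A" for x \<alpha>
  proof -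
    have "(p \<alpha> x)\<^sup>2 \<le> (C \<alpha>)\<^sup>2" using C[OF that(1), of \<alpha>] abs_le_square_iff[of "p \<alpha> x" "C \<alpha>"] by auto
    also have "\<dots> \<le> P" unfolding P_def using that(2) finite_mi_order by (intro member_le_sum) auto
    finally show ?thesis .
  qed
  have "B u u \<le> (lamn + mun * (real (card A) * P)) * (\<Sum>\<alpha>\<in>A. \<integral>x. (Dper L \<alpha> u x)\<^sup>2 \<partial>Q)" if u: "u \<in> H" for u
  proof -
    have i: "integrable (lebesgue_on \<Omega>) (\<lambda>x. (Dper L \<alpha> u x)\<^sup>2)" if "\<alpha> \<in> A" for \<alpha>
      using D_Om[OF u that] by (simp add: sq_int_def)
    have "(\<integral>x. (Dop L s p u x)\<^sup>2 \<partial>lebesgue_on \<Omega>)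
        \<le> (\<integral>x. (\<Sum>\<alpha>\<in>A. real (card A) * P * (Dper L \<alpha> u x)\<^sup>2) \<partial>lebesgue_on \<Omega>)"
    proof (rule integral_mono)
      show "integrable (lebesgue_on \<Omega>) (\<lambda>x. (Dop L s p u x)\<^sup>2)" using Dop_sq_int[OF u] by (simp add: sq_int_def)
      show "integrable (lebesgue_on \<Omega>) (\<lambda>x. \<Sum>\<alpha>\<in>A. real (card A) * P * (Dper L \<alpha> u x)\<^sup>2)"
        using i by (intro Bochner_Integration.integrable_sum integrable_mult_right) auto
      fix x assume "x \<in> space (lebesgue_on \<Omega>)"
      then have x: "x \<in> \<Omega>" by simp
      have "(Dop L s p u x)\<^sup>2 \<le> real (card A) * (\<Sum>\<alpha>\<in>A. (p \<alpha> x * Dper L \<alpha> u x)\<^sup>2)"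
        unfolding Dop_def using sum_squared_le_sum_of_squares[of "\<lambda>\<alpha>. p \<alpha> x * Dper L \<alpha> u x" A]
        by (simp add: mult.commute)
      also have "\<dots> \<le> real (card A) * (\<Sum>\<alpha>\<in>A. P * (Dper L \<alpha> u x)\<^sup>2)"
        using P[OF x] by (intro mult_left_mono sum_mono) (auto simp: power_mult_distrib intro: mult_right_mono)
      finally show "(Dop L s p u x)\<^sup>2 \<le> (\<Sum>\<alpha>\<in>A. real (card A) * P * (Dper L \<alpha> u x)\<^sup>2)"
        by (simp add: sum_distrib_left mult.assoc)
    qed
    also have "\<dots> = real (card A) * P * (\<Sum>\<alpha>\<in>A. \<integral>x. (Dper L \<alpha> u x)\<^sup>2 \<partial>lebesgue_on \<Omega>)"
      using i by (simp add: sum_distrib_left)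
    also have "\<dots> \<le> real (card A) * P * (\<Sum>\<alpha>\<in>A. \<integral>x. (Dper L \<alpha> u x)\<^sup>2 \<partial>Q)"
    proof (intro mult_left_mono sum_mono)
      show "(\<integral>x. (Dper L \<alpha> u x)\<^sup>2 \<partial>lebesgue_on \<Omega>) \<le> (\<integral>x. (Dper L \<alpha> u x)\<^sup>2 \<partial>Q)" if "\<alpha> \<in> A" for \<alpha>
        using that Om(1) by (intro sq_int_lebesgue_on_subset(2)[OF Hper_Dper(3)[OF u] Om_subset]) auto
      show "0 \<le> real (card A) * P" by (simp add: P_def sum_nonneg)
    qed
    finally have "mun * (\<integral>x. (Dop L s p u x)\<^sup>2 \<partial>lebesgue_on \<Omega>)
        \<le> mun * (real (card A) * P * (\<Sum>\<alpha>\<in>A. \<integral>x. (Dper L \<alpha> u x)\<^sup>2 \<partial>Q))"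
      using mu by (rule mult_left_mono)
    then show ?thesis by (simp add: B_eq power2_eq_square algebra_simps)
  qed
  then show ?thesis by (rule that)
qed

lemma Dper_diff_norm:
  assumes "u \<in> H" "v \<in> H" "\<alpha> \<in> A"
  shows "(\<integral>x. (Dper L \<alpha> (\<lambda>x. (-1) * v x + u x) x)\<^sup>2 \<partial>Q) = (\<integral>x. (Dper L \<alpha> u x - Dper L \<alpha> v x)\<^sup>2 \<partial>Q)"
proof -
  have a: "mi_order \<alpha> \<le> s" using assms(3) by simp
  have ae: "AE x in Q. Dper L \<alpha> (\<lambda>x. (-1) * v x + u x) x = (-1) * Dper L \<alpha> v x + Dper L \<alpha> u x"
    by (rule Hper_lincomb(2)[OF assms(2,1) a])
  show ?thesis
  proof (rule integral_cong_AE)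
    show "AE x in Q. (Dper L \<alpha> (\<lambda>x. (-1) * v x + u x) x)\<^sup>2 = (Dper L \<alpha> u x - Dper L \<alpha> v x)\<^sup>2"
      using ae by eventually_elim (simp del: mult_minus1)
    show "(\<lambda>x. (Dper L \<alpha> (\<lambda>x. (-1) * v x + u x) x)\<^sup>2) \<in> borel_measurable Q"
      by (intro borel_measurable_power sq_int_measurable[OF Hper_Dper(3)[OF Hper_lincomb(1)[OF assms(2,1)] a]])
    show "(\<lambda>x. (Dper L \<alpha> u x - Dper L \<alpha> v x)\<^sup>2) \<in> borel_measurable Q"
      using sq_int_measurable[OF Hper_Dper(3)[OF assms(1) a]] sq_int_measurable[OF Hper_Dper(3)[OF assms(2) a]]
      by simp
  qed
qed

lemma B_complete:
  fixes u :: "nat \<Rightarrow> real^'d \<Rightarrow> real"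
  assumes u: "\<And>n. u n \<in> H"
    and cau: "\<And>e. e > 0 \<Longrightarrow> \<exists>N. \<forall>i\<ge>N. \<forall>j\<ge>N. B (\<lambda>x. (-1) * u j x + u i x) (\<lambda>x. (-1) * u j x + u i x) < e"
  shows "\<exists>w\<in>H. (\<lambda>n. B (\<lambda>x. (-1) * w x + u n x) (\<lambda>x. (-1) * w x + u n x)) \<longlonglongrightarrow> 0"
proof -
  have "\<exists>w\<in>H. \<forall>\<alpha>. mi_order \<alpha> \<le> s \<longrightarrow> (\<lambda>n. \<integral>x. (Dper L \<alpha> (u n) x - Dper L \<alpha> w x)\<^sup>2 \<partial>Q) \<longlonglongrightarrow> 0"
  proof (rule Hper_complete[OF u])
    fix \<alpha> :: "'d \<Rightarrow> nat" and e :: real assume a: "mi_order \<alpha> \<le> s" and e: "e > 0"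
    then have aA: "\<alpha> \<in> A" by simp
    obtain N where N: "\<And>i j. i \<ge> N \<Longrightarrow> j \<ge> N \<Longrightarrow> B (\<lambda>x. (-1) * u j x + u i x) (\<lambda>x. (-1) * u j x + u i x) < lamn * e"
      using cau[of "lamn * e"] lam e by auto
    have "(\<integral>x. (Dper L \<alpha> (u i) x - Dper L \<alpha> (u j) x)\<^sup>2 \<partial>Q) < e" if "i \<ge> N" "j \<ge> N" for i j
    proof -
      have "lamn * (\<integral>x. (Dper L \<alpha> (u i) x - Dper L \<alpha> (u j) x)\<^sup>2 \<partial>Q) < lamn * e"
        using B_lower[OF aA, of "\<lambda>x. (-1) * u j x + u i x"] N[OF that]
        unfolding Dper_diff_norm[OF u u aA] by linarith
      then show ?thesis using lam by simp
    qed
    then show "\<exists>N. \<forall>i\<ge>N. \<forall>j\<ge>N. (\<integral>x. (Dper L \<alpha> (u i) x - Dper L \<alpha> (u j) x)\<^sup>2 \<partial>Q) < e" by blast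
  qed
  then obtain w where w: "w \<in> H" and lim: "\<And>\<alpha>. \<alpha> \<in> A \<Longrightarrow> (\<lambda>n. \<integral>x. (Dper L \<alpha> (u n) x - Dper L \<alpha> w x)\<^sup>2 \<partial>Q) \<longlonglongrightarrow> 0"
    by blast
  obtain K where K: "\<And>u. u \<in> H \<Longrightarrow> B u u \<le> K * (\<Sum>\<alpha>\<in>A. \<integral>x. (Dper L \<alpha> u x)\<^sup>2 \<partial>Q)" using B_upper by blast
  have "(\<lambda>n. B (\<lambda>x. (-1) * w x + u n x) (\<lambda>x. (-1) * w x + u n x)) \<longlonglongrightarrow> 0"
  proof (rule tendsto_sandwich[where f = "\<lambda>_. 0"])
    show "\<forall>\<^sub>F n in sequentially. B (\<lambda>x. (-1) * w x + u n x) (\<lambda>x. (-1) * w x + u n x)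
        \<le> K * (\<Sum>\<alpha>\<in>A. \<integral>x. (Dper L \<alpha> (u n) x - Dper L \<alpha> w x)\<^sup>2 \<partial>Q)"
    proof (intro always_eventually allI)
      fix n
      have "(\<Sum>\<alpha>\<in>A. \<integral>x. (Dper L \<alpha> (\<lambda>x. (-1) * w x + u n x) x)\<^sup>2 \<partial>Q)
          = (\<Sum>\<alpha>\<in>A. \<integral>x. (Dper L \<alpha> (u n) x - Dper L \<alpha> w x)\<^sup>2 \<partial>Q)"
        by (intro sum.cong refl Dper_diff_norm u w)
      then show "B (\<lambda>x. (-1) * w x + u n x) (\<lambda>x. (-1) * w x + u n x)
          \<le> K * (\<Sum>\<alpha>\<in>A. \<integral>x. (Dper L \<alpha> (u n) x - Dper L \<alpha> w x)\<^sup>2 \<partial>Q)"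
        using K[OF Hper_lincomb(1)[OF w u, of "-1" n]] by simp
    qed
    have "(\<lambda>n. K * (\<Sum>\<alpha>\<in>A. \<integral>x. (Dper L \<alpha> (u n) x - Dper L \<alpha> w x)\<^sup>2 \<partial>Q)) \<longlonglongrightarrow> K * (\<Sum>\<alpha>\<in>A. 0)"
      by (intro tendsto_mult tendsto_const tendsto_sum lim)
    then show "(\<lambda>n. K * (\<Sum>\<alpha>\<in>A. \<integral>x. (Dper L \<alpha> (u n) x - Dper L \<alpha> w x)\<^sup>2 \<partial>Q)) \<longlonglongrightarrow> 0" by simp
    show "\<forall>\<^sub>F n in sequentially. 0 \<le> B (\<lambda>x. (-1) * w x + u n x) (\<lambda>x. (-1) * w x + u n x)"
      by (intro always_eventually allI B_nonneg)
  qed auto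
  with w show ?thesis by blast
qed

text \<open>Discharges the \<open>SOME\<close> in \<open>On\<close>: pairing with h is bounded for
  the energy since \<open>lamn > 0\<close> lets the energy dominate the L2 norm, and the energy
  space is complete.\<close>

lemma On_spec:
  assumes h: "sq_int Q h"
  shows "On L s \<Omega> p lamn mun h \<in> H"
    "\<phi> \<in> H \<Longrightarrow> B (On L s \<Omega> p lamn mun h) \<phi> = (\<integral>x. \<phi> x * h x \<partial>Q)"
proof -
  have "\<exists>w\<in>H. \<forall>\<phi>\<in>H. B w \<phi> = (\<integral>x. \<phi> x * h x \<partial>Q)"
  proof (rule riesz_representation)
    fix u :: "nat \<Rightarrow> real^'d \<Rightarrow> real"
    assume "\<And>n. u n \<in> H"
      "\<And>e. e > 0 \<Longrightarrow> \<exists>N. \<forall>i\<ge>N. \<forall>j\<ge>N. B (\<lambda>x. (-1) * u j x + u i x) (\<lambda>x. (-1) * u j x + u i x) < e"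
    then show "\<exists>w\<in>H. (\<lambda>n. B (\<lambda>x. (-1) * w x + u n x) (\<lambda>x. (-1) * w x + u n x)) \<longlonglongrightarrow> 0"
      by (rule B_complete)
  next
    show "(\<integral>x. (c * u x + v x) * h x \<partial>Q) = c * (\<integral>x. u x * h x \<partial>Q) + (\<integral>x. v x * h x \<partial>Q)"
      if "u \<in> H" "v \<in> H" for c u v
      by (rule sq_int_integral_lincomb[OF Hper_sq_int[OF that(1)] Hper_sq_int[OF that(2)] h
            Hper_sq_int[OF Hper_lincomb(1)[OF that]]]) auto
    show "(\<integral>x. u x * h x \<partial>Q)\<^sup>2 \<le> (\<integral>x. (h x)\<^sup>2 \<partial>Q) / lamn * B u u" if u: "u \<in> H" for u
    proof -
      have "(\<integral>x. u x * h x \<partial>Q)\<^sup>2 \<le> (\<integral>x. (u x)\<^sup>2 \<partial>Q) * (\<integral>x. (h x)\<^sup>2 \<partial>Q)"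
        by (intro sq_int_Cauchy_Schwarz Hper_sq_int[OF u] h)
      also have "\<dots> \<le> (B u u / lamn) * (\<integral>x. (h x)\<^sup>2 \<partial>Q)"
        using B_lower_L2[OF u] lam by (intro mult_right_mono) (auto simp: field_simps)
      finally show ?thesis by (simp add: mult.commute)
    qed
  qed (auto intro: Hper_zero Hper_lincomb(1) B_lincomb B_nonneg B_sym)
  then have "\<exists>w. w \<in> H \<and> (\<forall>\<phi>\<in>H. B w \<phi> = (LINT x:cube (2 * L)|lebesgue. \<phi> x * h x))"
    by (auto simp: set_integral_lebesgue_on)
  from someI_ex[OF this] show "On L s \<Omega> p lamn mun h \<in> H"
    "\<phi> \<in> H \<Longrightarrow> B (On L s \<Omega> p lamn mun h) \<phi> = (\<integral>x. \<phi> x * h x \<partial>Q)"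
    unfolding On_def[symmetric] by (auto simp: set_integral_lebesgue_on)
qed

end

section \<open>Boundedness of point evaluation\<close>

lemma tensor_remove: "tensor f y = f j (y $ j) * (\<Prod>i\<in>UNIV - {j}. f i (y $ i))"
  unfolding tensor_def by (rule prod.remove) auto

lemma tensor_upd_diff:
  "tensor (f(j := \<lambda>t. a t - b t)) y = tensor (f(j := a)) y - tensor (f(j := b)) y"
proof -
  have "(\<Prod>i\<in>UNIV - {j}. (f(j := c)) i (y $ i)) = (\<Prod>i\<in>UNIV - {j}. f i (y $ i))" for c
    by (intro prod.cong) auto
  then show ?thesis by (simp add: tensor_remove[of _ y j] left_diff_distrib)
qed

lemma integral_square_supported_le:
  fixes F :: "real^'d::finite \<Rightarrow> real"
  assumes F: "F \<in> borel_measurable (lebesgue_on S)" and S: "S \<in> sets lebesgue"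
    and supp: "\<And>y. y \<notin> cbox x (x + e *\<^sub>R One) \<Longrightarrow> F y = 0"
    and bd: "\<And>y. \<bar>F y\<bar> \<le> K" and e: "e > 0"
  shows "sq_int (lebesgue_on S) F" "(\<integral>y. (F y)\<^sup>2 \<partial>lebesgue_on S) \<le> K\<^sup>2 * e ^ CARD('d)"
proof -
  let ?C = "cbox x (x + e *\<^sub>R One)"
  have meas: "measure lebesgue ?C = e ^ CARD('d)"
    using e by (subst measure_completion, simp, subst content_cbox) (auto simp: inner_add_left)
  have i: "integrable lebesgue (\<lambda>y. K\<^sup>2 * indicator ?C y)" 
    using lmeasurable_cbox[of x "x + e *\<^sub>R One"] by (intro integrable_mult_right integrable_real_indicator) (auto simp: fmeasurable_def)
  have b: "indicator S y *\<^sub>R (F y)\<^sup>2 \<le> K\<^sup>2 * indicator ?C y" for y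
  proof (cases "y \<in> ?C")
    case True
    have "(F y)\<^sup>2 \<le> K\<^sup>2"
      using bd[of y] order_trans[OF bd abs_ge_self, of y] by (simp add: abs_le_square_iff[symmetric])
    then show ?thesis using True by (auto split: split_indicator)
  qed (simp add: supp)
  have m: "(\<lambda>y. indicator S y *\<^sub>R (F y)\<^sup>2) \<in> borel_measurable lebesgue"
    using F S by (subst borel_measurable_restrict_space_iff[symmetric]) auto
  have i2: "integrable lebesgue (\<lambda>y. indicator S y *\<^sub>R (F y)\<^sup>2)"
    by (rule Bochner_Integration.integrable_bound[OF i m])
      (use b in \<open>auto intro!: AE_I2 order_trans[OF _ abs_ge_self] simp: abs_mult\<close>)
  then show "sq_int (lebesgue_on S) F" using F S by (simp add: sq_int_def integrable_restrict_space)
  have "(\<integral>y. (F y)\<^sup>2 \<partial>lebesgue_on S) = (\<integral>y. indicator S y *\<^sub>R (F y)\<^sup>2 \<partial>lebesgue)"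
    using S by (simp add: integral_restrict_space)
  also have "\<dots> \<le> (\<integral>y. K\<^sup>2 * indicator ?C y \<partial>lebesgue)"
    by (rule integral_mono[OF i2 i b])
  also have "\<dots> = K\<^sup>2 * e ^ CARD('d)" by (simp add: meas)
  finally show "(\<integral>y. (F y)\<^sup>2 \<partial>lebesgue_on S) \<le> K\<^sup>2 * e ^ CARD('d)" .
qed

context sobolev_form
begin

text \<open>Weak derivatives are tested on the large open cube, the energy integrates over the base
  cube. For F supported in the base cube both integrals agree, and the extension may be dropped
  a.e.\<close>

lemma integral_cube_eq_ocube:
  assumes u: "u \<in> H" and F: "F \<in> borel_measurable (lebesgue_on (ocube (4 * L)))"
    and supp: "\<And>y. y \<notin> cube (2 * L) \<Longrightarrow> F y = 0"
  shows "(LINT y:ocube (4 * L)|lebesgue. perext L u y * F y) = (\<integral>y. u y * F y \<partial>Q)"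
    "(LINT y:ocube (4 * L)|lebesgue. g y * F y) = (\<integral>y. g y * F y \<partial>Q)"
proof -
  have sub: "cube (2 * L) \<subseteq> ocube (4 * L)" using L_pos by (intro cube_subset_ocube) simp
  have FQ: "F \<in> borel_measurable Q"
    using F sub by (rule measurable_restrict_mono)
  show 1: "(LINT y:ocube (4 * L)|lebesgue. g y * F y) = (\<integral>y. g y * F y \<partial>Q)" for g :: "real^'d \<Rightarrow> real"
  proof -
    have "(LINT y:ocube (4 * L)|lebesgue. g y * F y) = (LINT y:cube (2 * L)|lebesgue. g y * F y)"
      unfolding set_lebesgue_integral_def using sub supp
      by (intro Bochner_Integration.integral_cong) (auto split: split_indicator)
    then show ?thesis by (simp add: set_integral_lebesgue_on)
  qed
  have "sq_int (lebesgue_on (ocube (4 * L))) (perext L u)" using u by (simp add: Hper_def in_Hs_def)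
  then have p: "perext L u \<in> borel_measurable Q"
    by (rule sq_int_measurable[OF sq_int_lebesgue_on_subset(1)[OF _ sub cube_lmeasurable(4,3)]])
  have "(\<integral>y. perext L u y * F y \<partial>Q) = (\<integral>y. u y * F y \<partial>Q)"
  proof (rule integral_cong_AE)
    show "(\<lambda>y. perext L u y * F y) \<in> borel_measurable Q" "(\<lambda>y. u y * F y) \<in> borel_measurable Q"
      using p FQ sq_int_measurable[OF Hper_sq_int[OF u]] by simp_all
    show "AE y in Q. perext L u y * F y = u y * F y" using perext_AE[of u] by eventually_elim simp
  qed
  with 1[of "perext L u"] show "(LINT y:ocube (4 * L)|lebesgue. perext L u y * F y) = (\<integral>y. u y * F y \<partial>Q)" by simp
qed

lemma cbox_subset_cube:
  fixes x :: "real^'d"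
  assumes "x \<in> cube L" "0 < e" "e \<le> L"
  shows "cbox x (x + e *\<^sub>R One) \<subseteq> cube (2 * L)"
proof
  fix y assume y: "y \<in> cbox x (x + e *\<^sub>R One)"
  have "\<bar>y $ i\<bar> \<le> 2 * L" for i
  proof -
    have "x $ i \<le> y $ i \<and> y $ i \<le> x $ i + e" using y by (simp add: mem_box_cart)
    moreover have "\<bar>x $ i\<bar> \<le> L" using assms(1) by (simp add: cube_def)
    ultimately show ?thesis using assms(2,3) by linarith
  qed
  then show "y \<in> cube (2 * L)" by (simp add: cube_def)
qed

text \<open>Values of u make sense only a.e., so evaluation is first bounded through mollified
  values, uniformly in the point and in the dyadic scale. Points of \<open>cube L\<close> have room
  L inside the base cube, enough for every scale that occurs.\<close>

lemma sobolev_mollifier_bound: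
  obtains \<eta> C where "mollifier \<eta>" "C \<ge> 0"
    "\<And>u x n. u \<in> H \<Longrightarrow> x \<in> cube L \<Longrightarrow> (\<integral>y. u y * mollifier.moll \<eta> (L * (1/2) ^ n) x y \<partial>Q)\<^sup>2 \<le> C * B u u"
proof -
  obtain \<eta> \<theta> :: "real \<Rightarrow> real" where sm: "smooth1 \<eta>" "smooth1 \<theta>"
    and spt: "\<And>x. x \<notin> {0..1} \<Longrightarrow> \<eta> x = 0" "\<And>x. x \<notin> {0..1} \<Longrightarrow> \<theta> x = 0"
    and der: "(deriv ^^ s) \<theta> = (\<lambda>x. \<eta> x - 2 * \<eta> (2 * x))"
    and int: "integrable lborel \<eta>" "(\<integral>x. \<eta> x \<partial>lborel) = 1"
    by (rule refinable_mollifier[OF s(1)]) (rule that; assumption)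
  have moll_\<eta>: "mollifier \<eta>" using sm(1) spt(1) int by (intro mollifier.intro)
  interpret mollifier \<eta> by (rule moll_\<eta>)
  let ?U = "ocube (4 * L) :: (real^'d) set"
  obtain M1 where M1: "M1 > 0" "\<And>t. \<bar>\<eta> t\<bar> \<le> M1" using eta_bounded by blast
  have "compact (\<theta> ` {0..1})" by (intro compact_continuous_image smooth1_continuous sm) auto
  then obtain M2 where M2: "\<And>t. t \<in> {0..1} \<Longrightarrow> \<bar>\<theta> t\<bar> \<le> M2"
    using bounded_iff[of "\<theta> ` {0..1}"] compact_imp_bounded by (metis imageI real_norm_def)
  define M where "M = max M1 M2"
  have M: "M > 0" "\<And>t. \<bar>\<eta> t\<bar> \<le> M" using M1 by (auto simp: M_def le_max_iff_disj)
  have M\<theta>: "\<bar>\<theta> t\<bar> \<le> M" for t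
    using M2[of t] spt(2)[of t] M(1) by (cases "t \<in> {0..1}") (auto simp: M_def le_max_iff_disj)
  \<comment> \<open>Twice the margin \<open>s - d / 2\<close>, an integer: the exponent of e in the
    squared cost of one change of scale.\<close>
  define k where "k = 2 * s - CARD('d)"
  have "CARD('d) < 2 * s" using s(2) by linarith
  then have k: "k > 0" "2 * s = k + CARD('d)" by (auto simp: k_def)
  define I where "I u F = (\<integral>y. u y * F y \<partial>Q)" for u F :: "real^'d \<Rightarrow> real"
  \<comment> \<open>Hybrid kernels: coordinates in S are already at scale \<open>e / 2\<close>, the
    others still at scale e. Growing S from the empty set to all coordinates leads from
    \<open>moll e\<close> to \<open>moll (e / 2)\<close>.\<close>
  define fac where "fac e x S i = (if i \<in> S then dil (e / 2) (x $ i) else dil e (x $ i))"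
    for e :: real and x :: "real^'d" and S :: "'d set" and i
  have fac_smooth: "smooth1 (fac e x S i)" for e x S i by (simp add: fac_def smooth1_dil)
  have fac_zero: "fac e x S i t = 0" if "t \<notin> {x $ i..x $ i + e}" "e > 0" for e x S i t
    using that dil_zero[of e t "x $ i"] dil_zero[of "e / 2" t "x $ i"] by (auto simp: fac_def)
  have dil_le: "\<bar>dil e c t\<bar> \<le> inverse e * M" if "e > 0" for e c t
    using that M by (auto simp: dil_def abs_mult intro!: mult_left_mono)
  have fac_le: "\<bar>fac e x S i t\<bar> \<le> 2 * M / e" if "e > 0" for e x S i t
  proof -
    have "\<bar>fac e x S i t\<bar> \<le> inverse (e / 2) * M \<or> \<bar>fac e x S i t\<bar> \<le> inverse e * M"
      using dil_le[of "e / 2"] dil_le[of e] that by (auto simp: fac_def)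
    moreover have "inverse e * M \<le> 2 * M / e" using that M(1) by (simp add: field_simps)
    moreover have "inverse (e / 2) * M = 2 * M / e" using that by (simp add: field_simps)
    ultimately show ?thesis by linarith
  qed
  have test: "test_fun ?U (tensor f)" if "\<And>i. smooth1 (f i)" "\<And>i t. t \<notin> {x $ i..x $ i + e} \<Longrightarrow> f i t = 0"
    "x \<in> cube L" "0 < e" "e \<le> L" for f x e
  proof (rule test_fun_tensor[OF that(1), of x "x + e *\<^sub>R One"])
    show "f i t = 0" if "t \<notin> {x $ i..(x + e *\<^sub>R One) $ i}" for i t using that by (simp add: \<open>\<And>i t. t \<notin> {x $ i..x $ i + e} \<Longrightarrow> f i t = 0\<close>)
    have "cube (2 * L) \<subseteq> ?U" using L_pos by (intro cube_subset_ocube) simp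
    then show "cbox x (x + e *\<^sub>R One) \<subseteq> ?U" using cbox_subset_cube[OF that(3-5)] by blast
  qed
  have ten_zero: "tensor f y = 0" if "\<And>i t. t \<notin> {x $ i..x $ i + e} \<Longrightarrow> f i t = 0"
    "y \<notin> cbox x (x + e *\<^sub>R One)" for f and x y :: "real^'d" and e
    by (rule tensor_zero_outside[OF _ that(2)]) (simp add: that(1))
  have step: "(I u (tensor (fac e x S)) - I u (tensor (fac e x (insert j S))))\<^sup>2
      \<le> (2 * M) ^ (2 * CARD('d)) / lamn * e ^ k * B u u"
    if u: "u \<in> H" and x: "x \<in> cube L" and e: "0 < e" "e \<le> L" and j: "j \<notin> S" for u x e j S
  proof -
    \<comment> \<open>The prefactor compensates the \<open>inverse e ^ s\<close> from s
      differentiations up to the single \<open>inverse e\<close> that belongs to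
      \<open>dil\<close>.\<close>
    define th where "th = (\<lambda>t. e ^ (s - 1) * \<theta> (inverse e * t + - (x $ j * inverse e)))"
    define \<Psi> where "\<Psi> = tensor ((fac e x S)(j := th))"
    have th: "smooth1 th" unfolding th_def by (intro smooth1_mult smooth1_const smooth1_affine sm)
    have th0: "th t = 0" if "t \<notin> {x $ j..x $ j + e}" for t
    proof -
      have "inverse e * t + - (x $ j * inverse e) = (t - x $ j) / e" by (simp add: divide_inverse algebra_simps)
      moreover have "(t - x $ j) / e \<notin> {0..1}" using that e by (auto simp: field_simps)
      ultimately show ?thesis by (simp add: th_def spt)
    qed
    have es: "e ^ s = e * e ^ (s - 1)" using s(1) by (metis Suc_diff_1 power_Suc)
    have thd: "(deriv ^^ s) th = (\<lambda>t. dil e (x $ j) t - dil (e / 2) (x $ j) t)"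
    proof
      fix t
      let ?r = "inverse e * t + - (x $ j * inverse e)"
      have "(deriv ^^ s) th t = e ^ (s - 1) * inverse e ^ s * (\<eta> ?r - 2 * \<eta> (2 * ?r))"
        unfolding th_def nderiv_affine[OF sm(2)] der by simp
      also have "e ^ (s - 1) * inverse e ^ s = inverse e"
        using e es by (simp add: power_inverse field_simps)
      finally have 1: "(deriv ^^ s) th t = inverse e * (\<eta> ?r - 2 * \<eta> (2 * ?r))" .
      have "inverse (e / 2) = 2 * inverse e" using e by (simp add: field_simps)
      then have "dil (e / 2) (x $ j) t = 2 * inverse e * \<eta> (2 * ?r)"
        unfolding dil_def by (simp only:) (simp add: algebra_simps)
      with 1 show "(deriv ^^ s) th t = dil e (x $ j) t - dil (e / 2) (x $ j) t"
        by (simp only: dil_def[of e]) (simp add: right_diff_distrib)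
    qed
    have sm\<Psi>: "smooth1 (((fac e x S)(j := th)) i)" for i using th fac_smooth by simp
    have z\<Psi>: "((fac e x S)(j := th)) i t = 0" if "t \<notin> {x $ i..x $ i + e}" for i t
      using that th0 fac_zero e by auto
    have t\<Psi>: "test_fun ?U \<Psi>" unfolding \<Psi>_def by (rule test[OF sm\<Psi> z\<Psi> x e])
    let ?\<alpha> = "\<lambda>i. if i = j then s else 0"
    have aA: "?\<alpha> \<in> A" by (simp add: mi_order_single)
    then have a: "mi_order ?\<alpha> \<le> s" by simp
    have pd: "pdiffs (mi_list ?\<alpha>) \<Psi> y = tensor (fac e x S) y - tensor (fac e x (insert j S)) y" for y
    proof -
      have cl: "count_list (replicate s j) i = (if i = j then s else 0)" for i
        using count_list_mi_list[of ?\<alpha> i] by (simp add: mi_list_single)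
      have "(\<lambda>i. (deriv ^^ count_list (replicate s j) i) (((fac e x S)(j := th)) i))
          = (fac e x S)(j := \<lambda>t. dil e (x $ j) t - dil (e / 2) (x $ j) t)"
        by (auto simp: cl fun_eq_iff thd)
      then have "pdiffs (mi_list ?\<alpha>) \<Psi> y = tensor ((fac e x S)(j := dil e (x $ j))) y - tensor ((fac e x S)(j := dil (e / 2) (x $ j))) y"
        unfolding \<Psi>_def mi_list_single pdiffs_tensor[OF sm\<Psi>] by (simp only: tensor_upd_diff)
      moreover have "(fac e x S)(j := dil e (x $ j)) = fac e x S" using j by (auto simp: fun_eq_iff fac_def)
      moreover have "(fac e x S)(j := dil (e / 2) (x $ j)) = fac e x (insert j S)" by (auto simp: fun_eq_iff fac_def)
      ultimately show ?thesis by simp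
    qed
    have outQ: "y \<notin> cbox x (x + e *\<^sub>R One)" if "y \<notin> cube (2 * L)" for y using that cbox_subset_cube[OF x e] by blast
    have m\<Psi>: "\<Psi> \<in> borel_measurable (lebesgue_on S')" for S' using test_fun_pdiffs_measurable[OF t\<Psi>, of "[]"] by simp
    have fz: "fac e x S' i t = 0" if "t \<notin> {x $ i..x $ i + e}" for S' i t using fac_zero[OF that e(1)] .
    have mt: "tensor (fac e x S') \<in> borel_measurable (lebesgue_on S'')" for S' S''
    proof -
      have "test_fun ?U (tensor (fac e x S'))"
        by (rule test[OF fac_smooth fz x e]) simp
      from test_fun_pdiffs_measurable[OF this, of "[]"] show ?thesis by simp
    qed
    have \<Psi>0: "\<Psi> y = 0" if "y \<notin> cbox x (x + e *\<^sub>R One)" for y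
      unfolding \<Psi>_def by (rule ten_zero[OF z\<Psi> that])
    have fac0: "tensor (fac e x S') y = 0" if "y \<notin> cbox x (x + e *\<^sub>R One)" for y S'
      by (rule ten_zero[OF fz that]) simp
    \<comment> \<open>Compared with the generic bound \<open>2 * M / e\<close> for each coordinate,
      the factor in direction j carries the extra \<open>e ^ s\<close>; this is the whole gain from
      integrating by parts.\<close>
    have \<Psi>b: "\<bar>\<Psi> y\<bar> \<le> e ^ s * (2 * M / e) ^ CARD('d)" for y
    proof -
      have "\<bar>\<Psi> y\<bar> \<le> (\<Prod>i\<in>UNIV. (if i = j then e ^ s else 1) * (2 * M / e))"
        unfolding \<Psi>_def
      proof (rule tensor_abs_le)
        fix i t
        have "\<bar>th t\<bar> \<le> e ^ (s - 1) * M" using e M\<theta> by (auto simp: th_def abs_mult intro!: mult_left_mono)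
        also have "\<dots> \<le> e ^ s * (2 * M / e)" using e M(1) by (simp add: es)
        finally show "\<bar>((fac e x S)(j := th)) i t\<bar> \<le> (if i = j then e ^ s else 1) * (2 * M / e)"
          using fac_le[OF e(1)] by auto
      qed
      also have "\<dots> = e ^ s * (2 * M / e) ^ CARD('d)" by (simp only: prod.distrib prod_constant) simp
      finally show ?thesis .
    qed
    note sqPsi = integral_square_supported_le[OF m\<Psi> cube_lmeasurable(3) \<Psi>0 \<Psi>b e(1)]
    have D: "sq_int Q (Dper L ?\<alpha> u)" by (rule Hper_Dper(3)[OF u a])
    have facQ: "sq_int Q (tensor (fac e x S'))" for S'
    proof (rule integral_square_supported_le(1)[OF mt cube_lmeasurable(3) fac0 _ e(1)])
      show "\<bar>tensor (fac e x S') y\<bar> \<le> (\<Prod>i\<in>(UNIV::'d set). 2 * M / e)" for y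
        by (rule tensor_abs_le) (rule fac_le[OF e(1)])
    qed
    have "I u (tensor (fac e x S)) - I u (tensor (fac e x (insert j S))) = (\<integral>y. u y * pdiffs (mi_list ?\<alpha>) \<Psi> y \<partial>Q)"
      unfolding pd I_def using sq_int_mult[OF Hper_sq_int[OF u] facQ] by (simp add: right_diff_distrib)
    also have "\<dots> = (LINT y:?U|lebesgue. perext L u y * pdiffs (mi_list ?\<alpha>) \<Psi> y)"
      by (rule integral_cube_eq_ocube(1)[OF u test_fun_pdiffs_measurable[OF t\<Psi>], symmetric])
        (use fac0 outQ in \<open>simp add: pd\<close>)
    also have "\<dots> = (-1) ^ mi_order ?\<alpha> * (LINT y:?U|lebesgue. Dper L ?\<alpha> u y * \<Psi> y)"
      by (rule weak_derivD[OF Hper_Dper(1)[OF u a] t\<Psi>])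
    also have "(LINT y:?U|lebesgue. Dper L ?\<alpha> u y * \<Psi> y) = (\<integral>y. Dper L ?\<alpha> u y * \<Psi> y \<partial>Q)"
      by (rule integral_cube_eq_ocube(2)[OF u m\<Psi>]) (use \<Psi>0 outQ in auto)
    \<comment> \<open>Squaring disposes of the sign from the integration by parts.\<close>
    finally have "(I u (tensor (fac e x S)) - I u (tensor (fac e x (insert j S))))\<^sup>2 = (\<integral>y. Dper L ?\<alpha> u y * \<Psi> y \<partial>Q)\<^sup>2"
      by (simp add: power_mult_distrib flip: power_mult)
    also have "\<dots> \<le> (\<integral>y. (Dper L ?\<alpha> u y)\<^sup>2 \<partial>Q) * (\<integral>y. (\<Psi> y)\<^sup>2 \<partial>Q)"
      by (rule sq_int_Cauchy_Schwarz[OF D sqPsi(1)])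
    also have "\<dots> \<le> (B u u / lamn) * ((e ^ s * (2 * M / e) ^ CARD('d))\<^sup>2 * e ^ CARD('d))"
      using B_lower[OF aA, of u] lam sqPsi(2) B_nonneg[of u]
      by (intro mult_mono) (auto simp: field_simps)
    \<comment> \<open>Powers of e: 2 s from the gain, - 2 d from the height of the kernel, d from
      the volume of its support.\<close>
    also have "(e ^ s * (2 * M / e) ^ CARD('d))\<^sup>2 * e ^ CARD('d) = (2 * M) ^ (2 * CARD('d)) * e ^ k"
    proof -
      define E where "E = e ^ CARD('d)"
      have E: "E \<noteq> 0" using e(1) by (simp add: E_def)
      have "(e ^ s)\<^sup>2 = e ^ (2 * s)" by (simp add: power_even_eq)
      also have "\<dots> = e ^ k * E" by (simp only: k(2) power_add E_def)
      finally have "(e ^ s)\<^sup>2 = e ^ k * E" .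
      moreover have "(2 * M / e) ^ CARD('d) = (2 * M) ^ CARD('d) / E" by (simp only: power_divide E_def)
      moreover have "(2 * M) ^ (2 * CARD('d)) = ((2 * M) ^ CARD('d))\<^sup>2" by (rule power_even_eq)
      ultimately show ?thesis
        using E unfolding E_def[symmetric] by (simp only: power_mult_distrib) (simp add: power_divide power2_eq_square)
    qed
    finally show ?thesis by (simp add: field_simps)
  qed
  define K where "K = sqrt ((2 * M) ^ (2 * CARD('d)) / lamn)"
  \<comment> \<open>Halving e divides \<open>e ^ k\<close> by \<open>2 ^ k\<close>, so after the
    square root the cost shrinks by this factor per scale.\<close>
  define r where "r = sqrt ((1/2) ^ k)"
  have r: "0 \<le> r" "r < 1" using k(1) by (auto simp: r_def power_Suc_less_one real_sqrt_lt_1_iff power_less_one_iff)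
  have K0: "K \<ge> 0" using M lam by (simp add: K_def)
  have fac_UNIV: "tensor (fac e x UNIV) = moll (e / 2) x" "tensor (fac e x {}) = moll e x" for e x
  proof -
    have "fac e x UNIV = (\<lambda>i. dil (e / 2) (x $ i))" "fac e x {} = (\<lambda>i. dil e (x $ i))"
      by (auto simp: fac_def fun_eq_iff)
    then show "tensor (fac e x UNIV) = moll (e / 2) x" "tensor (fac e x {}) = moll e x"
      by (simp_all add: moll_def)
  qed
  have scale: "\<bar>I u (moll (L * (1/2) ^ Suc n) x) - I u (moll (L * (1/2) ^ n) x)\<bar>
      \<le> real CARD('d) * (K * sqrt (L ^ k) * sqrt (B u u)) * r ^ n"
    if u: "u \<in> H" and x: "x \<in> cube L" for u x n
  proof -
    define e where "e = L * (1/2) ^ n"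
    have e: "0 < e" "e \<le> L" using L_pos by (auto simp: e_def mult_le_cancel_left1 power_le_one)
    have ek: "sqrt (e ^ k) = sqrt (L ^ k) * r ^ n"
    proof -
      have "e ^ k = L ^ k * ((1/2) ^ k) ^ n"
        unfolding e_def power_mult_distrib by (simp add: mult.commute flip: power_mult)
      then show ?thesis by (simp only: real_sqrt_mult real_sqrt_power r_def)
    qed
    have one: "\<bar>I u (tensor (fac e x S)) - I u (tensor (fac e x (insert j S)))\<bar>
        \<le> K * sqrt (L ^ k) * sqrt (B u u) * r ^ n" if "j \<notin> S" for j S
    proof -
      have "sqrt ((I u (tensor (fac e x S)) - I u (tensor (fac e x (insert j S))))\<^sup>2)
          \<le> sqrt ((2 * M) ^ (2 * CARD('d)) / lamn * e ^ k * B u u)"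
        using step[OF u x e that] by (rule real_sqrt_le_mono)
      also have "\<dots> = K * (sqrt (L ^ k) * r ^ n) * sqrt (B u u)"
        by (simp only: real_sqrt_mult[of _ "B u u"] real_sqrt_mult[of _ "e ^ k"] ek K_def)
      finally show ?thesis by (simp only: real_sqrt_abs mult_ac)
    qed
    \<comment> \<open>Coordinates are switched to the finer scale one after another at equal cost,
      hence the factor \<open>card S\<close>.\<close>
    have "\<bar>I u (tensor (fac e x {})) - I u (tensor (fac e x S))\<bar>
        \<le> real (card S) * (K * sqrt (L ^ k) * sqrt (B u u) * r ^ n)" for S :: "'d set"
      using finite[of S]
    proof (induction S rule: finite_induct)
      case (insert j S)
      have card: "real (card (insert j S)) * X = real (card S) * X + X" for X :: real
        using insert.hyps by (simp add: distrib_right)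
      have tri: "\<bar>a - c\<bar> \<le> Y + X" if "\<bar>a - b\<bar> \<le> Y" "\<bar>b - c\<bar> \<le> X" for a b c X Y :: real
        using that by linarith
      show ?case unfolding card by (rule tri[OF insert.IH one[OF insert.hyps(2)]])
    qed simp
    from this[of UNIV] show ?thesis
      by (simp add: fac_UNIV e_def mult_ac abs_minus_commute)
  qed
  \<comment> \<open>The coarsest scale \<open>e = L\<close> needs no derivatives: Cauchy-Schwarz
    against the L2 part of the energy.\<close>
  define C0 where "C0 = sqrt (((inverse L * M) ^ CARD('d))\<^sup>2 * L ^ CARD('d) / lamn)"
  have base: "\<bar>I u (moll L x)\<bar> \<le> C0 * sqrt (B u u)" if u: "u \<in> H" and x: "x \<in> cube L" for u x
  proof -
    have m: "moll L x \<in> borel_measurable Q" using moll_measurable by (rule measurable_restrict_space1)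
    note sq = integral_square_supported_le[OF m cube_lmeasurable(3) moll_zero[OF L_pos] moll_abs_le[OF L_pos M(2)] L_pos]
    have "(I u (moll L x))\<^sup>2 \<le> (\<integral>y. (u y)\<^sup>2 \<partial>Q) * (\<integral>y. (moll L x y)\<^sup>2 \<partial>Q)"
      unfolding I_def by (rule sq_int_Cauchy_Schwarz[OF Hper_sq_int[OF u] sq(1)])
    also have "\<dots> \<le> (B u u / lamn) * (((inverse L * M) ^ CARD('d))\<^sup>2 * L ^ CARD('d))"
      using B_lower_L2[OF u] lam sq(2) B_nonneg[of u] by (intro mult_mono) (auto simp: field_simps)
    finally have "sqrt ((I u (moll L x))\<^sup>2) \<le> sqrt (((inverse L * M) ^ CARD('d))\<^sup>2 * L ^ CARD('d) / lamn * B u u)"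
      by (intro real_sqrt_le_mono) (simp add: mult_ac)
    then show ?thesis unfolding C0_def real_sqrt_mult[symmetric] by simp
  qed
  \<comment> \<open>Coarsest scale plus the sum of the geometric series over all
    refinements.\<close>
  define C1 where "C1 = C0 + real CARD('d) * (K * sqrt (L ^ k)) / (1 - r)"
  have geo: "\<bar>I u (moll (L * (1/2) ^ n) x)\<bar>
      \<le> C0 * sqrt (B u u) + real CARD('d) * (K * sqrt (L ^ k) * sqrt (B u u)) * (\<Sum>i<n. r ^ i)"
    if u: "u \<in> H" and x: "x \<in> cube L" for u x n
  proof (induction n)
    case 0
    then show ?case using base[OF u x] by simp
  next
    case (Suc n)
    then show ?case using scale[OF u x, of n] by (simp add: distrib_left)
  qed
  have fin: "(\<integral>y. u y * moll (L * (1/2) ^ n) x y \<partial>Q)\<^sup>2 \<le> C1\<^sup>2 * B u u"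
    if u: "u \<in> H" and x: "x \<in> cube L" for u x n
  proof -
    have "(\<Sum>i<n. r ^ i) = (1 - r ^ n) / (1 - r)" using r by (intro sum_gp_strict[THEN trans]) auto
    also have "\<dots> \<le> 1 / (1 - r)" using r by (intro divide_right_mono) auto
    finally have "real CARD('d) * (K * sqrt (L ^ k) * sqrt (B u u)) * (\<Sum>i<n. r ^ i)
        \<le> real CARD('d) * (K * sqrt (L ^ k) * sqrt (B u u)) * (1 / (1 - r))"
      using K0 L_pos B_nonneg by (intro mult_left_mono) auto
    with geo[OF u x, of n] have "\<bar>I u (moll (L * (1/2) ^ n) x)\<bar>
        \<le> C0 * sqrt (B u u) + real CARD('d) * (K * sqrt (L ^ k) * sqrt (B u u)) * (1 / (1 - r))" by linarith
    also have "\<dots> = C1 * sqrt (B u u)" by (simp add: C1_def algebra_simps)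
    finally have "\<bar>I u (moll (L * (1/2) ^ n) x)\<bar>\<^sup>2 \<le> (C1 * sqrt (B u u))\<^sup>2" by (intro power_mono) auto
    then show ?thesis using B_nonneg[of u] by (simp add: I_def power_mult_distrib)
  qed
  show ?thesis by (rule that[OF moll_\<eta> zero_le_power2[of C1] fin])
qed

section \<open>Orthonormal systems for the energy form\<close>

lemma H_sum:
  fixes w :: "nat \<Rightarrow> real^'d \<Rightarrow> real"
  assumes w: "\<And>k. w k \<in> H"
  shows "(\<lambda>x. \<Sum>k<N. c k * w k x) \<in> H"
    "v \<in> H \<Longrightarrow> B (\<lambda>x. \<Sum>k<N. c k * w k x) v = (\<Sum>k<N. c k * B (w k) v)"
proof -
  have "(\<lambda>x. \<Sum>k<N. c k * w k x) \<in> H \<and> (\<forall>v\<in>H. B (\<lambda>x. \<Sum>k<N. c k * w k x) v = (\<Sum>k<N. c k * B (w k) v))"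
  proof (induction N)
    case 0
    show ?case using B_lincomb[OF Hper_zero Hper_zero, of _ "-1"] by (auto simp: Hper_zero)
  next
    case (Suc N)
    have eq: "(\<lambda>x. \<Sum>k<Suc N. c k * w k x) = (\<lambda>x. c N * w N x + (\<Sum>k<N. c k * w k x))"
      by (simp add: add.commute)
    from Suc show ?case
      unfolding eq by (auto simp: Hper_lincomb(1)[OF w] B_lincomb[OF w] add.commute)
  qed
  then show "(\<lambda>x. \<Sum>k<N. c k * w k x) \<in> H"
    "v \<in> H \<Longrightarrow> B (\<lambda>x. \<Sum>k<N. c k * w k x) v = (\<Sum>k<N. c k * B (w k) v)" by auto
qed

lemma B_orthonormal_sum:
  fixes w :: "nat \<Rightarrow> real^'d \<Rightarrow> real"
  assumes w: "\<And>k. w k \<in> H" and on: "\<And>k j. B (w k) (w j) = (if k = j then 1 else 0)"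
  shows "B (\<lambda>x. \<Sum>k<N. c k * w k x) (\<lambda>x. \<Sum>k<N. c k * w k x) = (\<Sum>k<N. (c k)\<^sup>2)"
proof -
  let ?u = "\<lambda>x. \<Sum>k<N. c k * w k x"
  have "B (w k) ?u = c k" if "k < N" for k
  proof -
    have "B (w k) ?u = B ?u (w k)" by (rule B_sym)
    also have "\<dots> = (\<Sum>j<N. c j * (if j = k then 1 else 0))" by (simp only: H_sum(2)[OF w w] on)
    also have "\<dots> = (\<Sum>j<N. if j = k then c j else 0)" by (intro sum.cong) auto
    also have "\<dots> = c k" using that by (subst sum.delta) auto
    finally show ?thesis .
  qed
  then show ?thesis using H_sum(2)[OF w H_sum(1)[OF w]] by (simp add: power2_eq_square)
qed

lemma B_bessel:
  fixes w :: "nat \<Rightarrow> real^'d \<Rightarrow> real"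
  assumes w: "\<And>k. w k \<in> H" and on: "\<And>k j. B (w k) (w j) = (if k = j then 1 else 0)" and z: "z \<in> H"
  shows "(\<Sum>k<N. (B (w k) z)\<^sup>2) \<le> B z z"
proof -
  define c where "c k = B (w k) z" for k
  let ?u = "\<lambda>x. \<Sum>k<N. c k * w k x"
  have u: "?u \<in> H" by (rule H_sum(1)[OF w])
  have uz: "B ?u z = (\<Sum>k<N. (c k)\<^sup>2)" by (simp add: H_sum(2)[OF w z] c_def power2_eq_square)
  have uu: "B ?u ?u = (\<Sum>k<N. (c k)\<^sup>2)" by (rule B_orthonormal_sum[OF w on])
  let ?d = "\<lambda>x. (-1) * ?u x + z x"
  have d: "?d \<in> H" by (rule Hper_lincomb(1)[OF u z])
  have "0 \<le> B ?d ?d" by (rule B_nonneg)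
  also have "\<dots> = (-1) * B ?u ?d + B z ?d" by (rule B_lincomb[OF u z d])
  also have "B ?u ?d = (-1) * B ?u ?u + B z ?u"
    using B_lincomb[OF u z u, of "-1"] by (simp only: B_sym[of ?u ?d])
  also have "B z ?d = (-1) * B ?u z + B z z"
    using B_lincomb[OF u z z, of "-1"] by (simp only: B_sym[of z ?d])
  finally show ?thesis using uz uu B_sym[of z ?u] by (simp add: c_def)
qed

text \<open>The mollified bound is applied to the combination of the \<open>w k\<close> whose
  coefficients are their own mollified values at x. By orthonormality its mollified value and its
  energy both equal the sum S of the squared coefficients, so \<open>S^2 \<le> C * S\<close> and
  \<open>S \<le> C\<close>, with C independent of the system, the point and the number of terms.
  Outside countably many null sets the scale can then tend to 0.\<close>

lemma evaluation_bound:
  obtains C where "\<And>w. \<forall>k::nat. w k \<in> H \<Longrightarrow> \<forall>k j. B (w k) (w j) = (if k = j then 1 else 0) \<Longrightarrow>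
      AE x in lebesgue_on (cube L). \<forall>N. (\<Sum>k<N. (w k x)\<^sup>2) \<le> C"
proof -
  obtain \<eta> C where mol: "mollifier \<eta>" and C0: "C \<ge> 0" and
    C: "\<And>u x n. u \<in> H \<Longrightarrow> x \<in> cube L \<Longrightarrow> (\<integral>y. u y * mollifier.moll \<eta> (L * (1/2) ^ n) x y \<partial>Q)\<^sup>2 \<le> C * B u u"
    using sobolev_mollifier_bound by blast
  interpret mollifier \<eta> by (rule mol)
  have "AE x in lebesgue_on (cube L). \<forall>N. (\<Sum>k<N. (w k x)\<^sup>2) \<le> C"
    if wH: "\<forall>k::nat. w k \<in> H" and wB: "\<forall>k j. B (w k) (w j) = (if k = j then 1 else 0)" for w
  proof -
    have w: "w k \<in> H" for k using wH by blast
    have on: "B (w k) (w j) = (if k = j then 1 else 0)" for k j using wB by blast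
    define f where "f k y = indicator (cube (2 * L)) y * w k y" for k y
    have "integrable Q (w k)" for k by (rule sq_int_integrable[OF finite_measure_Q Hper_sq_int[OF w]])
    then have fi: "integrable lebesgue (f k)" for k
      unfolding f_def[abs_def] by (simp add: integrable_restrict_space)
    have "\<forall>k. \<exists>N. negligible N \<and> (\<forall>x. x \<notin> N \<longrightarrow> ((\<lambda>e. \<integral>y. f k y * moll e x y \<partial>lebesgue) \<longlongrightarrow> f k x) (at_right 0))"
    proof
      fix k
      show "\<exists>N. negligible N \<and> (\<forall>x. x \<notin> N \<longrightarrow> ((\<lambda>e. \<integral>y. f k y * moll e x y \<partial>lebesgue) \<longlongrightarrow> f k x) (at_right 0))"
        by (rule moll_tendsto[OF fi[of k]]) blast
    qed
    from choice[OF this] obtain Z where Z: "\<And>k. negligible (Z k)"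
      "\<And>k x. x \<notin> Z k \<Longrightarrow> ((\<lambda>e. \<integral>y. f k y * moll e x y \<partial>lebesgue) \<longlongrightarrow> f k x) (at_right 0)" by blast
    have "negligible (\<Union>(range Z))" using Z(1) by (intro negligible_countable_Union) auto
    then have "AE x in lebesgue. x \<notin> \<Union>(range Z)"
      by (intro AE_not_in) (simp add: negligible_iff_null_sets)
    then have "AE x in lebesgue. x \<in> cube L \<longrightarrow> (\<forall>N. (\<Sum>k<N. (w k x)\<^sup>2) \<le> C)"
    proof eventually_elim
      case (elim x)
      show ?case
      proof (intro impI allI)
        fix N assume x: "x \<in> cube L"
        have "x \<in> cbox x (x + L *\<^sub>R One)" using L_pos by (simp add: mem_box_cart)
        then have x2: "x \<in> cube (2 * L)" using cbox_subset_cube[OF x L_pos order_refl] by blast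
        define I where "I n k = (\<integral>y. w k y * moll (L * (1/2) ^ n) x y \<partial>Q)" for n k
        have e0: "filterlim (\<lambda>n. L * (1/2) ^ n) (at_right 0) sequentially"
        proof (rule tendsto_imp_filterlim_at_right)
          have "(\<lambda>n. L * (1/2) ^ n) \<longlonglongrightarrow> L * 0" by (intro tendsto_mult tendsto_const LIMSEQ_realpow_zero) auto
          then show "(\<lambda>n. L * (1/2) ^ n) \<longlonglongrightarrow> 0" by simp
          show "\<forall>\<^sub>F n in sequentially. 0 < L * (1/2) ^ n" using L_pos by simp
        qed
        have I_lim: "(\<lambda>n. I n k) \<longlonglongrightarrow> w k x" for k
        proof -
          have "(\<lambda>n. \<integral>y. f k y * moll (L * (1/2) ^ n) x y \<partial>lebesgue) \<longlonglongrightarrow> f k x"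
            using Z(2)[of x k] elim by (intro filterlim_compose[OF _ e0]) auto
          moreover have "(\<integral>y. f k y * moll (L * (1/2) ^ n) x y \<partial>lebesgue) = I n k" for n
            by (simp add: I_def f_def integral_restrict_space mult.assoc)
          ultimately show ?thesis using x2 by (simp add: f_def)
        qed
        have "(\<Sum>k<N. (I n k)\<^sup>2) \<le> C" for n
        proof -
          let ?u = "\<lambda>y. \<Sum>k<N. I n k * w k y"
          let ?S = "\<Sum>k<N. (I n k)\<^sup>2"
          let ?m = "moll (L * (1/2) ^ n) x"
          have e: "0 < L * (1/2) ^ n" "L * (1/2) ^ n \<le> L" using L_pos by (auto simp: mult_le_cancel_left1 power_le_one)
          have mQ: "sq_int Q ?m"
          proof -
            obtain M where "\<And>t. \<bar>\<eta> t\<bar> \<le> M" using eta_bounded by blast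
            then have "\<bar>?m y\<bar> \<le> (inverse (L * (1/2) ^ n) * M) ^ CARD('d)" for y by (rule moll_abs_le[OF e(1)])
            then show ?thesis
              by (rule sq_int_bounded[OF finite_measure_Q measurable_restrict_space1[OF moll_measurable]])
          qed
          have u: "?u \<in> H" by (rule H_sum(1)[OF w])
          have "(\<integral>y. ?u y * ?m y \<partial>Q) = (\<integral>y. (\<Sum>k<N. I n k * (w k y * ?m y)) \<partial>Q)"
            by (simp add: sum_distrib_right mult.assoc)
          also have "\<dots> = ?S"
            using sq_int_mult[OF Hper_sq_int[OF w] mQ] by (simp add: I_def power2_eq_square)
          finally have "?S\<^sup>2 \<le> C * ?S"
            using C[OF u x, of n] B_orthonormal_sum[OF w on, where N = N and c = "I n"] by simp
          moreover have "?S \<ge> 0" by (simp add: sum_nonneg)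
          ultimately show ?thesis using C0 by (cases "?S = 0") (auto simp: power2_eq_square)
        qed
        moreover have "(\<lambda>n. \<Sum>k<N. (I n k)\<^sup>2) \<longlonglongrightarrow> (\<Sum>k<N. (w k x)\<^sup>2)"
          by (intro tendsto_sum tendsto_power I_lim)
        ultimately show "(\<Sum>k<N. (w k x)\<^sup>2) \<le> C" by (intro LIMSEQ_le_const2) auto
      qed
    qed
    then show ?thesis by (subst AE_restrict_space_iff) auto
  qed
  then show ?thesis by (rule that)
qed

end

section \<open>Spectral expansions and the kernel\<close>

lemma orthonormal_integral_sum:
  assumes e: "\<And>k::nat. sq_int M (e k)"
    and on: "\<And>j k. (\<integral>x. e j x * e k x \<partial>M) = (if j = k then 1 else 0)"
    and I: "finite I"
  shows "(\<integral>x. (\<Sum>k\<in>I. c k * e k x) * e j x \<partial>M) = (if j \<in> I then c j else 0)"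
    "(\<integral>x. (\<Sum>k\<in>I. c k * e k x)\<^sup>2 \<partial>M) = (\<Sum>k\<in>I. (c k)\<^sup>2)"
proof -
  have lin: "(\<integral>x. (\<Sum>k\<in>I. c k * e k x) * h x \<partial>M) = (\<Sum>k\<in>I. c k * (\<integral>x. e k x * h x \<partial>M))"
    if "sq_int M h" for h
    using sq_int_mult[OF e that] by (simp add: sum_distrib_right mult.assoc)
  show 1: "(\<integral>x. (\<Sum>k\<in>I. c k * e k x) * e j x \<partial>M) = (if j \<in> I then c j else 0)" for j
  proof -
    have "(\<Sum>k\<in>I. c k * (\<integral>x. e k x * e j x \<partial>M)) = (\<Sum>k\<in>I. if k = j then c k else 0)"
      by (intro sum.cong) (auto simp: on)
    then show ?thesis using I by (simp add: lin[OF e] sum.delta)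
  qed
  have s: "sq_int M (\<lambda>x. \<Sum>k\<in>I. c k * e k x)" by (intro sq_int_sum sq_int_cmult e)
  have "(\<integral>x. (\<Sum>k\<in>I. c k * e k x)\<^sup>2 \<partial>M) = (\<Sum>k\<in>I. c k * (\<integral>x. e k x * (\<Sum>k\<in>I. c k * e k x) \<partial>M))"
    using lin[OF s] by (simp add: power2_eq_square)
  also have "\<dots> = (\<Sum>k\<in>I. (c k)\<^sup>2)"
    using 1 by (intro sum.cong) (auto simp: power2_eq_square mult.commute)
  finally show "(\<integral>x. (\<Sum>k\<in>I. c k * e k x)\<^sup>2 \<partial>M) = (\<Sum>k\<in>I. (c k)\<^sup>2)" .
qed

lemma sq_int_bessel:
  assumes e: "\<And>k::nat. sq_int M (e k)"
    and on: "\<And>j k. (\<integral>x. e j x * e k x \<partial>M) = (if j = k then 1 else 0)"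
    and h: "sq_int M h"
  shows "(\<Sum>k<N. (\<integral>x. h x * e k x \<partial>M)\<^sup>2) \<le> (\<integral>x. (h x)\<^sup>2 \<partial>M)"
proof -
  define c where "c k = (\<integral>x. h x * e k x \<partial>M)" for k
  let ?s = "\<lambda>x. \<Sum>k<N. c k * e k x"
  have s: "sq_int M ?s" by (intro sq_int_sum sq_int_cmult e)
  have hs: "(\<integral>x. h x * ?s x \<partial>M) = (\<Sum>k<N. (c k)\<^sup>2)"
  proof -
    have "(\<integral>x. h x * ?s x \<partial>M) = (\<integral>x. (\<Sum>k<N. c k * (h x * e k x)) \<partial>M)"
      by (simp add: sum_distrib_left mult_ac)
    also have "\<dots> = (\<Sum>k<N. (c k)\<^sup>2)"
      using sq_int_mult[OF h e] by (simp add: c_def power2_eq_square)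
    finally show ?thesis .
  qed
  have "0 \<le> (\<integral>x. (h x + (-1) * ?s x)\<^sup>2 \<partial>M)" by simp
  also have "\<dots> = (\<integral>x. (h x)\<^sup>2 \<partial>M) + 2 * (-1) * (\<integral>x. h x * ?s x \<partial>M) + (-1)\<^sup>2 * (\<integral>x. (?s x)\<^sup>2 \<partial>M)"
    by (rule sq_int_expand[OF h s])
  also have "(\<integral>x. (?s x)\<^sup>2 \<partial>M) = (\<Sum>k<N. (c k)\<^sup>2)" by (rule orthonormal_integral_sum(2)[OF e on]) simp_all
  finally show ?thesis unfolding hs by (simp add: c_def)
qed

text \<open>The expansion of \<open>T f\<close> converges in L2, so it may be paired with f term by
  term.\<close>

lemma spectral_quadratic_form:
  assumes e: "\<And>k::nat. sq_int M (e k)" and f: "sq_int M f" "sq_int M (T f)"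
    and lim: "(\<lambda>N. \<integral>x. (T f x - (\<Sum>m<N. a m * (\<integral>y. f y * e m y \<partial>M) * e m x))\<^sup>2 \<partial>M) \<longlonglongrightarrow> 0"
  shows "(\<lambda>N. \<Sum>j<N. a j * (\<integral>x. f x * e j x \<partial>M)\<^sup>2) \<longlonglongrightarrow> (\<integral>x. T f x * f x \<partial>M)"
proof -
  let ?S = "\<lambda>N x. \<Sum>m<N. a m * (\<integral>y. f y * e m y \<partial>M) * e m x"
  have S: "sq_int M (?S N)" for N by (intro sq_int_sum sq_int_cmult e)
  have "(\<lambda>N. \<integral>x. (?S N x - T f x)\<^sup>2 \<partial>M) \<longlonglongrightarrow> 0" using lim by (simp add: power2_commute)
  from sq_int_tendsto_mult[OF S f(2,1) this]
  have "(\<lambda>N. \<integral>x. ?S N x * f x \<partial>M) \<longlonglongrightarrow> (\<integral>x. T f x * f x \<partial>M)" .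
  moreover have "(\<integral>x. ?S N x * f x \<partial>M) = (\<Sum>j<N. a j * (\<integral>x. f x * e j x \<partial>M)\<^sup>2)" for N
  proof -
    have "(\<integral>x. ?S N x * f x \<partial>M) = (\<integral>x. (\<Sum>m<N. a m * (\<integral>y. f y * e m y \<partial>M) * (f x * e m x)) \<partial>M)"
      by (simp only: sum_distrib_right) (simp only: mult_ac)
    also have "\<dots> = (\<Sum>j<N. a j * (\<integral>x. f x * e j x \<partial>M)\<^sup>2)"
      using sq_int_mult[OF f(1) e] by (simp add: power2_eq_square mult.assoc)
    finally show ?thesis .
  qed
  ultimately show ?thesis by simp
qed

text \<open>One half of the min-max principle. In the expansion of the quadratic form the first m
  terms vanish by orthogonality, the remaining eigenvalues are at most \<open>b m\<close>, and
  Bessel's inequality closes the estimate.\<close>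

lemma eigenvalues_desc_upper:
  assumes "eigenvalues_desc M T b"
  obtains e where "\<And>k. sq_int M (e k)"
    "\<And>h m. sq_int M h \<Longrightarrow> \<forall>j<m. (\<integral>x. h x * e j x \<partial>M) = 0 \<Longrightarrow>
       (\<integral>x. T h x * h x \<partial>M) \<le> b m * (\<integral>x. (h x)\<^sup>2 \<partial>M)"
proof -
  from assms obtain e where b: "antimono b" "\<And>m. 0 \<le> b m" and e: "\<And>k. sq_int M (e k)"
    and on: "\<And>j k. (\<integral>x. e j x * e k x \<partial>M) = (if j = k then 1 else 0)"
    and T: "\<And>f. sq_int M f \<Longrightarrow> sq_int M (T f)"
    and lim: "\<And>f. sq_int M f \<Longrightarrow>
      (\<lambda>N. \<integral>x. (T f x - (\<Sum>m<N. b m * (\<integral>y. f y * e m y \<partial>M) * e m x))\<^sup>2 \<partial>M) \<longlonglongrightarrow> 0"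
    unfolding eigenvalues_desc_def by blast
  have "(\<integral>x. T h x * h x \<partial>M) \<le> b m * (\<integral>x. (h x)\<^sup>2 \<partial>M)"
    if h: "sq_int M h" and o: "\<forall>j<m. (\<integral>x. h x * e j x \<partial>M) = 0" for h m
  proof (rule LIMSEQ_le_const2[OF spectral_quadratic_form[where T = T, OF e h T[OF h] lim[OF h]]], intro exI allI impI)
    fix N :: nat
    have "(\<Sum>j<N. b j * (\<integral>x. h x * e j x \<partial>M)\<^sup>2) \<le> (\<Sum>j<N. b m * (\<integral>x. h x * e j x \<partial>M)\<^sup>2)"
    proof (rule sum_mono)
      fix j
      show "b j * (\<integral>x. h x * e j x \<partial>M)\<^sup>2 \<le> b m * (\<integral>x. h x * e j x \<partial>M)\<^sup>2"
      proof (cases "j < m")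
        case False
        then have "b j \<le> b m" using b(1) by (simp add: antimonoD)
        then show ?thesis by (rule mult_right_mono) simp
      qed (simp add: o)
    qed
    also have "\<dots> \<le> b m * (\<integral>x. (h x)\<^sup>2 \<partial>M)"
      unfolding sum_distrib_left[symmetric] by (intro mult_left_mono sq_int_bessel[OF e on h] b(2))
    finally show "(\<Sum>j<N. b j * (\<integral>x. h x * e j x \<partial>M)\<^sup>2) \<le> b m * (\<integral>x. (h x)\<^sup>2 \<partial>M)" .
  qed
  with e show ?thesis by (rule that)
qed

text \<open>The other half: on the span of the first m + 1 eigenfunctions every eigenvalue involved
  is at least \<open>a m\<close>. The combination is allowed to hold only a.e., because it will be
  applied to a function cut off at \<Omega>.\<close>

lemma eigenvalues_desc_lower:
  assumes "eigenvalues_desc M T a"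
  obtains g where "\<And>k. sq_int M (g k)"
    "\<And>f c m. sq_int M f \<Longrightarrow> (AE x in M. f x = (\<Sum>k\<le>m. c k * g k x)) \<Longrightarrow>
       a m * (\<integral>x. (f x)\<^sup>2 \<partial>M) \<le> (\<integral>x. T f x * f x \<partial>M) \<and> (\<integral>x. (f x)\<^sup>2 \<partial>M) = (\<Sum>k\<le>m. (c k)\<^sup>2)"
    "\<And>f. sq_int M f \<Longrightarrow> sq_int M (T f)"
proof -
  from assms obtain g where a: "antimono a" "\<And>m. 0 \<le> a m" and g: "\<And>k. sq_int M (g k)"
    and on: "\<And>j k. (\<integral>x. g j x * g k x \<partial>M) = (if j = k then 1 else 0)"
    and T: "\<And>f. sq_int M f \<Longrightarrow> sq_int M (T f)"
    and lim: "\<And>f. sq_int M f \<Longrightarrow>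
      (\<lambda>N. \<integral>x. (T f x - (\<Sum>m<N. a m * (\<integral>y. f y * g m y \<partial>M) * g m x))\<^sup>2 \<partial>M) \<longlonglongrightarrow> 0"
    unfolding eigenvalues_desc_def by blast
  have "a m * (\<integral>x. (f x)\<^sup>2 \<partial>M) \<le> (\<integral>x. T f x * f x \<partial>M) \<and> (\<integral>x. (f x)\<^sup>2 \<partial>M) = (\<Sum>k\<le>m. (c k)\<^sup>2)"
    if f: "sq_int M f" and ae: "AE x in M. f x = (\<Sum>k\<le>m. c k * g k x)" for f c m
  proof -
    let ?s = "\<lambda>x. \<Sum>k\<le>m. c k * g k x"
    have s: "sq_int M ?s" by (intro sq_int_sum sq_int_cmult g)
    note ms = sq_int_measurable[OF s] and mf = sq_int_measurable[OF f] and mg = sq_int_measurable[OF g]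
    have "(\<integral>x. (f x)\<^sup>2 \<partial>M) = (\<integral>x. (?s x)\<^sup>2 \<partial>M)"
      using ae ms mf by (intro integral_cong_AE) auto
    then have n: "(\<integral>x. (f x)\<^sup>2 \<partial>M) = (\<Sum>k\<le>m. (c k)\<^sup>2)"
      using orthonormal_integral_sum(2)[OF g on, where I = "{..m}" and c = c] by simp
    have fg: "(\<integral>x. f x * g j x \<partial>M) = (if j \<le> m then c j else 0)" for j
    proof -
      have "(\<integral>x. f x * g j x \<partial>M) = (\<integral>x. ?s x * g j x \<partial>M)"
      proof (rule integral_cong_AE)
        show "(\<lambda>x. f x * g j x) \<in> borel_measurable M" "(\<lambda>x. ?s x * g j x) \<in> borel_measurable M"
          using ms mf mg by (intro borel_measurable_times; simp)+
        show "AE x in M. f x * g j x = ?s x * g j x" using ae by eventually_elim simp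
      qed
      then show ?thesis using orthonormal_integral_sum(1)[OF g on, where I = "{..m}" and c = c] by simp
    qed
    have "a m * (\<Sum>k\<le>m. (c k)\<^sup>2) \<le> (\<integral>x. T f x * f x \<partial>M)"
    proof (rule LIMSEQ_le_const[OF spectral_quadratic_form[where T = T, OF g f T[OF f] lim[OF f]]],
        intro exI allI impI)
      \<comment> \<open>From \<open>Suc m\<close> on, the partial sums contain all indices up to m;
        what they add is nonnegative.\<close>
      fix N assume N: "Suc m \<le> N"
      have "a m * (\<Sum>k\<le>m. (c k)\<^sup>2) \<le> (\<Sum>k\<le>m. a k * (c k)\<^sup>2)"
        unfolding sum_distrib_left using a(1) by (intro sum_mono mult_right_mono) (auto simp: antimonoD)
      also have "\<dots> = (\<Sum>j\<le>m. a j * (\<integral>x. f x * g j x \<partial>M)\<^sup>2)" by (intro sum.cong) (auto simp: fg)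
      also have "\<dots> \<le> (\<Sum>j<N. a j * (\<integral>x. f x * g j x \<partial>M)\<^sup>2)"
        using N a(2) by (intro sum_mono2) auto
      finally show "a m * (\<Sum>k\<le>m. (c k)\<^sup>2) \<le> (\<Sum>j<N. a j * (\<integral>x. f x * g j x \<partial>M)\<^sup>2)" .
    qed
    with n show ?thesis by simp
  qed
  with g T show ?thesis by (intro that) blast+
qed

text \<open>Summation is exchanged with both integrations by dominated convergence, first in y for
  fixed x, then in x. The majorant comes from \<open>\<bar>s * t\<bar> \<le> (s^2 + t^2) / 2\<close>
  and the bound C on sums of squares, which limits every partial sum of the kernel by C at good
  points.\<close>

lemma kernel_quadratic_form:
  fixes \<phi> :: "nat \<Rightarrow> 'a \<Rightarrow> real"
  assumes fin: "finite_measure P" and S: "S \<in> sets P"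
    and meas: "\<And>k. (\<lambda>x. indicator S x * \<phi> k x) \<in> borel_measurable P"
    and bnd: "AE x in P. x \<in> S \<and> (\<forall>N. (\<Sum>k<N. (\<phi> k x)\<^sup>2) \<le> C)"
    and f: "sq_int P f" and supp: "\<And>x. x \<notin> S \<Longrightarrow> f x = 0"
    and Tm: "(\<lambda>x. \<integral>y. (\<Sum>k. \<phi> k x * \<phi> k y) * f y \<partial>P) \<in> borel_measurable P"
  shows "(\<lambda>N. \<Sum>k<N. (\<integral>x. \<phi> k x * f x \<partial>P)\<^sup>2)
    \<longlonglongrightarrow> (\<integral>x. (\<integral>y. (\<Sum>k. \<phi> k x * \<phi> k y) * f y \<partial>P) * f x \<partial>P)"
proof -
  interpret finite_measure P by fact
  define good where "good x \<longleftrightarrow> x \<in> S \<and> (\<forall>N. (\<Sum>k<N. (\<phi> k x)\<^sup>2) \<le> C)" for x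
  \<comment> \<open>Measurability of \<open>\<phi> k\<close> is given only after restriction to S.
    Since f vanishes off S, \<open>\<psi> k\<close> can replace \<open>\<phi> k\<close> wherever it
    is multiplied by f.\<close>
  define \<psi> where "\<psi> k x = indicator S x * \<phi> k x" for k x
  have good: "AE x in P. good x" using bnd by (simp add: good_def)
  have \<psi> [measurable]: "\<psi> k \<in> borel_measurable P" for k using meas by (simp add: \<psi>_def[abs_def])
  have fm [measurable]: "f \<in> borel_measurable P" by (rule sq_int_measurable[OF f])
  have fi: "integrable P f" by (rule sq_int_integrable[OF fin f])
  have \<psi>f: "\<phi> k x * f x = \<psi> k x * f x" for k x using supp[of x] by (auto simp: \<psi>_def indicator_def)
  have absum: "(\<Sum>k<N. \<bar>\<phi> k x * \<phi> k y\<bar>) \<le> C" if "good x" "good y" for x y N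
  proof -
    have "\<bar>s * t\<bar> \<le> (s\<^sup>2 + t\<^sup>2) / 2" for s t :: real
    proof -
      have "2 * (\<bar>s\<bar> * \<bar>t\<bar>) \<le> s\<^sup>2 + t\<^sup>2"
        using zero_le_power2[of "\<bar>s\<bar> - \<bar>t\<bar>"] by (simp add: power2_diff)
      then show ?thesis by (simp add: abs_mult)
    qed
    then have "(\<Sum>k<N. \<bar>\<phi> k x * \<phi> k y\<bar>) \<le> (\<Sum>k<N. ((\<phi> k x)\<^sup>2 + (\<phi> k y)\<^sup>2) / 2)" by (intro sum_mono)
    also have "\<dots> = ((\<Sum>k<N. (\<phi> k x)\<^sup>2) + (\<Sum>k<N. (\<phi> k y)\<^sup>2)) / 2"
      by (simp add: sum_divide_distrib sum.distrib add_divide_distrib)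
    also have "\<dots> \<le> (C + C) / 2"
      using that by (intro divide_right_mono add_mono) (auto simp: good_def)
    finally show ?thesis by simp
  qed
  have K_bound: "\<bar>\<Sum>k<N. \<phi> k x * \<phi> k y\<bar> \<le> C" if "good x" "good y" for x y N
    using sum_abs[of "\<lambda>k. \<phi> k x * \<phi> k y" "{..<N}"] absum[OF that, of N] by linarith
  \<comment> \<open>Absolute convergence at good points makes \<open>suminf\<close> a genuine limit
    there instead of a default value.\<close>
  have K_lim: "(\<lambda>N. \<Sum>k<N. \<phi> k x * \<phi> k y) \<longlonglongrightarrow> (\<Sum>k. \<phi> k x * \<phi> k y)" if "good x" "good y" for x y
  proof -
    have "summable (\<lambda>k. \<bar>\<phi> k x * \<phi> k y\<bar>)"
      using absum[OF that] by (intro summableI_nonneg_bounded[where x = C]) auto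
    then have "summable (\<lambda>k. \<phi> k x * \<phi> k y)" by (rule summable_rabs_cancel)
    then show ?thesis by (rule summable_LIMSEQ)
  qed
  have Kf: "(\<Sum>k. \<phi> k x * \<phi> k y) * f y = (\<Sum>k. \<phi> k x * \<psi> k y) * f y" for x y
    using supp[of y] by (auto simp: \<psi>_def indicator_def)
  have i\<psi>: "integrable P (\<lambda>x. \<phi> k x * f x)" for k
    unfolding \<psi>f
  proof (rule Bochner_Integration.integrable_bound[where f = "\<lambda>x. sqrt C * f x"])
    show "integrable P (\<lambda>x. sqrt C * f x)" using fi by simp
    show "AE x in P. norm (\<psi> k x * f x) \<le> norm (sqrt C * f x)"
      using good
    proof eventually_elim
      case (elim x)
      have "(\<phi> k x)\<^sup>2 \<le> (\<Sum>k<Suc k. (\<phi> k x)\<^sup>2)" by (rule member_le_sum) auto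
      also have "\<dots> \<le> C" using elim unfolding good_def by blast
      finally have "\<bar>\<phi> k x\<bar> \<le> sqrt C" by (rule real_le_rsqrt[OF order_trans[OF eq_refl[OF power2_abs]]])
      then have "\<bar>\<psi> k x\<bar> \<le> sqrt C" using elim by (simp add: \<psi>_def good_def)
      then have "\<bar>\<psi> k x\<bar> * \<bar>f x\<bar> \<le> \<bar>sqrt C\<bar> * \<bar>f x\<bar>"
        by (intro mult_right_mono) (auto intro: order_trans[OF _ abs_ge_self])
      then show ?case by (simp only: real_norm_def abs_mult)
    qed
  qed measurable
  define c where "c k = (\<integral>x. \<phi> k x * f x \<partial>P)" for k
  define T where "T x = (\<integral>y. (\<Sum>k. \<phi> k x * \<phi> k y) * f y \<partial>P)" for x
  have partial: "(\<integral>y. (\<Sum>k<N. \<phi> k x * \<phi> k y) * f y \<partial>P) = (\<Sum>k<N. c k * \<phi> k x)" for x N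
  proof -
    have "(\<integral>y. (\<Sum>k<N. \<phi> k x * \<phi> k y) * f y \<partial>P) = (\<integral>y. (\<Sum>k<N. \<phi> k x * (\<phi> k y * f y)) \<partial>P)"
      by (simp add: sum_distrib_right mult.assoc)
    also have "\<dots> = (\<Sum>k<N. c k * \<phi> k x)" using i\<psi> by (simp add: c_def mult.commute)
    finally show ?thesis .
  qed
  have T_lim: "(\<lambda>N. \<Sum>k<N. c k * \<phi> k x) \<longlonglongrightarrow> T x" if x: "good x" for x
    unfolding partial[symmetric] T_def
  proof (rule integral_dominated_convergence[where w = "\<lambda>y. C * \<bar>f y\<bar>"])
    show "(\<lambda>y. (\<Sum>k. \<phi> k x * \<phi> k y) * f y) \<in> borel_measurable P" unfolding Kf by measurable
    have *: "(\<Sum>k<N. \<phi> k x * \<phi> k y) * f y = (\<Sum>k<N. \<phi> k x * \<psi> k y) * f y" for y N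
      using supp[of y] by (auto simp: \<psi>_def indicator_def)
    show "(\<lambda>y. (\<Sum>k<N. \<phi> k x * \<phi> k y) * f y) \<in> borel_measurable P" for N
      unfolding * by measurable
    show "integrable P (\<lambda>y. C * \<bar>f y\<bar>)" using fi by simp
    show "AE y in P. (\<lambda>N. (\<Sum>k<N. \<phi> k x * \<phi> k y) * f y) \<longlonglongrightarrow> (\<Sum>k. \<phi> k x * \<phi> k y) * f y"
      using good by eventually_elim (intro tendsto_mult tendsto_const K_lim[OF x])
    show "AE y in P. norm ((\<Sum>k<N. \<phi> k x * \<phi> k y) * f y) \<le> C * \<bar>f y\<bar>" for N
      using good by eventually_elim (simp only: real_norm_def abs_mult, intro mult_right_mono K_bound[OF x], auto)
  qed
  have T_bound: "\<bar>\<Sum>k<N. c k * \<phi> k x\<bar> \<le> C * (\<integral>y. \<bar>f y\<bar> \<partial>P)" if x: "good x" for x N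
  proof -
    have "\<bar>\<Sum>k<N. c k * \<phi> k x\<bar> \<le> (\<integral>y. \<bar>(\<Sum>k<N. \<phi> k x * \<phi> k y) * f y\<bar> \<partial>P)"
      unfolding partial[symmetric] by (rule integral_abs_bound)
    also have "\<dots> \<le> (\<integral>y. C * \<bar>f y\<bar> \<partial>P)"
    proof (rule integral_mono_AE)
      have "integrable P (\<lambda>y. \<Sum>k<N. \<phi> k x * (\<phi> k y * f y))" using i\<psi> by simp
      then show "integrable P (\<lambda>y. \<bar>(\<Sum>k<N. \<phi> k x * \<phi> k y) * f y\<bar>)"
        by (intro integrable_abs) (simp add: sum_distrib_right mult.assoc)
      show "integrable P (\<lambda>y. C * \<bar>f y\<bar>)" using fi by simp
      show "AE y in P. \<bar>(\<Sum>k<N. \<phi> k x * \<phi> k y) * f y\<bar> \<le> C * \<bar>f y\<bar>"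
        using good by eventually_elim (simp only: abs_mult, intro mult_right_mono K_bound[OF x], auto)
    qed
    finally show ?thesis by simp
  qed
  have "(\<lambda>N. \<integral>x. (\<Sum>k<N. c k * \<phi> k x) * f x \<partial>P) \<longlonglongrightarrow> (\<integral>x. T x * f x \<partial>P)"
  proof (rule integral_dominated_convergence[where w = "\<lambda>x. C * (\<integral>y. \<bar>f y\<bar> \<partial>P) * \<bar>f x\<bar>"])
    have "T \<in> borel_measurable P" using Tm by (simp add: T_def[abs_def])
    then show "(\<lambda>x. T x * f x) \<in> borel_measurable P" by measurable
    have *: "(\<Sum>k<N. c k * \<phi> k y) * f y = (\<Sum>k<N. c k * \<psi> k y) * f y" for y N
      using supp[of y] by (auto simp: \<psi>_def indicator_def)
    show "(\<lambda>x. (\<Sum>k<N. c k * \<phi> k x) * f x) \<in> borel_measurable P" for N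
      unfolding * by measurable
    show "integrable P (\<lambda>x. C * (\<integral>y. \<bar>f y\<bar> \<partial>P) * \<bar>f x\<bar>)" using fi by simp
    show "AE x in P. (\<lambda>N. (\<Sum>k<N. c k * \<phi> k x) * f x) \<longlonglongrightarrow> T x * f x"
      using good by eventually_elim (intro tendsto_mult tendsto_const T_lim)
    show "AE x in P. norm ((\<Sum>k<N. c k * \<phi> k x) * f x) \<le> C * (\<integral>y. \<bar>f y\<bar> \<partial>P) * \<bar>f x\<bar>" for N
      using good by eventually_elim (simp only: real_norm_def abs_mult, intro mult_right_mono T_bound, auto)
  qed
  moreover have "(\<integral>x. (\<Sum>k<N. c k * \<phi> k x) * f x \<partial>P) = (\<Sum>k<N. (c k)\<^sup>2)" for N
  proof -
    have "(\<integral>x. (\<Sum>k<N. c k * \<phi> k x) * f x \<partial>P) = (\<integral>x. (\<Sum>k<N. c k * (\<phi> k x * f x)) \<partial>P)"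
      by (simp add: sum_distrib_right mult.assoc)
    also have "\<dots> = (\<Sum>k<N. (c k)\<^sup>2)" using i\<psi> by (simp add: c_def power2_eq_square)
    finally show ?thesis .
  qed
  ultimately show ?thesis by (simp add: c_def T_def)
qed

section \<open>Comparison of the eigenvalues\<close>

theorem mainTheorem4:
  fixes L lamn mun \<kappa> :: real and s :: nat and \<Omega> :: "(real^'d::finite) set"
    and p :: "('d \<Rightarrow> nat) \<Rightarrow> real^'d \<Rightarrow> real"
    and v :: "nat \<Rightarrow> real^'d \<Rightarrow> real" and av :: "nat \<Rightarrow> real"
    and \<rho> :: "real^'d \<Rightarrow> real" and a b :: "nat \<Rightarrow> real" and m :: nat
  assumes L: "L > 0"
    and dom: "lipschitz_domain \<Omega>" "\<Omega> \<subseteq> cube L"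
    and s: "s > 0" "real s > real CARD('d) / 2"
    and lam: "lamn > 0" and mu: "mun \<ge> 0"
    and p_meas: "\<And>\<alpha>. p \<alpha> \<in> borel_measurable (lebesgue_on \<Omega>)"
    and p_bdd: "\<And>\<alpha>. \<exists>B. \<forall>x\<in>\<Omega>. \<bar>p \<alpha> x\<bar> \<le> B"
    \<comment> \<open>(v m) is an L2-orthonormal eigenbasis of On with eigenvalues av m > 0\<close>
    and v_L2: "\<And>m. sq_int (lebesgue_on (cube (2 * L))) (v m)"
    and v_on: "\<And>m k. (LINT x:cube (2 * L)|lebesgue. v m x * v k x) = (if m = k then 1 else 0)"
    and v_complete: "\<And>f. sq_int (lebesgue_on (cube (2 * L))) f \<Longrightarrow>
          (\<forall>m. (LINT x:cube (2 * L)|lebesgue. f x * v m x) = 0) \<Longrightarrow>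
          AE x in lebesgue_on (cube (2 * L)). f x = 0"
    and av_pos: "\<And>m. av m > 0"
    and v_eig: "\<And>m. AE x in lebesgue_on (cube (2 * L)).
                  On L s \<Omega> p lamn mun (v m) x = av m * v m x"
    \<comment> \<open>P_X has a density rho on Omega bounded by kappa\<close>
    and \<rho>_meas: "\<rho> \<in> borel_measurable lebesgue"
    and \<rho>_nonneg: "\<And>x. \<rho> x \<ge> 0"
    and \<rho>_supp: "\<And>x. x \<notin> \<Omega> \<Longrightarrow> \<rho> x = 0"
    and \<rho>_int: "integrable lebesgue \<rho>" "(\<integral>x. \<rho> x \<partial>lebesgue) = 1"
    and \<kappa>: "\<kappa> > 0" "\<And>x. x \<in> \<Omega> \<Longrightarrow> \<rho> x \<le> \<kappa>"
    \<comment> \<open>eigenvalues in non-increasing order\<close>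
    and a: "eigenvalues_desc (density lebesgue (\<lambda>x. ennreal (\<rho> x)))
              (intop (density lebesgue (\<lambda>x. ennreal (\<rho> x))) (kernelK av v)) a"
    and b: "eigenvalues_desc (lebesgue_on (cube (2 * L))) (COC L s \<Omega> p lamn mun) b"
  shows "a m \<le> \<kappa> * b m"
proof -
  let ?P = "density lebesgue (\<lambda>x. ennreal (\<rho> x))"
  let ?Q = "lebesgue_on (cube (2 * L)) :: (real^'d) measure"
  let ?O = "On L s \<Omega> p lamn mun"
  let ?T = "intop ?P (kernelK av v)"
  have Om: "\<Omega> \<in> sets lebesgue" using dom(1) by (auto simp: lipschitz_domain_def)
  interpret F: sobolev_form L s \<Omega> p lamn mun
    using L Om dom(2) s lam mu p_meas p_bdd by unfold_locales auto
  have Om2: "\<Omega> \<subseteq> cube (2 * L)" by (rule F.Om_subset)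
  have \<rho>_le: "(\<rho> x)\<^sup>2 \<le> \<kappa> * \<rho> x" for x
    using \<kappa>(2)[of x] \<rho>_nonneg[of x] \<rho>_supp[of x] \<kappa>(1)
    by (cases "x \<in> \<Omega>") (auto simp: power2_eq_square intro: mult_right_mono)
  have P_integral: "(\<integral>x. q x \<partial>?P) = (\<integral>x. \<rho> x * q x \<partial>lebesgue)"
    and P_integrable: "integrable ?P q \<longleftrightarrow> integrable lebesgue (\<lambda>x. \<rho> x * q x)"
    if "q \<in> borel_measurable lebesgue" for q :: "real^'d \<Rightarrow> real"
    using that \<rho>_meas \<rho>_nonneg by (simp_all add: integral_density integrable_density)
  have P_fin: "finite_measure ?P"
  proof (rule finite_measureI)
    have "emeasure ?P (space ?P) = (\<integral>\<^sup>+x. ennreal (\<rho> x) \<partial>lebesgue)"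
      using \<rho>_meas by (simp add: emeasure_density)
    also have "\<dots> = ennreal 1" using \<rho>_int \<rho>_nonneg by (simp add: nn_integral_eq_integral)
    finally show "emeasure ?P (space ?P) \<noteq> \<infinity>" by simp
  qed
  \<comment> \<open>P_X is absolutely continuous and charges only points with positive density, all
    of which lie in \<Omega>.\<close>
  have AE_P: "AE x in ?P. q x" if "AE x in lebesgue_on \<Omega>. q x" for q
  proof -
    have "AE x in lebesgue. x \<in> \<Omega> \<longrightarrow> q x" using that Om by (subst (asm) AE_restrict_space_iff) auto
    then have "AE x in lebesgue. 0 < ennreal (\<rho> x) \<longrightarrow> q x"
      by eventually_elim (use \<rho>_supp in force)
    then show ?thesis using \<rho>_meas by (subst AE_density) auto
  qed
  have P_Om: "AE x in ?P. x \<in> \<Omega>" by (rule AE_P) (simp add: AE_restrict_space_iff Om)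

  have weighted: "sq_int ?Q (\<lambda>x. \<rho> x * q x)"
    "(\<integral>x. (\<rho> x * q x)\<^sup>2 \<partial>?Q) \<le> \<kappa> * (\<integral>x. (q x)\<^sup>2 \<partial>?P)" if q: "sq_int ?P q" for q
  proof -
    have qm [measurable]: "q \<in> borel_measurable lebesgue" using sq_int_measurable[OF q] by simp
    have [measurable]: "\<rho> \<in> borel_measurable lebesgue" by (rule \<rho>_meas)
    have i: "integrable lebesgue (\<lambda>x. \<rho> x * (q x)\<^sup>2)"
      using q P_integrable[of "\<lambda>x. (q x)\<^sup>2"] by (simp add: sq_int_def)
    have le: "(\<rho> x * q x)\<^sup>2 \<le> \<kappa> * (\<rho> x * (q x)\<^sup>2)" for x
      using mult_right_mono[OF \<rho>_le[of x], of "(q x)\<^sup>2"] by (simp add: power_mult_distrib mult.assoc)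
    have i2: "integrable lebesgue (\<lambda>x. (\<rho> x * q x)\<^sup>2)"
      by (rule Bochner_Integration.integrable_bound[where f = "\<lambda>x. \<kappa> * (\<rho> x * (q x)\<^sup>2)"])
        (use i le in \<open>auto intro!: AE_I2 order_trans[OF _ abs_ge_self]\<close>)
    have e: "indicator (cube (2 * L)) x * (\<rho> x * q x) = \<rho> x * q x" for x
      using Om2 \<rho>_supp[of x] by (auto simp: indicator_def)
    show "sq_int ?Q (\<lambda>x. \<rho> x * q x)"
      unfolding sq_int_lebesgue_on_iff[OF cube_lmeasurable(3)] e using i2 by (simp add: sq_int_def)
    have "(\<integral>x. (\<rho> x * q x)\<^sup>2 \<partial>?Q) = (\<integral>x. (\<rho> x * q x)\<^sup>2 \<partial>lebesgue)"
      by (simp add: integral_square_lebesgue_on e)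
    also have "\<dots> \<le> (\<integral>x. \<kappa> * (\<rho> x * (q x)\<^sup>2) \<partial>lebesgue)"
      using i by (intro integral_mono[OF i2] le) simp
    also have "\<dots> = \<kappa> * (\<integral>x. (q x)\<^sup>2 \<partial>?P)" by (simp add: P_integral)
    finally show "(\<integral>x. (\<rho> x * q x)\<^sup>2 \<partial>?Q) \<le> \<kappa> * (\<integral>x. (q x)\<^sup>2 \<partial>?P)" .
  qed

  obtain g where g: "\<And>k. sq_int ?P (g k)"
    and lower: "\<And>f c m. sq_int ?P f \<Longrightarrow> (AE x in ?P. f x = (\<Sum>k\<le>m. c k * g k x)) \<Longrightarrow>
       a m * (\<integral>x. (f x)\<^sup>2 \<partial>?P) \<le> (\<integral>x. ?T f x * f x \<partial>?P) \<and> (\<integral>x. (f x)\<^sup>2 \<partial>?P) = (\<Sum>k\<le>m. (c k)\<^sup>2)"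
    and T: "\<And>f. sq_int ?P f \<Longrightarrow> sq_int ?P (?T f)"
    by (rule eigenvalues_desc_lower[OF a]) (rule that; assumption)
  obtain e where e: "\<And>k. sq_int ?Q (e k)"
    and upper: "\<And>h m. sq_int ?Q h \<Longrightarrow> \<forall>j<m. (\<integral>x. h x * e j x \<partial>?Q) = 0 \<Longrightarrow>
       (\<integral>x. COC L s \<Omega> p lamn mun h x * h x \<partial>?Q) \<le> b m * (\<integral>x. (h x)\<^sup>2 \<partial>?Q)"
    by (rule eigenvalues_desc_upper[OF b]) (rule that; assumption)
  \<comment> \<open>Orthogonality is imposed in the cube on the weighted functions
    \<open>\<rho> * g k\<close>: m conditions on m + 1 coefficients.\<close>
  obtain c where c: "\<exists>k\<le>m. c k \<noteq> 0"
    "\<And>i. i < m \<Longrightarrow> (\<Sum>k\<le>m. (\<integral>x. (\<rho> x * g k x) * e i x \<partial>?Q) * c k) = 0"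
    using nontrivial_solution[of m "\<lambda>i k. \<integral>x. (\<rho> x * g k x) * e i x \<partial>?Q"] by blast
  define S where "S = (\<Sum>k\<le>m. (c k)\<^sup>2)"
  have S: "S > 0" unfolding S_def using c(1) by (auto intro!: sum_pos2)
  \<comment> \<open>The cut-off changes the combination only on a P_X-null set, and makes f and h
    vanish everywhere outside \<Omega>, so that the operator C leaves h unchanged pointwise.\<close>
  define f where "f x = indicator \<Omega> x * (\<Sum>k\<le>m. c k * g k x)" for x
  define h where "h x = \<rho> x * f x" for x
  have f: "sq_int ?P f"
    unfolding f_def[abs_def] using Om
    by (intro sq_int_mult_bounded[where C = 1] sq_int_sum sq_int_cmult g) (auto simp: indicator_def)
  have f_AE: "AE x in ?P. f x = (\<Sum>k\<le>m. c k * g k x)"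
    using P_Om by eventually_elim (simp add: f_def)
  have f0: "f x = 0" if "x \<notin> \<Omega>" for x using that by (simp add: f_def)
  have h: "sq_int ?Q h" and h_norm: "(\<integral>x. (h x)\<^sup>2 \<partial>?Q) \<le> \<kappa> * (\<integral>x. (f x)\<^sup>2 \<partial>?P)"
    using weighted[OF f] by (simp_all add: h_def[abs_def])
  have h0: "h x = 0" if "x \<notin> \<Omega>" for x using that by (simp add: h_def f0)
  have orth: "(\<integral>x. h x * e i x \<partial>?Q) = 0" if "i < m" for i
  proof -
    have h_eq: "h x = (\<Sum>k\<le>m. c k * (\<rho> x * g k x))" for x
      using \<rho>_supp[of x] by (cases "x \<in> \<Omega>") (simp_all add: h_def f_def sum_distrib_left mult_ac)
    have "(\<integral>x. h x * e i x \<partial>?Q) = (\<integral>x. (\<Sum>k\<le>m. c k * ((\<rho> x * g k x) * e i x)) \<partial>?Q)"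
      by (simp only: h_eq sum_distrib_right mult.assoc)
    also have "\<dots> = (\<Sum>k\<le>m. c k * (\<integral>x. (\<rho> x * g k x) * e i x \<partial>?Q))"
      using sq_int_mult[OF weighted(1)[OF g] e] by simp
    finally show ?thesis using c(2)[OF that] by (simp add: mult.commute)
  qed

  \<comment> \<open>\<open>\<langle>L\<^sub>K f, f\<rangle>\<close> over \<open>P\<^sub>X\<close> is bounded by \<open>\<langle>O\<^sub>n h, h\<rangle>\<close>: the normalised eigenfunctions \<open>w\<close> are
    orthonormal for the energy form, whose evaluation functionals are bounded on \<open>\<Omega>\<close>.\<close>
  have quad: "(\<integral>x. ?T f x * f x \<partial>?P) \<le> (\<integral>x. ?O h x * h x \<partial>?Q)"
  proof -
    define z where "z k = ?O (v k)" for k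
    \<comment> \<open>The energy product of \<open>z k\<close> and \<open>z j\<close> is
      \<open>av j\<close> for j = k and 0 otherwise, so division by \<open>sqrt (av k)\<close>
      normalises. The added 0 fits the closure rule for \<open>c * u + v\<close>.\<close>
    define w where "w k = (\<lambda>x. inverse (sqrt (av k)) * z k x + 0)" for k
    have z: "z k \<in> Hper L s" for k unfolding z_def by (rule F.On_spec(1)[OF v_L2])
    have w: "w k \<in> Hper L s" for k unfolding w_def by (rule F.Hper_lincomb(1)[OF z F.Hper_zero])
    have wv: "AE x in ?Q. w k x = sqrt (av k) * v k x" for k
      using v_eig[of k]
    proof eventually_elim
      case (elim x)
      have "inverse (sqrt (av k)) * av k = sqrt (av k)"
        using av_pos[of k] by (simp add: field_simps)
      then show ?case by (simp add: w_def z_def elim flip: mult.assoc)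
    qed
    have B0: "F.B (\<lambda>x. 0) u = 0" if "u \<in> Hper L s" for u
      using F.B_lincomb[OF F.Hper_zero F.Hper_zero that, of "-1"] by simp
    have w_pair: "(\<integral>x. w j x * q x \<partial>?Q) = sqrt (av j) * (\<integral>x. v j x * q x \<partial>?Q)" if q: "sq_int ?Q q" for j q
    proof -
      have "(\<integral>x. w j x * q x \<partial>?Q) = (\<integral>x. sqrt (av j) * (v j x * q x) \<partial>?Q)"
      proof (rule integral_cong_AE)
        show "(\<lambda>x. w j x * q x) \<in> borel_measurable ?Q" "(\<lambda>x. sqrt (av j) * (v j x * q x)) \<in> borel_measurable ?Q"
          using sq_int_measurable[OF q] sq_int_measurable[OF v_L2] sq_int_measurable[OF F.Hper_sq_int[OF w]]
          by simp_all
        show "AE x in ?Q. w j x * q x = sqrt (av j) * (v j x * q x)"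
          using wv[of j] by eventually_elim simp
      qed
      then show ?thesis by simp
    qed
    have w_on: "F.B (w k) (w j) = (if k = j then 1 else 0)" for k j
    proof -
      have "F.B (w k) (w j) = inverse (sqrt (av k)) * F.B (z k) (w j)"
        unfolding w_def[of k] using F.B_lincomb[OF z F.Hper_zero w, of "inverse (sqrt (av k))" k j] B0[OF w] by simp
      also have "F.B (z k) (w j) = (\<integral>x. w j x * v k x \<partial>?Q)"
        unfolding z_def by (rule F.On_spec(2)[OF v_L2 w])
      also have "\<dots> = sqrt (av j) * (if j = k then 1 else 0)"
        using v_on[of j k] by (simp add: w_pair[OF v_L2] set_integral_lebesgue_on)
      finally show ?thesis using av_pos[of k] by auto
    qed
    obtain C where C: "\<And>w. \<forall>k::nat. w k \<in> Hper L s \<Longrightarrow> \<forall>k j. F.B (w k) (w j) = (if k = j then 1 else 0) \<Longrightarrow>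
        AE x in lebesgue_on (cube L). \<forall>N. (\<Sum>k<N. (w k x)\<^sup>2) \<le> C"
      by (rule F.evaluation_bound) (rule that; assumption)
    \<comment> \<open>The kernel is built from the given representatives \<open>v k\<close>, the
      evaluation bound speaks of the Sobolev functions \<open>w k\<close>. They agree a.e., for all
      k at once since there are countably many.\<close>
    define \<phi> where "\<phi> k x = sqrt (av k) * v k x" for k x
    have bound: "AE x in ?P. x \<in> \<Omega> \<and> (\<forall>N. (\<Sum>k<N. (\<phi> k x)\<^sup>2) \<le> C)"
    proof -
      have "AE x in lebesgue_on \<Omega>. \<forall>N. (\<Sum>k<N. (w k x)\<^sup>2) \<le> C"
        by (rule AE_lebesgue_on_subset[OF C dom(2)]) (simp_all add: Om w w_on)
      moreover have "AE x in lebesgue_on \<Omega>. \<forall>k. w k x = \<phi> k x"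
        unfolding AE_all_countable \<phi>_def
        by (intro allI AE_lebesgue_on_subset[OF wv Om2]) (simp_all add: Om)
      ultimately have "AE x in lebesgue_on \<Omega>. \<forall>N. (\<Sum>k<N. (\<phi> k x)\<^sup>2) \<le> C" by eventually_elim simp
      from AE_P[OF this] P_Om show ?thesis by eventually_elim simp
    qed
    have \<phi>m: "(\<lambda>x. indicator \<Omega> x * \<phi> k x) \<in> borel_measurable lebesgue" for k
    proof -
      have "v k \<in> borel_measurable (lebesgue_on \<Omega>)"
        using sq_int_measurable[OF v_L2] Om2 by (rule measurable_restrict_mono)
      then have "(\<lambda>x. indicator \<Omega> x *\<^sub>R v k x) \<in> borel_measurable lebesgue"
        using Om by (simp add: borel_measurable_restrict_space_iff)
      from borel_measurable_times[OF borel_measurable_const[of "sqrt (av k)"] this] show ?thesis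
        by (simp add: \<phi>_def mult_ac)
    qed
    have T_eq: "?T q = (\<lambda>x. \<integral>y. (\<Sum>k. \<phi> k x * \<phi> k y) * q y \<partial>?P)" for q
    proof -
      have "\<phi> k x * \<phi> k y = av k * v k x * v k y" for k x y
        using av_pos[of k] by (simp add: \<phi>_def mult_ac flip: real_sqrt_mult)
      then show ?thesis by (simp add: intop_def kernelK_def)
    qed
    have "(\<lambda>N. \<Sum>k<N. (\<integral>x. \<phi> k x * f x \<partial>?P)\<^sup>2) \<longlonglongrightarrow> (\<integral>x. ?T f x * f x \<partial>?P)"
      unfolding T_eq
      by (rule kernel_quadratic_form[OF P_fin _ _ bound f f0])
        (use Om \<phi>m sq_int_measurable[OF T[OF f]] in \<open>simp_all add: T_eq\<close>)
    moreover have "(\<Sum>k<N. (\<integral>x. \<phi> k x * f x \<partial>?P)\<^sup>2) \<le> (\<integral>x. ?O h x * h x \<partial>?Q)" for N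
    proof -
      have Oh: "?O h \<in> Hper L s" by (rule F.On_spec(1)[OF h])
      \<comment> \<open>The density moves from the measure into h; the resulting pairing of
        \<open>w k\<close> with h is an energy product by the defining equation of
        \<open>?O h\<close>, and Bessel's inequality becomes applicable.\<close>
      have "(\<integral>x. \<phi> k x * f x \<partial>?P) = F.B (w k) (?O h)" for k
      proof -
        have e: "\<phi> k x * f x = (indicator \<Omega> x * \<phi> k x) * f x" for x using f0[of x] by (auto simp: indicator_def)
        have fm: "f \<in> borel_measurable lebesgue" using sq_int_measurable[OF f] by simp
        have "(\<integral>x. \<phi> k x * f x \<partial>?P) = (\<integral>x. \<rho> x * (\<phi> k x * f x) \<partial>lebesgue)"
          by (rule P_integral) (simp only: e borel_measurable_times[OF \<phi>m fm])
        also have "\<dots> = (\<integral>x. indicator (cube (2 * L)) x *\<^sub>R (sqrt (av k) * (v k x * h x)) \<partial>lebesgue)"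
        proof (intro Bochner_Integration.integral_cong refl)
          fix x
          show "\<rho> x * (\<phi> k x * f x) = indicator (cube (2 * L)) x *\<^sub>R (sqrt (av k) * (v k x * h x))"
            using Om2 f0[of x] by (cases "x \<in> \<Omega>") (auto simp: h_def \<phi>_def)
        qed
        also have "\<dots> = sqrt (av k) * (\<integral>x. v k x * h x \<partial>?Q)"
          by (subst integral_restrict_space[symmetric]) simp_all
        also have "\<dots> = (\<integral>x. w k x * h x \<partial>?Q)" by (simp add: w_pair[OF h])
        also have "\<dots> = F.B (?O h) (w k)" by (rule F.On_spec(2)[OF h w, symmetric])
        finally show ?thesis by (simp only: F.B_sym[of "w k"])
      qed
      then have "(\<Sum>k<N. (\<integral>x. \<phi> k x * f x \<partial>?P)\<^sup>2) \<le> F.B (?O h) (?O h)"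
        using F.B_bessel[OF w w_on Oh, of N] by simp
      also have "\<dots> = (\<integral>x. ?O h x * h x \<partial>?Q)" by (rule F.On_spec(2)[OF h Oh])
      finally show ?thesis .
    qed
    ultimately show ?thesis by (intro LIMSEQ_le_const2) auto
  qed

  have COC_h: "COC L s \<Omega> p lamn mun h x * h x = ?O h x * h x" for x
  proof -
    have "(\<lambda>y. indicator \<Omega> y * h y) = h" using h0 by (auto simp: fun_eq_iff indicator_def)
    then show ?thesis using h0[of x] by (auto simp: COC_def indicator_def)
  qed
  have f_norm: "(\<integral>x. (f x)\<^sup>2 \<partial>?P) = S" and f_form: "a m * S \<le> (\<integral>x. ?T f x * f x \<partial>?P)"
    using lower[OF f f_AE] by (auto simp: S_def)
  note f_form
  also note quad
  also have "(\<integral>x. ?O h x * h x \<partial>?Q) \<le> b m * (\<integral>x. (h x)\<^sup>2 \<partial>?Q)"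
    unfolding COC_h[symmetric] by (rule upper[OF h]) (use orth in blast)
  also have "\<dots> \<le> b m * (\<kappa> * S)"
    using b h_norm unfolding f_norm by (intro mult_left_mono) (auto simp: eigenvalues_desc_def)
  finally have "a m * S \<le> (\<kappa> * b m) * S" by (simp only: mult_ac)
  then show ?thesis using S by (simp only: mult_le_cancel_right_pos)
qed

end
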